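(* For $l\in\{0,1\}$ and $n\in\mathbb{N}$, $$\Phi_2^{\mathrm{Rev}}(1+l+\rho_n,-l;1,\Lambda)=-(\log 2\pi)\,\zeta(1+\rho_n)+\frac{\pi\,l!\,\mathrm{ord}(\rho_n)}{(\rho_n)_{l+1}\,\sin(\pi\rho_n)}+\sum_{\substack{1\le k\le l\\ k\ \mathrm{odd}}}\binom{l}{k}M(-k)\,\zeta(1+k+\rho_n).$$
   Context: $\mathbb{N}=\{1,2,3,\dots\}$. $\zeta$ is the Riemann zeta function and $M(s)=-\zeta'(s)/\zeta(s)$. $\{\rho_n\}_{n\ge1}$ are the (distinct) non-trivial zeros of $\zeta(s)$, numbered by the size of the absolute values of their imaginary parts, and $\mathrm{ord}(\rho_n)$ is the order of $\rho_n$ as a zero of $\zeta$. $(s)_k=s(s+1)(s+2)\cdots(s+k-1)$. $\Lambda$ is the von Mangoldt function: $\Lambda(n)=\log p$ if $n=p^j$ with $p$ prime and $j\in\mathbb{N}$, and $\Lambda(n)=0$ otherwise. $\Phi_2(s_1,s_2;1,\Lambda)$ denotes the meromorphic continuation to $\mathbb{C}^2$ (known to exist) of the double series $\sum_{m_1=1}^\infty\sum_{m_2=1}^\infty\frac{\Lambda(m_2)}{m_1^{s_1}(m_1+m_2)^{s_2}}$, which converges absolutely for $\Re s_2>1$, $\Re(s_1+s_2)>2$. Its reverse value at $(u_1,u_2)$ is the iterated limit $$\Phi_2^{\mathrm{Rev}}(u_1,u_2;1,\Lambda)=\lim_{s_2\to u_2}\ \lim_{s_1\to u_1}\Phi_2(s_1,s_2;1,\Lambda).$$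 *)

theory Defs
  imports
    "HOL-Complex_Analysis.Complex_Analysis"
    "HOL-Number_Theory.Prime_Powers"
begin

text \<open>
  The Riemann zeta function is the unique holomorphic continuation to the punctured plane of its
  Dirichlet series. The value at the pole is a convention that only serves to make the function
  total (and hence the description unique).
\<close>

definition zeta :: "complex \<Rightarrow> complex" where
  "zeta = (THE f. f holomorphic_on - {1} \<and> f 1 = 0 \<and>
                  (\<forall>s. Re s > 1 \<longrightarrow> f s = (\<Sum>n. 1 / of_nat (Suc n) powr s)))"

definition zeta_M :: "complex \<Rightarrow> complex" where
  "zeta_M s = - deriv zeta s / zeta s"

text \<open>The pole has to be excluded because of the convention for its value.\<close>

definition nontrivial_zeros :: "complex set" where
  "nontrivial_zeros =
     {s. s \<noteq> 1 \<and> zeta s = 0 \<and> (\<forall>k::nat. k \<ge> 1 \<longrightarrow> s \<noteq> - 2 * of_nat k)}"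

text \<open>
  Sequences are indexed from 1, the value at 0 is irrelevant. Zeros whose imaginary parts
  have the same absolute value (such as conjugate ones) may come in any order.
\<close>

definition zero_numbering :: "(nat \<Rightarrow> complex) \<Rightarrow> bool" where
  "zero_numbering \<rho> \<longleftrightarrow>
     bij_betw \<rho> {1..} nontrivial_zeros \<and>
     (\<forall>m n. 1 \<le> m \<and> m \<le> n \<longrightarrow> \<bar>Im (\<rho> m)\<bar> \<le> \<bar>Im (\<rho> n)\<bar>)"

definition holomorphic2_on :: "(complex \<times> complex \<Rightarrow> complex) \<Rightarrow> (complex \<times> complex) set \<Rightarrow> bool" where
  "holomorphic2_on f U \<longleftrightarrow>
     (\<forall>p\<in>U. \<exists>a b. (f has_derivative (\<lambda>(x, y). a * x + b * y)) (at p within U))"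

text \<open>
  Meromorphic functions of two variables are locally quotients of holomorphic functions whose
  denominator does not vanish identically on any nonempty open set. As functions are total, this
  leaves open the values on the zero set of the denominators, a thin analytic set; iterated limits
  over punctured neighbourhoods, as in the reverse value below, are not affected by these values.
\<close>

definition meromorphic2 :: "(complex \<times> complex \<Rightarrow> complex) \<Rightarrow> bool" where
  "meromorphic2 F \<longleftrightarrow>
     (\<forall>p. \<exists>U g h. open U \<and> p \<in> U \<and> holomorphic2_on g U \<and> holomorphic2_on h U \<and>
        (\<forall>V. open V \<and> V \<noteq> {} \<and> V \<subseteq> U \<longrightarrow> (\<exists>q\<in>V. h q \<noteq> 0)) \<and>
        (\<forall>q\<in>U. h q \<noteq> 0 \<longrightarrow> F q = g q / h q))"

definition Phi2_series :: "complex \<Rightarrow> complex \<Rightarrow> complex" where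
  "Phi2_series s1 s2 =
     (\<Sum>\<^sub>\<infinity>(m1, m2)\<in>{1..} \<times> {1..}. mangoldt m2 / (of_nat m1 powr s1 * of_nat (m1 + m2) powr s2))"

text \<open>Such a continuation is unique up to its values on a thin analytic set.\<close>

definition is_Phi2 :: "(complex \<times> complex \<Rightarrow> complex) \<Rightarrow> bool" where
  "is_Phi2 \<Phi> \<longleftrightarrow> meromorphic2 \<Phi> \<and>
     (\<forall>s1 s2. Re s2 > 1 \<and> Re (s1 + s2) > 2 \<longrightarrow> \<Phi> (s1, s2) = Phi2_series s1 s2)"

text \<open>
  Both limits are required to exist, the inner one for all \<open>s2 \<noteq> u2\<close> sufficiently close to \<open>u2\<close>.
\<close>

definition has_reverse_value ::
    "(complex \<times> complex \<Rightarrow> complex) \<Rightarrow> complex \<Rightarrow> complex \<Rightarrow> complex \<Rightarrow> bool" where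
  "has_reverse_value F u1 u2 L \<longleftrightarrow>
     (\<exists>G. (\<forall>\<^sub>F s2 in at u2. ((\<lambda>s1. F (s1, s2)) \<longlongrightarrow> G s2) (at u1)) \<and> (G \<longlongrightarrow> L) (at u2))"

end

theory Submission
  imports Defs "HOL-Real_Asymp.Real_Asymp"
begin

text \<open>
  Write \<open>Li\<^sub>s(e\<^sup>-\<^sup>t)\<close> for the sum of \<open>m\<^sup>-\<^sup>s e\<^sup>-\<^sup>m\<^sup>t\<close>. The difference of this and \<open>\<Gamma>(1 - s) t\<^sup>s\<^sup>-\<^sup>1\<close> has
  at \<open>t = 0\<close> the expansion with terms \<open>\<zeta>(s - k) (-t)\<^sup>k / k!\<close>; this also yields the continuation of \<open>\<zeta>\<close>.
  Integrating the expansion against \<open>t\<^bsup>s2 - 1\<^esup> e\<^sup>-\<^sup>n\<^sup>t\<close> and summing over \<open>n\<close> with weights \<open>\<Lambda>(n)\<close> gives, with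
  \<open>w = s1 + s2 - 1\<close>,
  \<open>\<Phi>\<^sub>2(s1, s2) = \<Gamma>(1 - s1) \<Gamma>(w) M(w) / \<Gamma>(s2) + (\<Sum>k<4. (-1)\<^sup>k / k! (s2)\<^sub>k \<zeta>(s1 - k) M(s2 + k)) + E(s1, s2) / \<Gamma>(s2)\<close>
  where \<open>E\<close> is holomorphic for \<open>Re s2 > -2\<close>, so that no sum over zeros and no functional equation is
  needed. By the identity theorem every meromorphic continuation agrees with the right-hand side.
  At \<open>s1 = 1 + l + \<rho>\<close>, \<open>s2 \<rightarrow> -l\<close> the zero of \<open>1 / \<Gamma>\<close> cancels the pole of \<open>M(w)\<close> at \<open>\<rho>\<close>, which leaves the
  term with \<open>ord(\<rho>)\<close>, and kills \<open>E\<close>; the term \<open>k = l + 1\<close> contains the factor \<open>\<zeta>(\<rho>) = 0\<close>.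
\<close>

subsection \<open>Integrals over the half-line\<close>

text \<open>Three obstacles shape the proof. The expansion at t = 0 has to be uniform in
  \<open>s\<close>: differentiation in t lowers \<open>s\<close> by 1, so boundedness for Re s < 1
  can be integrated upwards, and each integration gains one power of t, with a value of zeta as
  constant of integration. Poles on both sides and the free values of a meromorphic function force
  the comparison with \<open>\<Phi>\<close> into a cross-multiplied form, which calls for holomorphy
  in each variable separately. Finally \<open>s1 = 1 + l + \<rho>\<close> must avoid the positive
  integers, where the expansion breaks down, so it must be shown that zeta has no integer zeros
  besides the trivial ones. The number 4 of terms stems from the crude estimate \<Lambda>(m) \<le>
  m: with n terms the remainder is controlled for Re s2 > 2 - n, and n = 4 is the least n that
  admits \<open>s2 = -1\<close>. As l \<le> 1, the values of M at -l, ..., 0 stay clear of the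
  trivial zeros.\<close>

lemma holomorphic_on_lebesgue_integral:
  fixes F :: "complex \<Rightarrow> 'a \<Rightarrow> complex"
  assumes S: "open S"
    and hol: "\<And>t. t \<in> space M \<Longrightarrow> (\<lambda>z. F z t) holomorphic_on S"
    and meas: "\<And>z. z \<in> S \<Longrightarrow> F z \<in> borel_measurable M"
    and dom: "\<And>z. z \<in> S \<Longrightarrow> \<exists>r>0. \<exists>g. integrable M g \<and> ball z r \<subseteq> S \<and>
                (\<forall>y\<in>ball z r. \<forall>t\<in>space M. norm (F y t) \<le> g t)"
  shows "(\<lambda>z. \<integral>t. F z t \<partial>M) holomorphic_on S"
proof -
  have "(\<lambda>z. \<integral>t. F z t \<partial>M) field_differentiable at z" if z: "z \<in> S" for z
  proof -
    obtain r g where r: "r > 0" "ball z r \<subseteq> S" and g: "integrable M g"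
      and le: "\<And>y t. y \<in> ball z r \<Longrightarrow> t \<in> space M \<Longrightarrow> norm (F y t) \<le> g t"
      using dom[OF z] by metis
    \<comment> \<open>With half the radius, a disc of radius r / 2 about any point of
      \<open>B\<close> stays where \<open>g\<close> dominates, as the Cauchy estimate below
      requires.\<close>
    define B where "B = ball z (r / 2)"
    have zB: "z \<in> B" and B: "open B" "convex B" using r by (auto simp: B_def)
    have BS: "B \<subseteq> S" and Bz: "B \<subseteq> ball z r" using r by (auto simp: B_def)
    define D where "D t = deriv (\<lambda>y. F y t) z" for t
    have int: "integrable M (F y)" if "y \<in> B" for y
      by (rule Bochner_Integration.integrable_bound[OF g meas])
         (use that BS Bz le in \<open>auto intro!: AE_I2 simp: real_norm_def intro: order_trans[OF le abs_ge_self]\<close>)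
    \<comment> \<open>Cauchy's inequality bounds the derivative by 2 / r * g t on the convex set
      \<open>B\<close>, hence also the difference quotient; this is the majorant for dominated
      convergence.\<close>
    have bound: "norm ((F y t - F z t) / (y - z)) \<le> 2 / r * g t"
      if y: "y \<in> B" "y \<noteq> z" and t: "t \<in> space M" for y t
    proof -
      have d: "((\<lambda>y. F y t) has_field_derivative deriv (\<lambda>y. F y t) x) (at x within B)" if "x \<in> B" for x
        using hol[OF t] S that BS by (meson holomorphic_derivI has_field_derivative_at_within subsetD)
      have b: "norm (deriv (\<lambda>y. F y t) x) \<le> 2 / r * g t" if x: "x \<in> B" for x
      proof -
        have sub: "cball x (r / 2) \<subseteq> ball z r"
        proof
          fix u assume "u \<in> cball x (r / 2)"
          then show "u \<in> ball z r"
            using x dist_triangle[of z u x] by (simp add: B_def)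
        qed
        have "norm ((deriv ^^ 1) (\<lambda>y. F y t) x) \<le> fact 1 * g t / (r / 2) ^ 1"
        proof (rule Cauchy_inequality)
          show "(\<lambda>y. F y t) holomorphic_on ball x (r / 2)"
            using sub r by (intro holomorphic_on_subset[OF hol[OF t]]) (use ball_subset_cball in blast)
          show "continuous_on (cball x (r / 2)) (\<lambda>y. F y t)"
            using sub r by (intro holomorphic_on_imp_continuous_on holomorphic_on_subset[OF hol[OF t]]) auto
          fix u assume "norm (x - u) = r / 2"
          then show "norm (F u t) \<le> g t"
            using sub t by (intro le) (auto simp: dist_norm subset_iff)
        qed (use r in auto)
        then show ?thesis by (simp add: field_simps)
      qed
      have "norm (F y t - F z t) \<le> 2 / r * g t * norm (y - z)"
        by (rule field_differentiable_bound[OF B(2) d b]) (use y zB in auto)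
      then show ?thesis using y by (simp add: norm_divide field_simps)
    qed
    have "((\<lambda>y. ((\<integral>t. F y t \<partial>M) - (\<integral>t. F z t \<partial>M)) / (y - z)) \<longlongrightarrow> (\<integral>t. D t \<partial>M)) (at z within B)"
      unfolding tendsto_at_iff_sequentially
    proof (intro allI impI)
      fix X assume X: "\<forall>i. X i \<in> B - {z}" "X \<longlonglongrightarrow> z"
      define q where "q i t = (F (X i) t - F z t) / (X i - z)" for i t
      have qm: "q i \<in> borel_measurable M" for i
        unfolding q_def using X(1) zB BS by (intro borel_measurable_divide borel_measurable_diff meas) auto
      have qlim: "(\<lambda>i. q i t) \<longlonglongrightarrow> D t" if t: "t \<in> space M" for t
      proof -
        have "((\<lambda>y. F y t) has_field_derivative D t) (at z)"
          unfolding D_def using hol[OF t] S z by (meson holomorphic_derivI)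
        then have "((\<lambda>y. (F y t - F z t) / (y - z)) \<longlongrightarrow> D t) (at z within B)"
          unfolding has_field_derivative_iff by (rule tendsto_within_subset) auto
        then show ?thesis
          using X unfolding tendsto_at_iff_sequentially q_def o_def by blast
      qed
      have "(\<lambda>i. \<integral>t. q i t \<partial>M) \<longlonglongrightarrow> (\<integral>t. D t \<partial>M)"
      proof (rule integral_dominated_convergence[where w = "\<lambda>t. 2 / r * g t"])
        show "D \<in> borel_measurable M" by (rule borel_measurable_LIMSEQ_metric[OF qm qlim])
        show "integrable M (\<lambda>t. 2 / r * g t)" using g by simp
        show "AE t in M. norm (q i t) \<le> 2 / r * g t" for i
          using X(1) by (intro AE_I2) (auto simp: q_def simp del: norm_divide intro!: bound[simplified])
      qed (use qm qlim in auto)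
      moreover have "(\<integral>t. q i t \<partial>M) = ((\<integral>t. F (X i) t \<partial>M) - (\<integral>t. F z t \<partial>M)) / (X i - z)" for i
        unfolding q_def using X(1) zB by (subst integral_divide_zero) (auto simp: Bochner_Integration.integral_diff int)
      ultimately show "((\<lambda>y. ((\<integral>t. F y t \<partial>M) - (\<integral>t. F z t \<partial>M)) / (y - z)) \<circ> X) \<longlonglongrightarrow> (\<integral>t. D t \<partial>M)"
        by (simp add: o_def)
    qed
    then show ?thesis
      unfolding at_within_open[OF zB B(1)] field_differentiable_def has_field_derivative_iff by blast
  qed
  then show ?thesis by (simp add: holomorphic_on_open[OF S] field_differentiable_def)
qed

text \<open>Weierstrass: locally uniform domination of the terms alone lets the derivatives be
  summed. The summability of the derivatives is recorded because it later yields the convergence of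
  the series with the additional factor \<open>ln\<close>.\<close>

lemma
  fixes f :: "nat \<Rightarrow> complex \<Rightarrow> complex"
  assumes S: "open S" and der: "\<And>n x. x \<in> S \<Longrightarrow> (f n has_field_derivative f' n x) (at x)"
    and dom: "\<And>x. x \<in> S \<Longrightarrow> \<exists>d>0. \<exists>h. summable h \<and> (\<forall>n. \<forall>y\<in>ball x d \<inter> S. norm (f n y) \<le> h n)"
    and x: "x \<in> S"
  shows suminf_has_field_derivative: "((\<lambda>x. \<Sum>n. f n x) has_field_derivative (\<Sum>n. f' n x)) (at x)"
    and suminf_derivative_summable: "summable (\<lambda>n. f' n x)"
proof -
  obtain g g' where g: "\<And>x. x \<in> S \<Longrightarrow> (\<lambda>n. f n x) sums g x \<and> (\<lambda>n. f' n x) sums g' x \<and>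
      (g has_field_derivative g' x) (at x)"
  proof -
    have "\<exists>d h. 0 < d \<and> summable h \<and> (\<forall>\<^sub>F n in sequentially. \<forall>y\<in>ball x d \<inter> S. norm (f n y) \<le> h n)"
      if xS: "x \<in> S" for x
    proof -
      obtain d h where "d > 0" "summable h" "\<forall>n. \<forall>y\<in>ball x d \<inter> S. norm (f n y) \<le> h n"
        using dom[OF xS] by blast
      then show ?thesis by (intro exI[of _ d] exI[of _ h]) auto
    qed
    from series_and_derivative_comparison_local[of S f f', OF S der this] show ?thesis
      using that by blast
  qed
  have "((\<lambda>x. \<Sum>n. f n x) has_field_derivative g' x) (at x)"
    by (rule has_field_derivative_transform_within_open[of g, OF _ S x])
       (use g x in \<open>auto simp: sums_unique\<close>)
  then show "((\<lambda>x. \<Sum>n. f n x) has_field_derivative (\<Sum>n. f' n x)) (at x)" "summable (\<lambda>n. f' n x)"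
    using g[OF x] by (auto simp: sums_iff)
qed

lemma holomorphic_on_suminf:
  fixes f :: "nat \<Rightarrow> complex \<Rightarrow> complex"
  assumes S: "open S" and hol: "\<And>n. f n holomorphic_on S"
    and dom: "\<And>x. x \<in> S \<Longrightarrow> \<exists>d>0. \<exists>h. summable h \<and> (\<forall>n. \<forall>y\<in>ball x d \<inter> S. norm (f n y) \<le> h n)"
  shows "(\<lambda>x. \<Sum>n. f n x) holomorphic_on S"
  unfolding holomorphic_on_open[OF S]
proof (intro ballI exI)
  fix x assume "x \<in> S"
  then show "((\<lambda>x. \<Sum>n. f n x) has_field_derivative (\<Sum>n. deriv (f n) x)) (at x)"
    by (intro suminf_has_field_derivative[OF S _ dom])
       (use S hol in \<open>auto intro: holomorphic_derivI\<close>)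
qed

text \<open>Restricting the space, rather than multiplying by an indicator, makes
  \<open>space\<close> consist of the t > 0 only; the domination hypothesis of
  \<open>holomorphic_on_lebesgue_integral\<close> quantifies over exactly these points.\<close>

abbreviation half_line :: "real measure" where
  "half_line \<equiv> restrict_space lborel {0<..}"

abbreviation has_hl_integral :: "(real \<Rightarrow> 'a :: {banach, second_countable_topology}) \<Rightarrow> 'a \<Rightarrow> bool" where
  "has_hl_integral \<equiv> has_bochner_integral half_line"

lemma space_half_line [simp]: "space half_line = {0<..}"
  by (simp add: space_restrict_space)

lemma measurable_half_line_continuous:
  fixes f :: "real \<Rightarrow> 'a :: topological_space"
  shows "continuous_on {0<..} f \<Longrightarrow> f \<in> borel_measurable half_line"
  using borel_measurable_continuous_on_restrict[of "{0<..}" f]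
  by (simp cong: measurable_cong_sets sets_restrict_space_cong)

lemma continuous_on_of_real_powr [continuous_intros]:
  "continuous_on {0<..} (\<lambda>t. complex_of_real t powr z)"
  by (intro continuous_intros) (auto simp: complex_nonpos_Reals_iff)

lemma measurable_half_line_powr: "(\<lambda>t. complex_of_real t powr z) \<in> borel_measurable half_line"
  by (intro measurable_half_line_continuous continuous_intros)

lemma Gamma_integral_half_line:
  assumes z: "Re z > 0" and a: "a > 0"
  shows "has_hl_integral (\<lambda>t. of_real t powr (z - 1) * of_real (exp (-(a * t))))
           (Gamma z * of_real a powr (- z))"
proof -
  define f where "f = (\<lambda>t. indicator {0<..} t *\<^sub>R (of_real t powr (z - 1) * complex_of_real (exp (- t))))"
  have m: "(\<lambda>t. of_real t powr (z - 1) * complex_of_real (exp (- t))) \<in> borel_measurable half_line"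
    by (intro measurable_half_line_continuous continuous_intros)
  then have fm: "f \<in> borel_measurable lborel"
    unfolding f_def by (subst (asm) borel_measurable_restrict_space_iff) auto
  have fi: "integrable lborel f"
    using absolutely_integrable_Gamma_integral'[OF z] fm
    by (simp add: set_integrable_def f_def integrable_completion exp_minus field_simps)
  have "integral\<^sup>L lborel f = Gamma z"
  proof -
    have "set_integrable lebesgue {0<..} (\<lambda>t. complex_of_real t powr (z - 1) / of_real (exp t))"
      by (rule absolutely_integrable_Gamma_integral'[OF z])
    from set_lebesgue_integral_eq_integral(2)[OF this]
    have "integral\<^sup>L lebesgue f = Gamma z"
      using Gamma_integral_complex'[OF z]
      by (simp add: set_lebesgue_integral_def f_def exp_minus field_simps integral_unique)
    then show ?thesis using fm by (simp add: integral_completion)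
  qed
  with fi have "has_bochner_integral lborel f (Gamma z)"
    by (simp add: has_bochner_integral_iff)
  then have "has_bochner_integral lborel (\<lambda>x. f (0 + a * x)) (Gamma z /\<^sub>R \<bar>a\<bar>)"
    using a by (subst (asm) lborel_has_bochner_integral_real_affine_iff[of a _ _ 0]) auto
  \<comment> \<open>The factor \<open>of_real a powr (1 - z)\<close> undoes the scaling in
    \<open>(a * x) powr (z - 1)\<close>; together with the Jacobian 1 / a it leaves
    \<open>a powr (- z)\<close>.\<close>
  then have "has_bochner_integral lborel (\<lambda>x. of_real a powr (1 - z) * f (a * x)) (of_real a powr (1 - z) * (Gamma z /\<^sub>R \<bar>a\<bar>))"
    using a by (intro has_bochner_integral_mult_right) auto
  moreover have "of_real a powr (1 - z) * f (a * x) = indicator {0<..} x *\<^sub>R (of_real x powr (z - 1) * of_real (exp (-(a * x))))" for x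
  proof (cases "x > 0")
    case True
    then show ?thesis using a
      by (simp add: f_def powr_times_real powr_diff powr_minus field_simps)
  qed (use a in \<open>auto simp: f_def zero_less_mult_iff\<close>)
  moreover have "of_real a powr (1 - z) * (Gamma z /\<^sub>R \<bar>a\<bar>) = Gamma z * of_real a powr (- z)"
    using a by (simp add: powr_diff powr_minus scaleR_conv_of_real field_simps)
  ultimately show ?thesis
    by (simp add: has_bochner_integral_restrict_space)
qed

lemma Gamma_integral_half_line_real:
  assumes x: "x > 0" and a: "a > 0"
  shows "has_hl_integral (\<lambda>t. t powr (x - 1) * exp (-(a * t))) (Gamma x * a powr (- x))"
proof -
  have *: "Gamma (complex_of_real x) * of_real a powr (- of_real x) = of_real (Gamma x * a powr (- x))"
    using a by (simp add: Gamma_complex_of_real powr_of_real[symmetric])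
  have "has_hl_integral (\<lambda>t. of_real t powr (complex_of_real x - 1) * of_real (exp (-(a * t))))
          (Gamma (complex_of_real x) * of_real a powr (- of_real x))"
    by (rule Gamma_integral_half_line) (use assms in auto)
  from has_bochner_integral_Re[OF this, unfolded *]
  have "has_hl_integral (\<lambda>t. Re (of_real t powr (complex_of_real x - 1) * of_real (exp (-(a * t)))))
         (Gamma x * a powr (- x))" by simp
  moreover have "Re (of_real t powr (complex_of_real x - 1) * of_real (exp (-(a * t)))) = t powr (x - 1) * exp (-(a * t))"
    if "t \<in> space half_line" for t
    using that powr_of_real[of t "x - 1"] by simp
  ultimately show ?thesis by (subst (asm) has_bochner_integral_cong) auto
qed

lemma norm_of_real_powr: "t > 0 \<Longrightarrow> norm (complex_of_real t powr z) = t powr Re z"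
  by (simp add: norm_powr_real_powr)

text \<open>The integral of the norm of a term is \<open>Gamma (Re w)\<close> times a term of the
  first series, so sum and integral may be exchanged; the second series gives pointwise convergence.
  The frequencies \<open>lam\<close> are left general because both m and m + M occur later.\<close>

lemma Mellin_series:
  fixes a :: "nat \<Rightarrow> complex" and lam :: "nat \<Rightarrow> real"
  assumes w: "Re w > 0" and lam: "\<And>m. lam m > 0"
    and s1: "summable (\<lambda>m. norm (a m) * lam m powr (- Re w))"
    and s2: "\<And>x. x > 0 \<Longrightarrow> summable (\<lambda>m. norm (a m) * exp (-(lam m * x)))"
  shows "has_hl_integral (\<lambda>x. of_real x powr (w - 1) * (\<Sum>m. a m * of_real (exp (-(lam m * x)))))
           (Gamma w * (\<Sum>m. a m * of_real (lam m) powr (- w)))"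
proof -
  define f where "f m x = a m * (of_real x powr (w - 1) * of_real (exp (-(lam m * x))))" for m x
  have f: "has_hl_integral (f m) (a m * (Gamma w * of_real (lam m) powr (- w)))" for m
    unfolding f_def using w lam by (intro has_bochner_integral_mult_right Gamma_integral_half_line) auto
  then have fi: "integrable half_line (f m)" for m by (auto simp: has_bochner_integral_iff)
  have nf: "norm (f m x) = norm (a m) * (x powr (Re w - 1) * exp (-(lam m * x)))" if "x > 0" for m x
    using that by (simp add: f_def norm_mult norm_of_real_powr)
  have "has_hl_integral (\<lambda>x. norm (a m) * (x powr (Re w - 1) * exp (-(lam m * x))))
          (norm (a m) * (Gamma (Re w) * lam m powr (- Re w)))" for m
    using w lam by (intro has_bochner_integral_mult_right Gamma_integral_half_line_real) auto
  then have "(\<integral>x. norm (f m x) \<partial>half_line) = norm (a m) * (Gamma (Re w) * lam m powr (- Re w))" for m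
    by (subst Bochner_Integration.integral_cong[OF refl nf]) (auto simp: has_bochner_integral_iff)
  then have sn: "summable (\<lambda>m. \<integral>x. norm (f m x) \<partial>half_line)"
    using summable_mult[OF s1, of "Gamma (Re w)"] by (simp add: mult_ac)
  have sx: "summable (\<lambda>m. norm (f m x))" if "x > 0" for x
    using summable_mult[OF s2[OF that], of "x powr (Re w - 1)"] that by (simp add: nf mult_ac)
  have ae: "AE x in half_line. summable (\<lambda>m. norm (f m x))"
    using sx by (intro AE_I2) auto
  have "has_hl_integral (\<lambda>x. \<Sum>m. f m x) (\<Sum>m. a m * (Gamma w * of_real (lam m) powr (- w)))"
    using integrable_suminf[OF fi ae sn] integral_suminf[OF fi ae sn] f
    by (simp add: has_bochner_integral_iff)
  moreover have "(\<Sum>m. a m * (Gamma w * of_real (lam m) powr (- w))) = Gamma w * (\<Sum>m. a m * of_real (lam m) powr (- w))"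
  proof -
    have "summable (\<lambda>m. a m * of_real (lam m) powr (- w))"
      by (rule summable_norm_cancel) (use s1 lam in \<open>simp add: norm_mult norm_of_real_powr\<close>)
    from suminf_mult[OF this, of "Gamma w"] show ?thesis by (simp add: mult_ac)
  qed
  moreover have "(\<Sum>m. f m x) = of_real x powr (w - 1) * (\<Sum>m. a m * of_real (exp (-(lam m * x))))" if "x \<in> space half_line" for x
  proof -
    have "summable (\<lambda>m. a m * complex_of_real (exp (-(lam m * x))))"
      by (rule summable_norm_cancel) (use s2 that in \<open>simp add: norm_mult\<close>)
    from suminf_mult[OF this, of "of_real x powr (w - 1)"] show ?thesis
      by (simp add: f_def mult_ac)
  qed
  ultimately show ?thesis by (subst (asm) has_bochner_integral_cong) auto
qed

subsection \<open>The regularised polylogarithm\<close>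

lemma exp_minus_le_fact: "x > 0 \<Longrightarrow> exp (- x) \<le> fact n / (x :: real) ^ n"
proof -
  assume x: "x > 0"
  have "(\<Sum>k\<in>{n}. x ^ k /\<^sub>R fact k) \<le> exp x"
    unfolding exp_def by (rule sum_le_suminf) (use x summable_exp_generic[of x] in \<open>auto simp: scaleR_conv_of_real\<close>)
  then show ?thesis using x by (simp add: exp_minus field_simps)
qed

lemma summable_inverse_Suc_square: "summable (\<lambda>m. 1 / real (Suc m) ^ 2)"
  using inverse_power_summable[of 2, where 'a = real]
  by (subst summable_Suc_iff) (simp add: inverse_eq_divide)

lemma norm_Suc_powr: "norm (of_nat (Suc m) powr z :: complex) = real (Suc m) powr Re z"
  using norm_of_real_powr[of "real (Suc m)" z] by simp

text \<open>\<open>Li s z\<close> is the polylogarithm of order \<open>s\<close> at \<open>exp (- z)\<close>.\<close>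

abbreviation Li_term :: "complex \<Rightarrow> complex \<Rightarrow> nat \<Rightarrow> complex" where
  "Li_term s z m \<equiv> of_nat (Suc m) powr (- s) * exp (- (of_nat (Suc m) * z))"

definition Li :: "complex \<Rightarrow> complex \<Rightarrow> complex" where
  "Li s z = (\<Sum>m. Li_term s z m)"

text \<open>The power a + 2 gained from the exponential pays for the growth m^a of the coefficient
  and leaves a summable square. Only lower bounds for Re z and Re s enter, so the estimate is
  locally uniform in both variables.\<close>

lemma Li_term_bound:
  assumes "0 < \<delta>" "\<delta> \<le> Re z" "- Re s \<le> real a"
  shows "norm (Li_term s z m)
           \<le> fact (a + 2) / \<delta> ^ (a + 2) * (1 / real (Suc m) ^ 2)"
proof -
  have "norm (Li_term s z m)
        = real (Suc m) powr (- Re s) * exp (- (real (Suc m) * Re z))"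
    by (simp only: norm_mult norm_Suc_powr norm_exp_eq_Re) simp
  also have "\<dots> \<le> real (Suc m) powr real a * exp (- (real (Suc m) * \<delta>))"
    using assms by (intro mult_mono powr_mono) auto
  also have "\<dots> \<le> real (Suc m) ^ a * (fact (a + 2) / (real (Suc m) * \<delta>) ^ (a + 2))"
    using assms by (intro mult_mono exp_minus_le_fact) (auto simp: powr_realpow simp del: of_nat_Suc)
  also have "\<dots> = fact (a + 2) / \<delta> ^ (a + 2) * (1 / real (Suc m) ^ 2)"
    using assms by (simp add: field_simps power_add power2_eq_square del: of_nat_Suc)
  finally show ?thesis .
qed

lemma Li_summable:
  assumes "Re z > 0"
  shows "summable (\<lambda>m. norm (Li_term s z m))"
proof (rule summable_comparison_test')
  define a where "a = nat \<lceil>- Re s\<rceil>"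
  show "summable (\<lambda>m. fact (a + 2) / Re z ^ (a + 2) * (1 / real (Suc m) ^ 2))"
    by (intro summable_mult summable_inverse_Suc_square)
  show "norm (norm (Li_term s z m))
         \<le> fact (a + 2) / Re z ^ (a + 2) * (1 / real (Suc m) ^ 2)" if "m \<ge> 0" for m
    unfolding real_norm_def abs_norm_cancel
    by (rule Li_term_bound) (use assms in \<open>auto simp: a_def intro: real_nat_ceiling_ge\<close>)
qed

lemma Re_gt_in_ball: "y \<in> ball x (Re x / 2) \<Longrightarrow> Re x / 2 < Re y"
  using abs_Re_le_cmod[of "x - y"] by (simp add: dist_norm)

lemma Li_has_field_derivative:
  assumes z: "Re z > 0"
  shows "(Li s has_field_derivative - Li (s - 1) z) (at z)"
proof -
  have "((\<lambda>z. \<Sum>m. Li_term s z m) has_field_derivative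
      (\<Sum>m. - (of_nat (Suc m) powr (- (s - 1)) * exp (- (of_nat (Suc m) * z))))) (at z)"
  proof (rule suminf_has_field_derivative[where S = "{z. Re z > 0}"])
    show "open {z. 0 < Re z}" by (simp add: open_halfspace_Re_gt)
    show "((\<lambda>z. Li_term s z n) has_field_derivative
            - (of_nat (Suc n) powr - (s - 1) * exp (- (of_nat (Suc n) * x)))) (at x)" for n x
      by (rule derivative_eq_intros refl)+ (simp add: powr_diff powr_minus field_simps del: of_nat_Suc)
    show "\<exists>d>0. \<exists>h. summable h \<and> (\<forall>n. \<forall>y\<in>ball x d \<inter> {z. 0 < Re z}.
            norm (Li_term s y n) \<le> h n)" if x: "x \<in> {z. Re z > 0}" for x
    proof (intro exI conjI allI ballI)
      define a where "a = nat \<lceil>- Re s\<rceil>"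
      show "Re x / 2 > 0" using x by simp
      show "summable (\<lambda>m. fact (a + 2) / (Re x / 2) ^ (a + 2) * (1 / real (Suc m) ^ 2))"
        by (intro summable_mult summable_inverse_Suc_square)
      fix n y assume "y \<in> ball x (Re x / 2) \<inter> {z. 0 < Re z}"
      then have "Re x / 2 \<le> Re y"
        using Re_gt_in_ball[of y x] by simp
      then show "norm (Li_term s y n)
          \<le> fact (a + 2) / (Re x / 2) ^ (a + 2) * (1 / real (Suc n) ^ 2)"
        unfolding a_def using x by (intro Li_term_bound real_nat_ceiling_ge) auto
    qed
  qed (use z in auto)
  moreover have "(\<Sum>m. - (of_nat (Suc m) powr (- (s - 1)) * exp (- (of_nat (Suc m) * z)))) = - Li (s - 1) z"
    unfolding Li_def by (rule suminf_minus[OF summable_norm_cancel[OF Li_summable[OF z]]])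
  ultimately show ?thesis by (simp add: Li_def[abs_def] del: of_nat_Suc)
qed

text \<open>Supplies one exponent \<open>a\<close> for \<open>Li_term_bound\<close> that serves a
  whole unit disc of orders.\<close>

lemma Re_bound_in_ball: "y \<in> ball x 1 \<Longrightarrow> - Re y \<le> real (nat \<lceil>1 - Re x\<rceil>)"
  using abs_Re_le_cmod[of "x - y"] by (simp add: dist_norm) linarith

lemma
  assumes z: "Re z > 0"
  shows Li_has_field_derivative_left: "((\<lambda>s. Li s z) has_field_derivative
      (\<Sum>m. - of_real (ln (Suc m)) * (Li_term s z m))) (at s)"
    and Li_log_summable: "summable (\<lambda>m. - of_real (ln (Suc m)) * (Li_term s z m))"
proof -
  have 1: "((\<lambda>s. Li_term s z n) has_field_derivative
            - of_real (ln (Suc n)) * (Li_term s z n)) (at s)" for n s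
    by (rule derivative_eq_intros has_field_derivative_powr_right[THEN DERIV_chain2] refl | simp del: of_nat_Suc)+
  have 2: "\<exists>d>0. \<exists>h. summable h \<and> (\<forall>n. \<forall>y\<in>ball x d \<inter> UNIV.
            norm (of_nat (Suc n) powr - y * exp (- (of_nat (Suc n) * z))) \<le> h n)" for x
      using z by (intro exI[of _ 1] exI[of _ "\<lambda>m. fact (nat \<lceil>1 - Re x\<rceil> + 2) / (Re z) ^ (nat \<lceil>1 - Re x\<rceil> + 2) * (1 / real (Suc m) ^ 2)"] conjI allI ballI
          summable_mult summable_inverse_Suc_square Li_term_bound Re_bound_in_ball) auto
  show "((\<lambda>s. Li s z) has_field_derivative
      (\<Sum>m. - of_real (ln (Suc m)) * (Li_term s z m))) (at s)"
    unfolding Li_def by (rule suminf_has_field_derivative[OF open_UNIV 1 2]) auto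
  show "summable (\<lambda>m. - of_real (ln (Suc m)) * (Li_term s z m))"
    by (rule suminf_derivative_summable[OF open_UNIV 1 2]) auto
qed

lemma holomorphic_Li_left: "Re z > 0 \<Longrightarrow> (\<lambda>s. Li s z) holomorphic_on A"
  using Li_has_field_derivative_left
  by (meson field_differentiable_at_within field_differentiable_def holomorphic_on_def)

text \<open>\<open>regular\<close> excludes the positive integers, where \<open>Gamma (1 - s)\<close> in \<open>Li_reg\<close> has its poles.\<close>

definition regular :: "complex set" where
  "regular = {s. 1 - s \<notin> \<int>\<^sub>\<le>\<^sub>0}"

definition Li_reg :: "complex \<Rightarrow> complex \<Rightarrow> complex" where
  "Li_reg s z = Li s z - Gamma (1 - s) * z powr (s - 1)"

lemma regular_minus_1: "s \<in> regular \<Longrightarrow> s - 1 \<in> regular"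
  using plus_one_in_nonpos_Ints_imp[of "1 - s"] by (auto simp: regular_def algebra_simps)

lemma regular_minus_nat: "s \<in> regular \<Longrightarrow> s - of_nat k \<in> regular"
proof (induction k)
  case (Suc k)
  then show ?case using regular_minus_1[of "s - of_nat k"] by (simp add: algebra_simps)
qed auto

lemma regular_if_Re: "Re s < 1 \<Longrightarrow> s \<in> regular"
  by (force simp: regular_def complex_eq_iff elim!: nonpos_Ints_cases)

lemma open_regular: "open regular"
proof -
  have "regular = (\<lambda>s. 1 - s) -` (- \<int>\<^sub>\<le>\<^sub>0)" by (auto simp: regular_def)
  moreover have "open ((\<lambda>s. 1 - s) -` (- \<int>\<^sub>\<le>\<^sub>0 :: complex set))"
    by (intro open_vimage continuous_intros) auto
  ultimately show ?thesis by simp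
qed

text \<open>The subtracted power obeys the same rule as \<open>Li\<close>, by Gamma(2 - s) = (1 - s)
  Gamma(1 - s). That differentiation lowers the order by one drives the inductions on the order
  below.\<close>

lemma Li_reg_has_field_derivative:
  assumes z: "Re z > 0" and s: "s \<in> regular"
  shows "(Li_reg s has_field_derivative - Li_reg (s - 1) z) (at z)"
proof -
  have z': "z \<notin> \<real>\<^sub>\<le>\<^sub>0" using z by (auto simp: complex_nonpos_Reals_iff)
  have "1 - s \<noteq> 0" using s by (auto simp: regular_def)
  then have "Gamma (2 - s) = (1 - s) * Gamma (1 - s)"
    using Gamma_plus1[of "1 - s"] s by (auto simp: regular_def algebra_simps)
  note G = this
  have "((\<lambda>w. w powr (s - 1)) has_field_derivative (s - 1) * z powr (s - 1 - 1)) (at z)"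
    by (rule has_field_derivative_powr[OF z'])
  then have "(Li_reg s has_field_derivative - Li (s - 1) z - Gamma (1 - s) * ((s - 1) * z powr (s - 1 - 1))) (at z)"
    unfolding Li_reg_def[abs_def] by (intro DERIV_diff DERIV_cmult Li_has_field_derivative[OF z])
  moreover have "1 - (s - 1) = 2 - s" by simp
  then have "- Li (s - 1) z - Gamma (1 - s) * ((s - 1) * z powr (s - 1 - 1)) = - Li_reg (s - 1) z"
    unfolding Li_reg_def by (simp only: G) (simp add: algebra_simps)
  ultimately show ?thesis by simp
qed

lemma holomorphic_Li_reg_left:
  assumes z: "Re z > 0" and A: "A \<subseteq> regular"
  shows "(\<lambda>s. Li_reg s z) holomorphic_on A"
proof -
  have "z \<noteq> 0" using z by auto
  then show ?thesis
    unfolding Li_reg_def using A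
    by (intro holomorphic_intros holomorphic_Li_left[OF z]) (auto simp: regular_def)
qed

text \<open>\<open>bern\<close> is the generating function of the numbers \<open>B\<^sub>n\<^sub>+\<^sub>1 / (n + 1)!\<close>.\<close>

definition bern :: "complex \<Rightarrow> complex" where
  "bern z = (if z = 0 then - 1 / 2 else 1 / (exp z - 1) - 1 / z)"

text \<open>The nonzero solutions of exp z = 1 have |Im z| \<ge> 2 pi, and 6 < 2 pi follows from pi
  > 3.\<close>

definition strip :: "complex set" where
  "strip = {z. \<bar>Im z\<bar> < 6}"

lemma open_strip: "open strip"
proof -
  have *: "strip = {z. Im z < 6} \<inter> {z. Im z > - 6}" by (auto simp: strip_def)
  show ?thesis unfolding * by (intro open_Int open_halfspace_Im_lt open_halfspace_Im_gt)
qed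

lemma exp_neq_1_strip: "z \<in> strip \<Longrightarrow> z \<noteq> 0 \<Longrightarrow> exp z \<noteq> 1"
proof
  assume z: "z \<in> strip" "z \<noteq> 0" "exp z = 1"
  then obtain n :: int where n: "Re z = 0" "Im z = of_int (2 * n) * pi"
    by (auto simp: exp_eq_1)
  then have "n \<noteq> 0" using z by (auto simp: complex_eq_iff)
  then have "\<bar>real_of_int n\<bar> \<ge> 1" by linarith
  then have "\<bar>Im z\<bar> \<ge> 2 * pi" using n by (simp add: abs_mult)
  then show False using z pi_gt3 by (simp add: strip_def)
qed

text \<open>The poles cancel algebraically: with q = (exp z - 1) / z and r = (q - 1) / z, both
  entire once the point 0 is filled in, \<open>bern\<close> is - r / q away from 0, and q has no
  zero in \<open>strip\<close>.\<close>

lemma bern_holomorphic: "bern holomorphic_on strip"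
proof -
  define q where "q z = (if z = 0 then deriv exp 0 else (exp z - exp 0) / (z - 0))" for z :: complex
  define r where "r z = (if z = 0 then deriv q 0 else (q z - q 0) / (z - 0))" for z :: complex
  have d: "deriv exp (0 :: complex) = 1" by (rule DERIV_imp_deriv) (auto intro!: derivative_eq_intros)
  have q: "q holomorphic_on UNIV" unfolding q_def by (intro pole_lemma holomorphic_intros) auto
  have r: "r holomorphic_on UNIV" unfolding r_def by (intro pole_lemma q) auto
  have qn: "q z \<noteq> 0" if "z \<in> strip" for z
    using exp_neq_1_strip[OF that] by (auto simp: q_def d)
  define f where "f z = - r z / q z" for z
  have f: "f holomorphic_on strip"
    unfolding f_def using qn by (intro holomorphic_intros holomorphic_on_subset[OF q] holomorphic_on_subset[OF r]) auto
  have eq: "f z = bern z" if "z \<in> strip" "z \<noteq> 0" for z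
    using that exp_neq_1_strip[OF that] by (simp add: f_def r_def q_def bern_def d divide_simps)
  have S0: "0 \<in> strip" by (simp add: strip_def)
  have "isCont f 0"
    using holomorphic_on_imp_continuous_on[OF f] S0 continuous_on_eq_continuous_at[OF open_strip] by blast
  then have "(f \<longlongrightarrow> f 0) (at 0)" by (simp add: isCont_def)
  \<comment> \<open>The value of \<open>f\<close> at 0 is obtained as a one-sided limit along the
    reals, where an asymptotic expansion delivers it.\<close>
  moreover have "filterlim complex_of_real (at 0) (at_right 0)"
    by (auto simp: filterlim_at eventually_at_filter intro!: tendsto_eq_intros)
  ultimately have "((\<lambda>t. f (complex_of_real t)) \<longlongrightarrow> f 0) (at_right 0)"
    by (rule filterlim_compose)
  moreover have "\<forall>\<^sub>F t in at_right 0. f (complex_of_real t) = of_real (1 / (exp t - 1) - 1 / t)"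
    by (auto simp: eventually_at_filter eq strip_def bern_def exp_of_real intro!: always_eventually)
  ultimately have "((\<lambda>t. complex_of_real (1 / (exp t - 1) - 1 / t)) \<longlongrightarrow> f 0) (at_right 0)"
    by (rule Lim_transform_eventually)
  moreover have "((\<lambda>t::real. 1 / (exp t - 1) - 1 / t) \<longlongrightarrow> - 1 / 2) (at_right 0)"
    by real_asymp
  then have "((\<lambda>t. complex_of_real (1 / (exp t - 1) - 1 / t)) \<longlongrightarrow> of_real (- 1 / 2)) (at_right 0)"
    by (rule tendsto_of_real)
  ultimately have "f 0 = of_real (- 1 / 2)"
    by (intro tendsto_unique[of "at_right (0::real)"]) auto
  then have "f z = bern z" if "z \<in> strip" for z
    using that eq[of z] by (cases "z = 0") (auto simp: bern_def)
  with f show ?thesis by (simp cong: holomorphic_cong)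
qed

lemma Li_0: "Re z > 0 \<Longrightarrow> Li 0 z = 1 / (exp z - 1)"
proof -
  assume z: "Re z > 0"
  have n: "norm (exp (- z)) < 1" using z by simp
  have "Li 0 z = (\<Sum>m. exp (- z) * exp (- z) ^ m)"
    unfolding Li_def
  proof (intro suminf_cong)
    fix m
    show "Li_term 0 z m = exp (- z) * exp (- z) ^ m"
      using of_nat_neq_0[of m, where 'a = complex]
      by (simp add: exp_of_nat_mult[symmetric] exp_add[symmetric] algebra_simps)
  qed
  also have "\<dots> = exp (- z) * (1 / (1 - exp (- z)))"
    using suminf_mult[OF summable_geometric[OF n]] suminf_geometric[OF n] by simp
  also have "\<dots> = 1 / (exp z - 1)"
    using n by (auto simp: exp_minus field_simps)
  finally show ?thesis .
qed

text \<open>At the orders 0, -1, -2, ... the regularised polylogarithm is thereby seen to extend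
  holomorphically across 0. Order 0 is a geometric series, and every derivative lowers the order and
  changes the sign.\<close>

lemma higher_deriv_bern:
  "Re z > 0 \<Longrightarrow> (deriv ^^ k) bern z = (- 1) ^ k * Li_reg (- of_nat k) z"
proof (induction k arbitrary: z)
  case 0
  then have "z \<noteq> 0" by auto
  with 0 show ?case by (simp add: bern_def Li_reg_def Li_0 powr_minus_divide)
next
  case (Suc k)
  have "\<forall>\<^sub>F w in nhds z. w \<in> {w. Re w > 0}"
    using Suc.prems by (intro eventually_nhds_in_open open_halfspace_Re_gt) auto
  then have "\<forall>\<^sub>F w in nhds z. (deriv ^^ k) bern w = (- 1) ^ k * Li_reg (- of_nat k) w"
    by eventually_elim (use Suc.IH in auto)
  then have "deriv ((deriv ^^ k) bern) z = deriv (\<lambda>w. (- 1) ^ k * Li_reg (- of_nat k) w) z"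
    by (intro deriv_cong_ev) auto
  also have "\<dots> = (- 1) ^ k * - Li_reg (- of_nat k - 1) z"
    using Suc.prems by (intro DERIV_imp_deriv DERIV_cmult Li_reg_has_field_derivative regular_if_Re) auto
  finally have "deriv ((deriv ^^ k) bern) z = (- 1) ^ Suc k * Li_reg (- of_nat k - 1) z" by simp
  moreover have "- of_nat k - 1 = (- of_nat (Suc k) :: complex)" by simp
  ultimately show ?case by (simp only: funpow.simps o_apply)
qed

text \<open>On (0, 1] the function is a derivative of \<open>bern\<close> up to sign, hence bounded;
  for y \<ge> 1 the subtracted power y^(-k-1) prevails, as the polylogarithm is O(y^(-k-2)). The
  majorant in 1 + y covers both ranges and is integrable against x^(a-1) for 0 < a < k + 1.\<close>

lemma Li_reg_neg_nat_bound:
  obtains C where "C \<ge> 0" "\<And>y. y > 0 \<Longrightarrow> norm (Li_reg (- of_nat k) (of_real y)) \<le> C * (1 + y) powr (- real (k + 1))"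
proof -
  have "compact (complex_of_real ` {0..1})"
    by (intro compact_continuous_image continuous_intros) auto
  moreover have "continuous_on (complex_of_real ` {0..1}) ((deriv ^^ k) bern)"
    by (intro holomorphic_on_imp_continuous_on holomorphic_on_subset[OF holomorphic_higher_deriv[OF bern_holomorphic open_strip]])
       (auto simp: strip_def)
  ultimately have "bounded ((deriv ^^ k) bern ` complex_of_real ` {0..1})"
    by (metis compact_imp_bounded compact_continuous_image)
  then obtain C0 where C0: "\<And>y. y \<in> {0..1} \<Longrightarrow> norm ((deriv ^^ k) bern (of_real y)) \<le> C0"
    unfolding bounded_iff by blast
  have small: "norm (Li_reg (- of_nat k) (of_real y)) \<le> C0" if "y > 0" "y \<le> 1" for y
    using C0[of y] that by (simp add: higher_deriv_bern norm_mult norm_power)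
  have C0': "C0 \<ge> 0" using order_trans[OF norm_ge_zero small[of 1]] by simp
  define C1 where "C1 = fact (k + 2) * (\<Sum>m. 1 / real (Suc m) ^ 2) + fact k"
  have C1': "C1 \<ge> 0" unfolding C1_def by (intro add_nonneg_nonneg mult_nonneg_nonneg suminf_nonneg summable_inverse_Suc_square) auto
  have large: "norm (Li_reg (- of_nat k) (of_real y)) \<le> C1 * y powr (- real (k + 1))" if y: "y \<ge> 1" for y
  proof -
    have "norm (Li (- of_nat k) (of_real y)) \<le> (\<Sum>m. fact (k + 2) / y ^ (k + 2) * (1 / real (Suc m) ^ 2))"
      unfolding Li_def using Li_term_bound[of y "of_real y" "- of_nat k" k] y
      by (intro norm_suminf_le summable_mult summable_inverse_Suc_square) auto
    also have "\<dots> = fact (k + 2) / y ^ (k + 2) * (\<Sum>m. 1 / real (Suc m) ^ 2)"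
      by (rule suminf_mult[OF summable_inverse_Suc_square])
    also have "\<dots> \<le> fact (k + 2) / y ^ (k + 1) * (\<Sum>m. 1 / real (Suc m) ^ 2)"
      using y by (intro mult_right_mono divide_left_mono power_increasing suminf_nonneg summable_inverse_Suc_square) auto
    finally have 1: "norm (Li (- of_nat k) (of_real y)) \<le> fact (k + 2) / y ^ (k + 1) * (\<Sum>m. 1 / real (Suc m) ^ 2)" .
    have "norm (Gamma (1 - (- of_nat k)) * of_real y powr (- of_nat k - 1) :: complex) = fact k * y powr (- real (k + 1))"
      using y by (simp add: norm_mult norm_of_real_powr Gamma_fact) (rule arg_cong2[where f = "(powr)"]; simp)
    also have "\<dots> = fact k / y ^ (k + 1)"
      using y powr_realpow[of y "k + 1"] by (simp add: powr_minus divide_inverse del: of_nat_Suc)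
    finally have 2: "norm (Gamma (1 - (- of_nat k)) * of_real y powr (- of_nat k - 1) :: complex) = fact k / y ^ (k + 1)" .
    have "norm (Li_reg (- of_nat k) (of_real y)) \<le> norm (Li (- of_nat k) (of_real y))
            + norm (Gamma (1 - (- of_nat k)) * of_real y powr (- of_nat k - 1) :: complex)"
      unfolding Li_reg_def by (rule norm_triangle_ineq4)
    also have "\<dots> \<le> fact (k + 2) / y ^ (k + 1) * (\<Sum>m. 1 / real (Suc m) ^ 2) + fact k / y ^ (k + 1)"
      by (intro add_mono 1 eq_refl[OF 2])
    also have "\<dots> = C1 / y ^ (k + 1)"
      by (simp add: C1_def add_divide_distrib)
    finally have "norm (Li_reg (- of_nat k) (of_real y)) \<le> C1 / y ^ (k + 1)" .
    then show ?thesis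
      using y powr_realpow[of y "k + 1"] by (simp add: powr_minus divide_inverse del: of_nat_Suc)
  qed
  show ?thesis
  proof
    \<comment> \<open>The factor 2^(k+1) compares 1 and y^(-k-1) with (1 + y)^(-k-1), since 1 + y
      \<le> 2 in the first range and 1 + y \<le> 2 y in the second.\<close>
    show "(C0 + C1) * 2 ^ (k + 1) \<ge> 0" using C0' C1' by simp
    fix y :: real assume y: "y > 0"
    show "norm (Li_reg (- of_nat k) (of_real y)) \<le> (C0 + C1) * 2 ^ (k + 1) * (1 + y) powr (- real (k + 1))"
    proof (cases "y \<le> 1")
      case True
      have "1 / 2 ^ (k + 1) = 2 powr (- real (k + 1))"
        using powr_realpow[of 2 "k + 1"] by (simp add: powr_minus divide_inverse del: of_nat_Suc power_Suc)
      also have "\<dots> \<le> (1 + y) powr (- real (k + 1))"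
        using True y by (intro powr_mono2') auto
      finally have "1 \<le> 2 ^ (k + 1) * (1 + y) powr (- real (k + 1))"
        by (simp add: field_simps)
      then have "C0 * 1 \<le> (C0 + C1) * (2 ^ (k + 1) * (1 + y) powr (- real (k + 1)))"
        using C0' C1' by (intro mult_mono) auto
      then show ?thesis using small[OF y True] by (simp add: mult_ac)
    next
      case False
      have "y powr (- real (k + 1)) \<le> ((1 + y) / 2) powr (- real (k + 1))"
        using False by (intro powr_mono2') auto
      also have "\<dots> = (1 + y) powr (- real (k + 1)) / 2 powr (- real (k + 1))"
        using y by (simp add: powr_divide)
      also have "\<dots> = 2 ^ (k + 1) * (1 + y) powr (- real (k + 1))"
        using powr_realpow[of 2 "k + 1"] by (simp add: powr_minus divide_inverse del: of_nat_Suc power_Suc)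
      finally have "C1 * y powr (- real (k + 1)) \<le> (C0 + C1) * (2 ^ (k + 1) * (1 + y) powr (- real (k + 1)))"
        using C0' C1' by (intro mult_mono) auto
      then show ?thesis using large[of y] False by (simp add: mult_ac)
    qed
  qed
qed

section \<open>Mellin representation and boundedness of the regularised polylogarithm\<close>

lemma sigma_finite_half_line: "sigma_finite_measure half_line"
  by (intro sigma_finite_measure_restrict_space) (auto simp: lborel.sigma_finite_measure_axioms)

text \<open>Expand k! (x + t)^(-k-1) as the integral of u^k exp(- u (x + t)) over u and integrate
  over x first: two Gamma integrals remain. This is the Mellin transform of the power that
  \<open>Li_reg\<close> subtracts at order -k.\<close>

lemma Beta_integral_half_line:
  assumes w: "Re w > 0" "Re w < real k + 1" and t: "t > 0"
  shows "has_hl_integral (\<lambda>x. of_real x powr (w - 1) * (fact k * of_real (x + t) powr (- of_nat (k + 1))))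
           (Gamma w * Gamma (of_nat (k + 1) - w) * of_real t powr (w - of_nat (k + 1)))"
proof -
  interpret sigma_finite_measure half_line by (rule sigma_finite_half_line)
  interpret pair_sigma_finite half_line half_line ..
  define f where "f u x = of_real x powr (w - 1) * (of_real u powr (of_nat (k + 1) - 1) * complex_of_real (exp (-(u * (x + t)))))"
    for u x :: real
  have fx: "has_hl_integral (\<lambda>x. f u x) (of_real u powr (of_nat (k + 1) - 1) * of_real (exp (-(u * t))) * (Gamma w * of_real u powr (- w)))"
    if u: "u > 0" for u
  proof -
    have "has_hl_integral (\<lambda>x. of_real u powr (of_nat (k + 1) - 1) * of_real (exp (-(u * t))) * (of_real x powr (w - 1) * of_real (exp (-(u * x)))))
           (of_real u powr (of_nat (k + 1) - 1) * of_real (exp (-(u * t))) * (Gamma w * of_real u powr (- w)))"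
      by (intro has_bochner_integral_mult_right Gamma_integral_half_line w u)
    moreover have "of_real u powr (of_nat (k + 1) - 1) * of_real (exp (-(u * t))) * (of_real x powr (w - 1) * of_real (exp (-(u * x)))) = f u x" for x
      by (simp add: f_def exp_add[symmetric] algebra_simps flip: of_real_mult)
    ultimately show ?thesis by simp
  qed
  have fu: "has_hl_integral (\<lambda>u. f u x) (of_real x powr (w - 1) * (fact k * of_real (x + t) powr (- of_nat (k + 1))))"
    if x: "x > 0" for x
  proof -
    have "has_hl_integral (\<lambda>u. of_real x powr (w - 1) * (of_real u powr (of_nat (k + 1) - 1) * of_real (exp (-((x + t) * u)))))
           (of_real x powr (w - 1) * (Gamma (of_nat (k + 1)) * of_real (x + t) powr (- of_nat (k + 1))))"
      using x t by (intro has_bochner_integral_mult_right Gamma_integral_half_line) auto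
    then show ?thesis
      by (simp add: f_def mult_ac Gamma_fact)
  qed
  \<comment> \<open>Absolute version of the inner integral for Fubini; the outer integral then
    converges at u = 0 because Re w < k + 1.\<close>
  have nx: "(\<integral>x. norm (f u x) \<partial>half_line) = Gamma (Re w) * (u powr ((real (k + 1) - Re w) - 1) * exp (-(t * u)))" if u: "u > 0" for u
  proof -
    have "has_hl_integral (\<lambda>x. u powr real k * exp (-(u * t)) * (x powr (Re w - 1) * exp (-(u * x))))
           (u powr real k * exp (-(u * t)) * (Gamma (Re w) * u powr (- Re w)))"
      by (intro has_bochner_integral_mult_right Gamma_integral_half_line_real w u)
    moreover have "u powr real k * exp (-(u * t)) * (x powr (Re w - 1) * exp (-(u * x))) = norm (f u x)" if "x \<in> space half_line" for x
      using that u by (simp add: f_def norm_mult norm_power norm_of_real_powr powr_realpow exp_add[symmetric] algebra_simps)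
    ultimately have "has_hl_integral (\<lambda>x. norm (f u x)) (u powr real k * exp (-(u * t)) * (Gamma (Re w) * u powr (- Re w)))"
      by (subst (asm) has_bochner_integral_cong) auto
    then show ?thesis using u by (simp add: has_bochner_integral_iff powr_diff powr_minus powr_add field_simps)
  qed
  have int: "integrable (half_line \<Otimes>\<^sub>M half_line) (\<lambda>(u, x). f u x)"
  proof (rule Fubini_integrable)
    have [measurable]: "(\<lambda>x. x) \<in> borel_measurable half_line"
      by (intro measurable_half_line_continuous continuous_intros)
    note [measurable] = measurable_half_line_powr
    have "(\<lambda>p. of_real (snd p) powr (w - 1) * (of_real (fst p) powr (of_nat (k + 1) - 1) * complex_of_real (exp (-(fst p * (snd p + t))))))
           \<in> borel_measurable (half_line \<Otimes>\<^sub>M half_line)"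
      by (intro borel_measurable_times measurable_compose[OF measurable_snd measurable_half_line_powr] measurable_compose[OF measurable_fst measurable_half_line_powr]) measurable
    then show "(\<lambda>(u, x). f u x) \<in> borel_measurable (half_line \<Otimes>\<^sub>M half_line)"
      by (simp add: f_def case_prod_beta')
    have "has_hl_integral (\<lambda>u. Gamma (Re w) * (u powr ((real (k + 1) - Re w) - 1) * exp (-(t * u)))) (Gamma (Re w) * (Gamma (real (k + 1) - Re w) * t powr (- (real (k + 1) - Re w))))"
      using w t by (intro has_bochner_integral_mult_right Gamma_integral_half_line_real) auto
    then have "integrable half_line (\<lambda>u. Gamma (Re w) * (u powr ((real (k + 1) - Re w) - 1) * exp (-(t * u))))"
      by (simp add: has_bochner_integral_iff)
    then show "integrable half_line (\<lambda>x. LINT y|half_line. norm (case (x, y) of (u, x) \<Rightarrow> f u x))"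
      by (subst Bochner_Integration.integrable_cong[OF refl]) (auto simp: nx)
    show "AE x in half_line. integrable half_line (\<lambda>y. case (x, y) of (u, x) \<Rightarrow> f u x)"
      using fx by (intro AE_I2) (auto simp: has_bochner_integral_iff)
  qed
  have I: "integrable half_line (\<lambda>x. \<integral>u. f u x \<partial>half_line)" by (rule integrable_snd[OF int])
  have "(\<integral>x. (\<integral>u. f u x \<partial>half_line) \<partial>half_line) = (\<integral>u. (\<integral>x. f u x \<partial>half_line) \<partial>half_line)"
    by (rule Fubini_integral[OF int])
  also have "\<dots> = (\<integral>u. Gamma w * (of_real u powr ((of_nat (k + 1) - w) - 1) * of_real (exp (-(t * u)))) \<partial>half_line)"
  proof (rule Bochner_Integration.integral_cong[OF refl])
    fix u assume "u \<in> space half_line"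
    then show "(\<integral>x. f u x \<partial>half_line) = Gamma w * (of_real u powr ((of_nat (k + 1) - w) - 1) * of_real (exp (-(t * u))))"
      using fx[of u] by (simp add: has_bochner_integral_iff powr_diff powr_minus powr_add field_simps)
  qed
  also have "\<dots> = Gamma w * (Gamma (of_nat (k + 1) - w) * of_real t powr (- (of_nat (k + 1) - w)))"
    using w t by (intro has_bochner_integral_integral_eq has_bochner_integral_mult_right Gamma_integral_half_line) auto
  finally have "has_hl_integral (\<lambda>x. \<integral>u. f u x \<partial>half_line) (Gamma w * Gamma (of_nat (k + 1) - w) * of_real t powr (w - of_nat (k + 1)))"
    using I by (simp add: has_bochner_integral_iff algebra_simps)
  moreover have "(\<integral>u. f u x \<partial>half_line) = of_real x powr (w - 1) * (fact k * of_real (x + t) powr (- of_nat (k + 1)))" if "x \<in> space half_line" for x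
    using that fu by (simp add: has_bochner_integral_iff)
  ultimately show ?thesis by (subst (asm) has_bochner_integral_cong) auto
qed

text \<open>
  Writing \<open>m\<^sup>-\<^sup>s = m\<^sup>k m\<^sup>-\<^sup>w\<close> with \<open>w = s + k\<close> and \<open>m\<^sup>-\<^sup>w\<close> as a Gamma integral reduces \<open>Li_reg s\<close> to
  the integer order \<open>- k\<close>, where it is a derivative of \<open>bern\<close> and hence bounded at 0.
\<close>

lemma Li_reg_integral:
  assumes s: "- real k < Re s" "Re s < 1" and t: "t > 0"
  shows "has_hl_integral (\<lambda>x. of_real x powr (s + of_nat k - 1) * Li_reg (- of_nat k) (of_real (x + t)))
           (Gamma (s + of_nat k) * Li_reg s (of_real t))"
proof -
  define w where "w = s + of_nat k"
  \<comment> \<open>The two bounds on Re s are exactly the range of the Beta integral.\<close>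
  have w: "Re w > 0" "Re w < real k + 1" using s by (auto simp: w_def)
  define a where "a m = of_nat (Suc m) powr of_nat k * exp (- (of_nat (Suc m) * complex_of_real t))" for m
  have "has_hl_integral (\<lambda>x. of_real x powr (w - 1) * (\<Sum>m. a m * of_real (exp (- (real (Suc m) * x)))))
           (Gamma w * (\<Sum>m. a m * of_real (real (Suc m)) powr (- w)))"
  proof (rule Mellin_series)
    have "norm (of_nat (Suc m) powr (- s) * exp (- (of_nat (Suc m) * complex_of_real t))) = norm (a m) * real (Suc m) powr (- Re w)" for m
      by (simp only: norm_mult norm_Suc_powr a_def) (simp add: w_def powr_add[symmetric] del: of_nat_Suc)
    then show "summable (\<lambda>m. norm (a m) * real (Suc m) powr (- Re w))"
      using Li_summable[of "of_real t" s] t by simp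
    fix x :: real assume x: "x > 0"
    have "norm (of_nat (Suc m) powr (- (- of_nat k)) * exp (- (of_nat (Suc m) * complex_of_real (x + t)))) = norm (a m) * exp (- (real (Suc m) * x))" for m
      by (simp add: a_def norm_mult exp_add[symmetric] algebra_simps del: of_nat_Suc)
    then show "summable (\<lambda>m. norm (a m) * exp (- (real (Suc m) * x)))"
      using Li_summable[of "of_real (x + t)" "- of_nat k"] t x by simp
  qed (use w in auto)
  moreover have "(\<Sum>m. a m * of_real (exp (- (real (Suc m) * x)))) = Li (- of_nat k) (of_real (x + t))" for x
    unfolding Li_def a_def
    by (intro suminf_cong) (simp add: exp_of_real[symmetric] exp_add[symmetric] algebra_simps del: of_nat_Suc exp_of_real)
  moreover have "(\<Sum>m. a m * of_real (real (Suc m)) powr (- w)) = Li s (of_real t)"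
    unfolding Li_def a_def w_def
  proof (intro suminf_cong)
    fix m
    have "of_nat (Suc m) powr (- s) = (of_nat (Suc m) powr of_nat k * of_nat (Suc m) powr (- (s + of_nat k)) :: complex)"
      unfolding powr_add[symmetric] by simp
    then show "of_nat (Suc m) powr of_nat k * exp (- (of_nat (Suc m) * complex_of_real t)) * of_real (real (Suc m)) powr (- (s + of_nat k))
       = of_nat (Suc m) powr (- s) * exp (- (of_nat (Suc m) * complex_of_real t))"
      by (simp del: of_nat_Suc)
  qed
  ultimately have 1: "has_hl_integral (\<lambda>x. of_real x powr (w - 1) * Li (- of_nat k) (of_real (x + t))) (Gamma w * Li s (of_real t))"
    by simp
  have 2: "has_hl_integral (\<lambda>x. of_real x powr (w - 1) * (fact k * of_real (x + t) powr (- of_nat (k + 1))))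
           (Gamma w * Gamma (of_nat (k + 1) - w) * of_real t powr (w - of_nat (k + 1)))"
    by (rule Beta_integral_half_line[OF w t])
  have "of_real x powr (w - 1) * Li (- of_nat k) (of_real (x + t)) - of_real x powr (w - 1) * (fact k * of_real (x + t) powr (- of_nat (k + 1)))
      = of_real x powr (s + of_nat k - 1) * Li_reg (- of_nat k) (of_real (x + t))" for x
  proof -
    have "- of_nat k - 1 = (- of_nat (k + 1) :: complex)" by simp
    moreover have "Gamma (1 - - of_nat k) = (fact k :: complex)" by (simp add: Gamma_fact)
    ultimately show ?thesis unfolding Li_reg_def w_def by (simp only:) (simp only: ring_distribs)
  qed
  moreover have "Gamma w * Li s (of_real t) - Gamma w * Gamma (of_nat (k + 1) - w) * of_real t powr (w - of_nat (k + 1))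
      = Gamma (s + of_nat k) * Li_reg s (of_real t)"
    unfolding Li_reg_def w_def by (simp add: algebra_simps)
  ultimately show ?thesis
    using has_bochner_integral_diff[OF 1 2] by simp
qed

lemma powr_between:
  fixes x :: real
  assumes "x > 0" "a \<le> b" "b \<le> c"
  shows "x powr b \<le> x powr a + x powr c"
proof (cases "x \<le> 1")
  case True
  then have "x powr b \<le> x powr a" using assms by (intro powr_mono') auto
  then show ?thesis by (simp add: add_increasing2)
next
  case False
  then have "x powr b \<le> x powr c" using assms by (intro powr_mono) auto
  then show ?thesis by (simp add: add_increasing)
qed

lemma integrable_Beta_real:
  assumes "0 < a" "a < real k + 1"
  shows "integrable half_line (\<lambda>x. x powr (a - 1) * (1 + x) powr (- real (k + 1)))"
proof -
  have "integrable half_line (\<lambda>x. norm (of_real x powr (complex_of_real a - 1) * (fact k * of_real (x + 1) powr (- of_nat (k + 1)))))"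
    using Beta_integral_half_line[of "of_real a" k 1] assms
    by (intro integrable_norm) (simp add: has_bochner_integral_iff)
  moreover have "norm (of_real x powr (complex_of_real a - 1) * (fact k * of_real (x + 1) powr (- of_nat (k + 1))))
      = fact k * (x powr (a - 1) * (1 + x) powr (- real (k + 1)))" if "x \<in> space half_line" for x
    using that norm_of_real_powr[of x "of_real a - 1"] norm_of_real_powr[of "x + 1" "- of_nat (k + 1)"]
    by (simp add: norm_mult add_ac)
  ultimately have "integrable half_line (\<lambda>x. fact k * (x powr (a - 1) * (1 + x) powr (- real (k + 1))))"
    by (rule Bochner_Integration.integrable_cong[THEN iffD1, OF refl, rotated])
  then show ?thesis by simp
qed

text \<open>In the Mellin representation the majorant only grows when x + t is replaced by x, so one
  integral bounds all t > 0. Dividing by Gamma(z + k) is multiplication by the entire function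
  \<open>rGamma\<close>, which is bounded on a disc.\<close>

lemma Li_reg_bounded_left:
  assumes s: "Re s < 1"
  shows "\<exists>r>0. \<exists>C. \<forall>z\<in>ball s r. Re z < 1 \<and> (\<forall>t>0. norm (Li_reg z (of_real t)) \<le> C)"
proof -
  \<comment> \<open>The choice gives Re s + k \<ge> 1; with a radius of at most 1 / 2 and below 1 -
    Re s, the whole disc satisfies -k < Re z < 1.\<close>
  define k where "k = nat \<lceil>1 - Re s\<rceil>"
  have k: "1 - Re s \<le> real k" by (simp add: k_def real_nat_ceiling_ge)
  define r where "r = min 1 (1 - Re s) / 2"
  have r: "r > 0" "r \<le> 1 / 2" "r < 1 - Re s" using s by (auto simp: r_def)
  define a where "a = Re s + k - r"
  define b where "b = Re s + k + r"
  have ab: "0 < a" "b < real k + 1" "a \<le> b" using r k by (auto simp: a_def b_def)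
  obtain C where C: "C \<ge> 0" "\<And>y. y > 0 \<Longrightarrow> norm (Li_reg (- of_nat k) (of_real y)) \<le> C * (1 + y) powr (- real (k + 1))"
    using Li_reg_neg_nat_bound by blast
  define g where "g x = C * (x powr (a - 1) * (1 + x) powr (- real (k + 1)) + x powr (b - 1) * (1 + x) powr (- real (k + 1)))" for x
  have g: "integrable half_line g"
    unfolding g_def using ab
    by (intro integrable_mult_right Bochner_Integration.integrable_add integrable_Beta_real) auto
  have "bounded (rGamma ` cball (s + of_nat k) r)"
    by (intro compact_imp_bounded compact_continuous_image holomorphic_on_imp_continuous_on holomorphic_intros) auto
  then obtain R where R: "\<And>w. w \<in> cball (s + of_nat k) r \<Longrightarrow> norm (rGamma w) \<le> R"
    unfolding bounded_iff by blast
  have R0: "R \<ge> 0" using order_trans[OF norm_ge_zero R[of "s + of_nat k"]] r by simp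
  have "Re z < 1 \<and> (\<forall>t>0. norm (Li_reg z (of_real t)) \<le> R * (\<integral>x. g x \<partial>half_line))" if z: "z \<in> ball s r" for z
  proof (intro conjI allI impI)
    have rez: "\<bar>Re s - Re z\<bar> < r" using z abs_Re_le_cmod[of "s - z"] by (simp add: dist_norm)
    then show z1: "Re z < 1" using r by linarith
    have zk: "- real k < Re z" using rez k r by linarith
    fix t :: real assume t: "t > 0"
    note I = Li_reg_integral[OF zk z1 t]
    have "norm (\<integral>x. of_real x powr (z + of_nat k - 1) * Li_reg (- of_nat k) (of_real (x + t)) \<partial>half_line) \<le> (\<integral>x. g x \<partial>half_line)"
    proof (rule Bochner_Integration.integral_norm_bound_integral[OF _ g])
      show "integrable half_line (\<lambda>x. of_real x powr (z + of_nat k - 1) * Li_reg (- of_nat k) (of_real (x + t)))"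
        using I by (simp add: has_bochner_integral_iff)
      fix x assume "x \<in> space half_line"
      then have x: "x > 0" by simp
      have "norm (of_real x powr (z + of_nat k - 1) * Li_reg (- of_nat k) (of_real (x + t)))
            \<le> (x powr (a - 1) + x powr (b - 1)) * (C * (1 + (x + t)) powr (- real (k + 1)))"
        unfolding norm_mult norm_of_real_powr[OF x]
        using rez x t C(1) by (intro mult_mono powr_between C(2)) (auto simp: a_def b_def)
      also have "\<dots> \<le> (x powr (a - 1) + x powr (b - 1)) * (C * (1 + x) powr (- real (k + 1)))"
        using x t C(1) by (intro mult_left_mono powr_mono2') auto
      also have "\<dots> = g x" by (simp add: g_def algebra_simps)
      finally show "norm (of_real x powr (z + of_nat k - 1) * Li_reg (- of_nat k) (of_real (x + t))) \<le> g x" .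
    qed
    then have 1: "norm (Gamma (z + of_nat k) * Li_reg z (of_real t)) \<le> (\<integral>x. g x \<partial>half_line)"
      using I by (simp add: has_bochner_integral_iff)
    have "z + of_nat k \<notin> \<int>\<^sub>\<le>\<^sub>0" using zk by (auto elim!: nonpos_Ints_cases simp: complex_eq_iff)
    then have "Li_reg z (of_real t) = rGamma (z + of_nat k) * (Gamma (z + of_nat k) * Li_reg z (of_real t))"
      by (simp add: rGamma_inverse_Gamma Gamma_eq_zero_iff)
    also have "norm \<dots> \<le> R * (\<integral>x. g x \<partial>half_line)"
      unfolding norm_mult[of "rGamma _"] using 1 z R0
      by (intro mult_mono R) (auto simp: dist_norm)
    finally show "norm (Li_reg z (of_real t)) \<le> R * (\<integral>x. g x \<partial>half_line)" .
  qed
  with r show ?thesis by blast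
qed

text \<open>A bound at order s - 1 is a Lipschitz constant in t at order s.\<close>

lemma Li_reg_diff_bound:
  assumes s: "s \<in> regular" and C: "\<And>u. u \<in> {0<..b} \<Longrightarrow> norm (Li_reg (s - 1) (of_real u)) \<le> C"
    and t: "t \<in> {0<..b}" "t' \<in> {0<..b}"
  shows "norm (Li_reg s (of_real t) - Li_reg s (of_real t')) \<le> C * \<bar>t - t'\<bar>"
proof -
  have "norm (Li_reg s (of_real t) - Li_reg s (of_real t')) \<le> C * norm (complex_of_real t - complex_of_real t')"
  proof (rule field_differentiable_bound[where S = "complex_of_real ` {0<..b}" and f' = "\<lambda>z. - Li_reg (s - 1) z"])
    show "convex (complex_of_real ` {0<..b})"
      by (intro convex_linear_image bounded_linear.linear[OF bounded_linear_of_real]) auto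
  qed (use t C s in \<open>auto intro!: has_field_derivative_at_within[OF Li_reg_has_field_derivative]\<close>)
  then show ?thesis by (simp flip: of_real_diff)
qed

text \<open>Induction over vertical strips of width 1, starting from Re s < 1: by the bound at order
  s - 1 the function stays within bounded distance of its value at t = 1, and that value is
  holomorphic in the order.\<close>

lemma Li_reg_bounded:
  assumes "s \<in> regular"
  shows "\<exists>r>0. \<exists>C. ball s r \<subseteq> regular \<and> (\<forall>z\<in>ball s r. \<forall>t\<in>{0<..1}. norm (Li_reg z (of_real t)) \<le> C)"
proof -
  have "Re s < 1 + real n \<Longrightarrow> s \<in> regular \<Longrightarrow> ?thesis" for n
  proof (induction n arbitrary: s)
    case 0
    then have "Re s < 1" by simp
    from Li_reg_bounded_left[OF this] obtain r C where "r > 0" and rC: "\<And>z. z \<in> ball s r \<Longrightarrow> Re z < 1 \<and> (\<forall>t>0. norm (Li_reg z (of_real t)) \<le> C)"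
      by blast
    have "ball s r \<subseteq> regular" using regular_if_Re rC by blast
    moreover have "\<forall>z\<in>ball s r. \<forall>t\<in>{0<..1}. norm (Li_reg z (of_real t)) \<le> C" using rC by simp
    ultimately show ?case using \<open>r > 0\<close> by blast
  next
    case (Suc n)
    then have "Re (s - 1) < 1 + real n" "s - 1 \<in> regular" using regular_minus_1 by auto
    from Suc.IH[OF this] obtain r C where r: "r > 0" and
      C: "\<And>z t. z \<in> ball (s - 1) r \<Longrightarrow> t \<in> {0<..1} \<Longrightarrow> norm (Li_reg z (of_real t)) \<le> C" by blast
    obtain r' where r': "r' > 0" "cball s r' \<subseteq> regular"
      using open_regular Suc.prems(2) by (meson open_contains_cball)
    have "bounded ((\<lambda>z. Li_reg z 1) ` cball s r')"
      using r' by (intro compact_imp_bounded compact_continuous_image holomorphic_on_imp_continuous_on holomorphic_Li_reg_left) auto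
    then obtain C' where C': "\<And>z. z \<in> cball s r' \<Longrightarrow> norm (Li_reg z 1) \<le> C'"
      unfolding bounded_iff by blast
    show ?case
    proof (intro exI conjI ballI)
      show "min r r' > 0" using r r' by simp
      show "ball s (min r r') \<subseteq> regular" using r' by auto
      fix z t assume z: "z \<in> ball s (min r r')" and t: "t \<in> {0<..1::real}"
      have zr: "z - 1 \<in> ball (s - 1) r" using z by (simp add: dist_norm algebra_simps)
      have zr': "z \<in> cball s r'" using z by auto
      have C0: "C \<ge> 0" using order_trans[OF norm_ge_zero C[OF zr t]] .
      have "norm (Li_reg z (of_real t) - Li_reg z (of_real 1)) \<le> C * \<bar>t - 1\<bar>"
        using zr zr' r' t by (intro Li_reg_diff_bound[where b = 1] C) auto
      also have "\<dots> \<le> C * 1" using t C0 by (intro mult_left_mono) auto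
      finally show "norm (Li_reg z (of_real t)) \<le> C + C'"
        using C'[OF zr'] norm_triangle_sub[of "Li_reg z (of_real t)" "Li_reg z 1"] by simp
    qed
  qed
  moreover have "Re s < 1 + real (nat \<lceil>Re s\<rceil>)" using real_nat_ceiling_ge[of "Re s"] by linarith
  ultimately show ?thesis using assms by blast
qed

section \<open>The constant term of the expansion at t = 0\<close>

lemma LIMSEQ_inverse_Suc: "(\<lambda>n. 1 / real (Suc n)) \<longlonglongrightarrow> 0"
  using LIMSEQ_inverse_real_of_nat by (simp add: inverse_eq_divide)

text \<open>A sequence stands in for t \<rightarrow> 0 so that the theorem on locally uniform limits
  of sequences of holomorphic functions applies directly.\<close>

definition zlim :: "complex \<Rightarrow> complex" where
  "zlim s = lim (\<lambda>n. Li_reg s (of_real (1 / real (Suc n))))"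

lemma
  assumes s: "s \<in> regular" and C: "\<And>u. u \<in> {0<..1} \<Longrightarrow> norm (Li_reg (s - 1) (of_real u)) \<le> C"
  shows Li_reg_zlim_LIMSEQ: "(\<lambda>n. Li_reg s (of_real (1 / real (Suc n)))) \<longlonglongrightarrow> zlim s"
    and Li_reg_zlim_bound: "t \<in> {0<..1} \<Longrightarrow> norm (Li_reg s (of_real t) - zlim s) \<le> C * t"
proof -
  define X where "X n = Li_reg s (of_real (1 / real (Suc n)))" for n
  have d: "norm (X m - X n) \<le> C * \<bar>1 / real (Suc m) - 1 / real (Suc n)\<bar>" for m n
    unfolding X_def by (rule Li_reg_diff_bound[OF s C]) auto
  have C0: "C \<ge> 0" using order_trans[OF norm_ge_zero C[of 1]] by simp
  have "Cauchy (\<lambda>n. 1 / real (Suc n))" by (rule LIMSEQ_imp_Cauchy[OF LIMSEQ_inverse_Suc])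
  have "Cauchy X"
  proof (rule metric_CauchyI)
    fix e :: real assume e: "e > 0"
    \<comment> \<open>The constant \<open>C\<close> may be 0, so \<open>C + 1\<close> serves as
      divisor.\<close>
    then have "e / (C + 1) > 0" using C0 by simp
    then obtain M where M: "\<And>m n. m \<ge> M \<Longrightarrow> n \<ge> M \<Longrightarrow> \<bar>1 / real (Suc m) - 1 / real (Suc n)\<bar> < e / (C + 1)"
      using \<open>Cauchy (\<lambda>n. 1 / real (Suc n))\<close> unfolding Cauchy_def dist_real_def by meson
    have "dist (X m) (X n) < e" if "m \<ge> M" "n \<ge> M" for m n
    proof -
      have "dist (X m) (X n) \<le> C * \<bar>1 / real (Suc m) - 1 / real (Suc n)\<bar>" using d by (simp add: dist_norm)
      also have "\<dots> \<le> (C + 1) * \<bar>1 / real (Suc m) - 1 / real (Suc n)\<bar>"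
        by (intro mult_right_mono) auto
      also have "\<dots> < (C + 1) * (e / (C + 1))" using M[OF that] C0 by (intro mult_strict_left_mono) auto
      also have "\<dots> = e" using C0 by simp
      finally show ?thesis .
    qed
    then show "\<exists>M. \<forall>m\<ge>M. \<forall>n\<ge>M. dist (X m) (X n) < e" by blast
  qed
  then have "convergent X" by (simp add: Cauchy_convergent_iff)
  then show L: "(\<lambda>n. Li_reg s (of_real (1 / real (Suc n)))) \<longlonglongrightarrow> zlim s"
    unfolding X_def zlim_def by (simp add: convergent_LIMSEQ_iff)
  assume t: "t \<in> {0<..1}"
  have "(\<lambda>n. norm (Li_reg s (of_real t) - Li_reg s (of_real (1 / real (Suc n))))) \<longlonglongrightarrow> norm (Li_reg s (of_real t) - zlim s)"
    by (intro tendsto_intros L)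
  moreover have "(\<lambda>n. C * \<bar>t - 1 / real (Suc n)\<bar>) \<longlonglongrightarrow> C * \<bar>t - 0\<bar>"
    by (intro tendsto_intros LIMSEQ_inverse_Suc)
  moreover have "norm (Li_reg s (of_real t) - Li_reg s (of_real (1 / real (Suc n)))) \<le> C * \<bar>t - 1 / real (Suc n)\<bar>" for n
    by (rule Li_reg_diff_bound[OF s C]) (use t in auto)
  ultimately have "norm (Li_reg s (of_real t) - zlim s) \<le> C * \<bar>t - 0\<bar>"
    by (intro LIMSEQ_le[of _ _ "\<lambda>n. C * \<bar>t - 1 / real (Suc n)\<bar>"]) auto
  then show "norm (Li_reg s (of_real t) - zlim s) \<le> C * t" using t by simp
qed

lemma Li_reg_zlim_uniform:
  assumes s: "s \<in> regular"
  obtains r C where "r > 0" "C \<ge> 0" "cball s r \<subseteq> regular"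
    "\<And>z t. z \<in> cball s r \<Longrightarrow> t \<in> {0<..1} \<Longrightarrow> norm (Li_reg z (of_real t) - zlim z) \<le> C * t"
proof -
  obtain r C where r: "r > 0" and C: "\<And>z t. z \<in> ball (s - 1) r \<Longrightarrow> t \<in> {0<..1} \<Longrightarrow> norm (Li_reg z (of_real t)) \<le> C"
    using Li_reg_bounded[OF regular_minus_1[OF s]] by blast
  obtain r' where r': "r' > 0" "cball s r' \<subseteq> regular"
    using open_regular s by (meson open_contains_cball)
  define d where "d = min r' (r / 2)"
  have d: "d > 0" "cball s d \<subseteq> regular" "d < r" using r r' by (auto simp: d_def)
  have C0: "C \<ge> 0" using order_trans[OF norm_ge_zero C[of "s - 1" 1]] r by simp
  have "norm (Li_reg z (of_real t) - zlim z) \<le> C * t" if z: "z \<in> cball s d" and t: "t \<in> {0<..1}" for z t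
  proof (rule Li_reg_zlim_bound[OF _ _ t])
    show "z \<in> regular" using z d by auto
    have "z - 1 \<in> ball (s - 1) r" using z d by (simp add: dist_norm)
    then show "norm (Li_reg (z - 1) (of_real u)) \<le> C" if "u \<in> {0<..1}" for u using that C by blast
  qed
  then show ?thesis using that d C0 by blast
qed

lemma Li_reg_LIMSEQ: "s \<in> regular \<Longrightarrow> (\<lambda>n. Li_reg s (of_real (1 / real (Suc n)))) \<longlonglongrightarrow> zlim s"
proof -
  assume s: "s \<in> regular"
  obtain r C where r: "r > 0" and C: "\<And>z t. z \<in> ball (s - 1) r \<Longrightarrow> t \<in> {0<..1} \<Longrightarrow> norm (Li_reg z (of_real t)) \<le> C"
    using Li_reg_bounded[OF regular_minus_1[OF s]] by blast
  show ?thesis by (rule Li_reg_zlim_LIMSEQ[OF s C]) (use r in auto)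
qed

lemma zlim_holomorphic: "zlim holomorphic_on regular"
proof (rule holomorphic_uniform_sequence[OF open_regular, where f = "\<lambda>n s. Li_reg s (of_real (1 / real (Suc n)))"])
  show "(\<lambda>s. Li_reg s (of_real (1 / real (Suc n)))) holomorphic_on regular" for n
    by (rule holomorphic_Li_reg_left) auto
  fix x assume "x \<in> regular"
  then obtain d C where d: "d > 0" "cball x d \<subseteq> regular"
    and C: "\<And>z t. z \<in> cball x d \<Longrightarrow> t \<in> {0<..1} \<Longrightarrow> norm (Li_reg z (of_real t) - zlim z) \<le> C * t"
    by (rule Li_reg_zlim_uniform) (rule that; assumption)
  have "uniform_limit (cball x d) (\<lambda>n s. Li_reg s (of_real (1 / real (Suc n)))) zlim sequentially"
  proof (rule uniform_limitI)
    fix e :: real assume e: "e > 0"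
    have "(\<lambda>n. C * (1 / real (Suc n))) \<longlonglongrightarrow> C * 0" by (intro tendsto_intros LIMSEQ_inverse_Suc)
    then have "\<forall>\<^sub>F n in sequentially. C * (1 / real (Suc n)) < e"
      using e by (intro order_tendstoD(2)) auto
    then show "\<forall>\<^sub>F n in sequentially. \<forall>z\<in>cball x d. dist (Li_reg z (of_real (1 / real (Suc n)))) (zlim z) < e"
      by eventually_elim (auto simp: dist_norm simp del: of_nat_Suc of_real_divide intro!: order.strict_trans1[OF C])
  qed
  with d show "\<exists>d>0. cball x d \<subseteq> regular \<and> uniform_limit (cball x d) (\<lambda>n s. Li_reg s (of_real (1 / real (Suc n)))) zlim sequentially"
    by blast
qed

subsection \<open>The zeta function\<close>

definition dirichlet :: "complex \<Rightarrow> complex" where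
  "dirichlet s = (\<Sum>n. 1 / of_nat (Suc n) powr s)"

lemma summable_Suc_powr: "a > 1 \<Longrightarrow> summable (\<lambda>m. real (Suc m) powr (- a))"
  using summable_real_powr_iff[of "- a"] by (subst summable_Suc_iff) simp

lemma dirichlet_altdef: "dirichlet s = (\<Sum>n. of_nat (Suc n) powr (- s))"
  by (simp only: dirichlet_def powr_minus divide_inverse mult_1)

lemma dirichlet_summable: "Re s > 1 \<Longrightarrow> summable (\<lambda>n. norm (of_nat (Suc n) powr (- s) :: complex))"
  unfolding norm_Suc_powr using summable_Suc_powr[of "Re s"] by simp

lemma dirichlet_has_field_derivative:
  assumes s: "Re s > 1"
  shows "(dirichlet has_field_derivative
           (\<Sum>n. - of_real (ln (Suc n)) * of_nat (Suc n) powr (- s))) (at s)"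
proof -
  have 1: "((\<lambda>s. of_nat (Suc n) powr (- s) :: complex) has_field_derivative
            - of_real (ln (Suc n)) * of_nat (Suc n) powr (- x)) (at x)" for n x
  proof -
    have "((\<lambda>s. of_nat (Suc n) powr (- s) :: complex) has_field_derivative Ln (of_nat (Suc n)) * of_nat (Suc n) powr (- x) * - 1) (at x)"
      by (rule DERIV_chain2[OF has_field_derivative_powr_right]) (auto intro!: derivative_eq_intros simp del: of_nat_Suc)
    then show ?thesis by (simp add: Ln_of_nat del: of_nat_Suc)
  qed
  have 2: "\<exists>d>0. \<exists>h. summable h \<and> (\<forall>n. \<forall>y\<in>ball x d \<inter> {s. Re s > 1}. norm (of_nat (Suc n) powr (- y) :: complex) \<le> h n)"
    if x: "x \<in> {s. Re s > 1}" for x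
  proof (intro exI conjI allI ballI)
    show "(Re x - 1) / 2 > 0" using x by simp
    show "summable (\<lambda>n. real (Suc n) powr (- ((1 + Re x) / 2)))"
      by (rule summable_Suc_powr) (use x in auto)
    fix n y assume "y \<in> ball x ((Re x - 1) / 2) \<inter> {s. Re s > 1}"
    then have "(1 + Re x) / 2 \<le> Re y"
      using abs_Re_le_cmod[of "x - y"] by (simp add: dist_norm field_simps) linarith
    then show "norm (of_nat (Suc n) powr (- y) :: complex) \<le> real (Suc n) powr (- ((1 + Re x) / 2))"
      unfolding norm_Suc_powr by (intro powr_mono) auto
  qed
  have op: "open {s. Re s > 1}" by (rule open_halfspace_Re_gt)
  show "(dirichlet has_field_derivative (\<Sum>n. - of_real (ln (Suc n)) * of_nat (Suc n) powr (- s))) (at s)"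
    unfolding dirichlet_altdef[abs_def] by (rule suminf_has_field_derivative[OF op 1 2]) (use s in auto)
qed

lemma dirichlet_holomorphic: "dirichlet holomorphic_on {s. Re s > 1}"
  using dirichlet_has_field_derivative
  by (subst holomorphic_on_open) (auto simp: open_halfspace_Re_gt)

text \<open>For Re s > 1 the subtracted power t^(s-1) tends to 0, and Tannery's theorem takes the
  limit of the polylogarithm inside the sum, with the majorant m^(- Re s).\<close>

lemma zlim_eq_dirichlet:
  assumes s: "s \<in> regular" "Re s > 1"
  shows "zlim s = dirichlet s"
proof -
  have L: "(\<lambda>n. Li_reg s (of_real (1 / real (Suc n)))) \<longlonglongrightarrow> zlim s"
    by (rule Li_reg_LIMSEQ[OF s(1)])
  have "(\<lambda>n. \<Sum>k. of_nat (Suc k) powr (- s) * exp (- (of_nat (Suc k) * complex_of_real (1 / real (Suc n))))) \<longlonglongrightarrow>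
         (\<Sum>k. of_nat (Suc k) powr (- s))"
  proof (intro conjunct2[OF conjunct2[OF tannerys_theorem]])
    show "(\<lambda>n. of_nat (Suc k) powr (- s) * exp (- (of_nat (Suc k) * complex_of_real (1 / real (Suc n))))) \<longlonglongrightarrow> of_nat (Suc k) powr (- s)" for k
    proof -
      have "(\<lambda>n. of_nat (Suc k) powr (- s) * exp (- (of_nat (Suc k) * complex_of_real (1 / real (Suc n))))) \<longlonglongrightarrow>
            of_nat (Suc k) powr (- s) * exp (- (of_nat (Suc k) * complex_of_real 0))"
        by (intro tendsto_intros LIMSEQ_inverse_Suc)
      then show ?thesis by simp
    qed
    have "norm (of_nat (Suc k) powr (- s) * exp (- (of_nat (Suc k) * complex_of_real (1 / real (Suc n))))) \<le> real (Suc k) powr (- Re s) * 1" for k n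
      unfolding norm_mult norm_Suc_powr by (intro mult_mono) auto
    then show "\<forall>\<^sub>F (k, n) in sequentially \<times>\<^sub>F sequentially.
       norm (of_nat (Suc k) powr (- s) * exp (- (of_nat (Suc k) * complex_of_real (1 / real (Suc n))))) \<le> real (Suc k) powr (- Re s)"
      by (intro always_eventually) auto
  qed (use summable_Suc_powr s in auto)
  then have 1: "(\<lambda>n. Li s (of_real (1 / real (Suc n)))) \<longlonglongrightarrow> dirichlet s"
    unfolding Li_def dirichlet_altdef .
  have "(\<lambda>n. (1 / real (Suc n)) powr (Re s - 1)) \<longlonglongrightarrow> 0"
  proof -
    have "filterlim (\<lambda>n. real (Suc n)) at_top sequentially"
      using filterlim_compose[OF filterlim_real_sequentially filterlim_Suc] by simp
    then have "(\<lambda>n. real (Suc n) powr (- (Re s - 1))) \<longlonglongrightarrow> 0"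
      by (intro tendsto_neg_powr) (use s in auto)
    moreover have "(1 / real (Suc n)) powr (Re s - 1) = real (Suc n) powr (- (Re s - 1))" for n
      unfolding powr_minus_divide by (subst powr_divide) auto
    ultimately show ?thesis by (simp only:)
  qed
  then have "(\<lambda>n. norm (complex_of_real (1 / real (Suc n)) powr (s - 1))) \<longlonglongrightarrow> 0"
    by (subst norm_of_real_powr) auto
  then have "(\<lambda>n. complex_of_real (1 / real (Suc n)) powr (s - 1)) \<longlonglongrightarrow> 0"
    by (rule tendsto_norm_zero_cancel)
  then have "(\<lambda>n. Li s (of_real (1 / real (Suc n))) - Gamma (1 - s) * complex_of_real (1 / real (Suc n)) powr (s - 1)) \<longlonglongrightarrow> dirichlet s - Gamma (1 - s) * 0"
    by (intro tendsto_intros 1)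
  then have "(\<lambda>n. Li_reg s (of_real (1 / real (Suc n)))) \<longlonglongrightarrow> dirichlet s"
    by (simp add: Li_reg_def)
  then show ?thesis using L LIMSEQ_unique by blast
qed

text \<open>Everything that \<open>zlim\<close> misses, apart from the pole, lies in the half-plane
  of the Dirichlet series; so the two pieces cover the punctured plane.\<close>

lemma not_regular: "s \<notin> regular \<Longrightarrow> s = 1 \<or> Re s > 1"
proof -
  assume "s \<notin> regular"
  then obtain m :: int where m: "1 - s = of_int m" "m \<le> 0"
    by (auto simp: regular_def elim!: nonpos_Ints_cases)
  then have "s = of_int (1 - m)" by (simp add: algebra_simps)
  with m show ?thesis by (cases "m = 0") auto
qed

text \<open>The continuation is patched from the Dirichlet series and \<open>zlim\<close>, which
  agree where both are available. The identity theorem on the connected punctured plane, together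
  with the prescribed value at 1, gives the uniqueness that \<open>THE\<close> requires.\<close>

lemma
  shows zeta_holomorphic: "zeta holomorphic_on - {1}"
    and zeta_eq_dirichlet: "Re s > 1 \<Longrightarrow> zeta s = dirichlet s"
proof -
  define P where "P f \<longleftrightarrow> f holomorphic_on - {1} \<and> f 1 = 0 \<and> (\<forall>s. Re s > 1 \<longrightarrow> f s = (\<Sum>n. 1 / of_nat (Suc n) powr s))"
    for f :: "complex \<Rightarrow> complex"
  define f where "f s = (if s = 1 then 0 else if Re s > 1 then dirichlet s else zlim s)" for s
  have "f holomorphic_on ({s. Re s > 1} \<union> regular)"
  proof (rule holomorphic_on_Un)
    show "f holomorphic_on {s. Re s > 1}"
      by (rule holomorphic_transform[OF dirichlet_holomorphic]) (auto simp: f_def)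
    have "1 \<notin> regular" by (simp add: regular_def)
    then show "f holomorphic_on regular"
      by (intro holomorphic_transform[OF zlim_holomorphic]) (auto simp: f_def zlim_eq_dirichlet)
  qed (auto simp: open_regular open_halfspace_Re_gt)
  moreover have "- {1} \<subseteq> {s. Re s > 1} \<union> regular" using not_regular by auto
  ultimately have "f holomorphic_on - {1}" by (rule holomorphic_on_subset)
  then have Pf: "P f" by (auto simp: P_def f_def dirichlet_def)
  have "g = f" if "P g" for g
  proof
    fix z show "g z = f z"
    proof (cases "z = 1")
      case False
      show ?thesis
      proof (rule analytic_continuation_open[of "{s. Re s > 1}" "- {1}" g f])
        have "2 \<in> {s. Re s > 1}" by simp
        then show "{s. Re s > 1} \<noteq> {}" by blast
        show "connected (- {1 :: complex})" by (rule connected_punctured_universe) simp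
      qed (use that Pf False in \<open>auto simp: P_def open_halfspace_Re_gt\<close>)
    qed (use that Pf in \<open>auto simp: P_def\<close>)
  qed
  with Pf have "P (THE f. P f)" by (metis theI)
  then have "P zeta" by (simp add: P_def zeta_def)
  then show "zeta holomorphic_on - {1}" "Re s > 1 \<Longrightarrow> zeta s = dirichlet s"
    by (auto simp: P_def dirichlet_def)
qed

lemma zeta_holomorphic_on [holomorphic_intros]:
  "f holomorphic_on A \<Longrightarrow> (\<And>z. z \<in> A \<Longrightarrow> f z \<noteq> 1) \<Longrightarrow> (\<lambda>z. zeta (f z)) holomorphic_on A"
proof -
  assume "f holomorphic_on A" "\<And>z. z \<in> A \<Longrightarrow> f z \<noteq> 1"
  then have "zeta \<circ> f holomorphic_on A"
    by (intro holomorphic_on_compose_gen[OF _ zeta_holomorphic]) auto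
  then show ?thesis by (simp add: o_def)
qed

lemma regular_neq_1: "s \<in> regular \<Longrightarrow> s \<noteq> 1"
  by (auto simp: regular_def)

lemma connected_regular: "connected regular"
proof -
  have "s \<notin> regular \<longleftrightarrow> s \<in> range (\<lambda>n. of_nat (Suc n))" for s
  proof
    assume "s \<notin> regular"
    then obtain m :: int where m: "1 - s = of_int m" "m \<le> 0"
      by (auto simp: regular_def elim!: nonpos_Ints_cases)
    then have "s = of_nat (Suc (nat (- m)))" by (simp add: algebra_simps)
    then show "s \<in> range (\<lambda>n. of_nat (Suc n))" by blast
  qed (auto simp: regular_def)
  then have "regular = - range (\<lambda>n. of_nat (Suc n))" by blast
  moreover have "connected (- (\<lambda>n. of_nat (Suc n)) ` UNIV :: complex set)"
    by (intro path_connected_imp_connected path_connected_complement_countable countable_image) auto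
  ultimately show ?thesis by simp
qed

lemma zeta_eq_zlim: "s \<in> regular \<Longrightarrow> zeta s = zlim s"
proof -
  assume s: "s \<in> regular"
  show ?thesis
  \<comment> \<open>The condition Im s > 0 keeps the starting region away from the positive
    integers, which \<open>regular\<close> omits.\<close>
  proof (rule analytic_continuation_open[of "{s. Re s > 1} \<inter> {s. Im s > 0}" regular zeta zlim])
    have "Complex 2 1 \<in> {s. Re s > 1} \<inter> {s. Im s > 0}" by simp
    then show "{s. Re s > 1} \<inter> {s. Im s > 0} \<noteq> {}" by blast
    show "open ({s. Re s > 1} \<inter> {s. Im s > 0})"
      by (intro open_Int open_halfspace_Re_gt open_halfspace_Im_gt)
    show *: "{s. Re s > 1} \<inter> {s. Im s > 0} \<subseteq> regular"
      by (auto simp: regular_def complex_eq_iff elim!: nonpos_Ints_cases)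
    show "zeta z = zlim z" if "z \<in> {s. Re s > 1} \<inter> {s. Im s > 0}" for z
      using that * by (subst zeta_eq_dirichlet) (auto simp: zlim_eq_dirichlet)
    show "zeta holomorphic_on regular"
      using regular_neq_1 by (intro holomorphic_on_subset[OF zeta_holomorphic]) auto
  qed (use s connected_regular open_regular zlim_holomorphic in auto)
qed

text \<open>Near s = 1 the difference of \<open>Li_reg s 1\<close> and \<open>zeta s\<close> is
  bounded, by the uniform bound for orders near 0, while (s - 1) times \<open>Li_reg s 1\<close>
  equals \<open>h s\<close>, the pole of Gamma(1 - s) being absorbed into Gamma(2 - s). So (s - 1)
  zeta(s) is bounded near 1, and Riemann's theorem removes the singularity.\<close>

lemma zeta_simple_pole:
  obtains \<xi> where "\<xi> holomorphic_on UNIV" "\<And>s. s \<noteq> 1 \<Longrightarrow> (s - 1) * zeta s = \<xi> s"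
proof -
  define f where "f s = (s - 1) * zeta s" for s
  define h where "h s = (s - 1) * Li s 1 + Gamma (2 - s)" for s
  obtain r C where r: "r > 0" and C: "\<And>z t. z \<in> ball 0 r \<Longrightarrow> t \<in> {0<..1} \<Longrightarrow> norm (Li_reg z (of_real t)) \<le> C"
    using Li_reg_bounded[OF regular_if_Re, of 0] by (metis zero_complex.sel(1) zero_less_one)
  \<comment> \<open>The bound 1 / 2 leaves 1 as the only positive integer in the disc.\<close>
  define d where "d = min r (1 / 2)"
  have d: "d > 0" "d \<le> 1 / 2" "d \<le> r" using r by (auto simp: d_def)
  have nn: "2 - s \<notin> \<int>\<^sub>\<le>\<^sub>0" if "s \<in> ball 1 d" for s :: complex
  proof -
    have "\<bar>1 - Re s\<bar> < 1" using that d abs_Re_le_cmod[of "1 - s"] by (simp add: dist_norm)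
    then show ?thesis by (auto simp: complex_eq_iff elim!: nonpos_Ints_cases)
  qed
  have "h holomorphic_on ball 1 d"
    unfolding h_def using nn by (intro holomorphic_intros holomorphic_Li_left) auto
  then have "isCont h 1"
    using d continuous_on_eq_continuous_at[OF open_ball] holomorphic_on_imp_continuous_on centre_in_ball by blast
  then have "((\<lambda>s. norm (h s)) \<longlongrightarrow> norm (h 1)) (at 1)"
    unfolding isCont_def by (rule tendsto_norm)
  then have ev: "\<forall>\<^sub>F s in at 1. norm (h s) < norm (h 1) + 1"
    by (rule order_tendstoD) simp
  have ball: "\<forall>\<^sub>F s in at 1. s \<in> ball 1 d - {1}"
    using d by (intro eventually_at_in_open) auto
  have "\<forall>\<^sub>F s in at 1. norm (f s) \<le> norm (h 1) + 1 + C"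
    using ev ball
  proof eventually_elim
    case (elim s)
    then have s: "s \<in> ball 1 d" "s \<noteq> 1" by auto
    have "norm (s - 1) < 1 / 2" using s d by (auto simp: dist_norm norm_minus_commute)
    have sreg: "s \<in> regular"
      unfolding regular_def mem_Collect_eq
    proof
      assume "1 - s \<in> \<int>\<^sub>\<le>\<^sub>0"
      then obtain m :: int where m: "1 - s = of_int m" by (auto elim!: nonpos_Ints_cases)
      then have "norm (1 - s) = \<bar>real_of_int m\<bar>" by simp
      then have "m = 0" using \<open>norm (s - 1) < 1 / 2\<close> by (simp add: norm_minus_commute)
      then show False using m s by simp
    qed
    have s1: "s - 1 \<in> ball 0 r" using s d by (auto simp: dist_norm norm_minus_commute)
    have "norm (Li_reg s (of_real 1) - zeta s) \<le> C * 1"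
      unfolding zeta_eq_zlim[OF sreg] by (rule Li_reg_zlim_bound[OF sreg C[OF s1]]) auto
    moreover have C0: "C \<ge> 0" using order_trans[OF norm_ge_zero C[of 0 1]] r by simp
    ultimately have 1: "norm ((s - 1) * (Li_reg s 1 - zeta s)) \<le> C"
      unfolding norm_mult using \<open>norm (s - 1) < 1 / 2\<close> mult_mono[of "norm (s - 1)" 1 "norm (Li_reg s 1 - zeta s)" C] by auto
    have "Gamma (2 - s) = (1 - s) * Gamma (1 - s)"
      using Gamma_plus1[of "1 - s"] sreg by (auto simp: regular_def algebra_simps)
    then have "(s - 1) * Li_reg s 1 = h s"
      by (simp add: Li_reg_def h_def algebra_simps)
    then have F: "f s = h s - (s - 1) * (Li_reg s 1 - zeta s)" by (simp add: f_def algebra_simps)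
    show ?case unfolding F using 1 elim norm_triangle_ineq4[of "h s" "(s - 1) * (Li_reg s 1 - zeta s)"] by linarith
  qed
  moreover have "f holomorphic_on UNIV - {1}"
    unfolding f_def by (intro holomorphic_intros) auto
  ultimately obtain \<xi> where "\<xi> holomorphic_on UNIV" "\<forall>z\<in>UNIV - {1}. \<xi> z = f z"
    using holomorphic_on_extend_bounded[of f UNIV 1] by auto
  then show ?thesis using that[of \<xi>] by (auto simp: f_def)
qed

text \<open>
  The exponent 3 makes both products vanish at 1, so that the conventional values of \<open>zeta\<close> and
  \<open>deriv zeta\<close> at the pole are harmless.
\<close>

lemma entire_zeta_factors:
  shows "(\<lambda>s. (s - 1) ^ 3 * zeta s) holomorphic_on UNIV"
    and "(\<lambda>s. (s - 1) ^ 3 * deriv zeta s) holomorphic_on UNIV"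
proof -
  obtain \<xi> where \<xi>: "\<xi> holomorphic_on UNIV" "\<And>s. s \<noteq> 1 \<Longrightarrow> (s - 1) * zeta s = \<xi> s"
    using zeta_simple_pole by blast
  have "(s - 1) ^ 3 * zeta s = (s - 1) ^ 2 * \<xi> s" for s
    using \<xi>(2)[of s] by (cases "s = 1") (auto simp: power2_eq_square power3_eq_cube)
  then show "(\<lambda>s. (s - 1) ^ 3 * zeta s) holomorphic_on UNIV"
    by (simp add: holomorphic_intros \<xi>(1))
  have "(s - 1) ^ 3 * deriv zeta s = (s - 1) ^ 2 * deriv \<xi> s - (s - 1) * \<xi> s" for s
  proof (cases "s = 1")
    case False
    have "(zeta has_field_derivative deriv zeta s) (at s)"
      using False by (intro holomorphic_derivI[OF zeta_holomorphic]) auto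
    then have "((\<lambda>s. (s - 1) * zeta s) has_field_derivative zeta s + (s - 1) * deriv zeta s) (at s)"
      by (auto intro!: derivative_eq_intros)
    then have "(\<xi> has_field_derivative zeta s + (s - 1) * deriv zeta s) (at s)"
      by (rule has_field_derivative_transform_within_open[of _ _ _ "- {1}"]) (use False \<xi>(2) in auto)
    then have D: "deriv \<xi> s = zeta s + (s - 1) * deriv zeta s" by (rule DERIV_imp_deriv)
    show ?thesis
      unfolding D \<xi>(2)[OF False, symmetric] by (simp add: power2_eq_square power3_eq_cube algebra_simps)
  qed simp
  moreover have "(\<lambda>s. (s - 1) ^ 2 * deriv \<xi> s - (s - 1) * \<xi> s) holomorphic_on UNIV"
    by (intro holomorphic_intros holomorphic_deriv \<xi>(1)) auto
  ultimately show "(\<lambda>s. (s - 1) ^ 3 * deriv zeta s) holomorphic_on UNIV" by simp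
qed

section \<open>Values and zeros of zeta at the integers\<close>

text \<open>At integer order the limit t \<rightarrow> 0 is plain continuity of a derivative of
  \<open>bern\<close>. In terms of Bernoulli numbers the right-hand side is (-1)^k B_{k+1} / (k +
  1), with B_1 = -1/2.\<close>

lemma zeta_neg_nat: "zeta (- of_nat k) = (- 1) ^ k * (deriv ^^ k) bern 0"
proof -
  have reg: "- of_nat k \<in> regular" by (rule regular_if_Re) simp
  have lim0: "(\<lambda>n. complex_of_real (1 / real (Suc n))) \<longlonglongrightarrow> of_real 0"
    by (intro tendsto_of_real LIMSEQ_inverse_Suc)
  have S0: "0 \<in> strip" by (simp add: strip_def)
  have "continuous_on strip ((deriv ^^ k) bern)"
    by (intro holomorphic_on_imp_continuous_on holomorphic_higher_deriv[OF bern_holomorphic open_strip])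
  then have "isCont ((deriv ^^ k) bern) 0"
    using continuous_on_eq_continuous_at[OF open_strip] S0 by blast
  then have "(\<lambda>n. (deriv ^^ k) bern (complex_of_real (1 / real (Suc n)))) \<longlonglongrightarrow> (deriv ^^ k) bern 0"
    using isCont_tendsto_compose lim0 by fastforce
  then have "(\<lambda>n. (- 1) ^ k * ((- 1) ^ k * Li_reg (- of_nat k) (of_real (1 / real (Suc n))))) \<longlonglongrightarrow> (- 1) ^ k * (deriv ^^ k) bern 0"
    by (intro tendsto_intros) (subst (asm) higher_deriv_bern, auto)
  moreover have "(- 1) ^ k * ((- 1) ^ k * z) = z" for z :: complex
    by (simp add: mult.assoc[symmetric] power_mult_distrib[symmetric])
  ultimately have "(\<lambda>n. Li_reg (- of_nat k) (of_real (1 / real (Suc n)))) \<longlonglongrightarrow> (- 1) ^ k * (deriv ^^ k) bern 0"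
    by simp
  with Li_reg_LIMSEQ[OF reg] show ?thesis unfolding zeta_eq_zlim[OF reg] by (rule LIMSEQ_unique)
qed

lemma zeta_0: "zeta 0 = - 1 / 2"
  using zeta_neg_nat[of 0] by (simp add: bern_def)

text \<open>
  The odd Taylor coefficients of \<open>g z = 1 / (exp z - 1) - 1 / z + 1 / 2\<close> do not vanish: by the
  Riccati equation \<open>z * g' + 2 * g = z / 4 - z * g ^ 2\<close>, they have alternating signs.
\<close>

lemma higher_deriv_bern_0_nonzero:
  assumes "odd k"
  shows "(deriv ^^ k) bern 0 \<noteq> 0"
proof -
  define g where "g z = bern z + 1 / 2" for z
  have S0: "0 \<in> strip" by (simp add: strip_def)
  have g: "g holomorphic_on strip"
    unfolding g_def by (intro holomorphic_intros bern_holomorphic)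
  define G where "G = fps_expansion g 0"
  have G [fps_expansion_intros]: "g has_fps_expansion G"
    unfolding G_def by (rule has_fps_expansion_fps_expansion[OF open_strip S0 g])
  have ode: "z * deriv g z + 2 * g z = 1 / 4 * z - z * (g z * g z)" if z: "z \<in> strip" for z
  proof (cases "z = 0")
    case False
    have e: "exp z - 1 \<noteq> 0" using exp_neq_1_strip[OF z False] by simp
    have "((\<lambda>z. 1 / (exp z - 1) - 1 / z + 1 / 2) has_field_derivative - exp z / (exp z - 1) ^ 2 + 1 / z ^ 2) (at z)"
      using False e by (auto intro!: derivative_eq_intros simp: power2_eq_square)
    then have "(g has_field_derivative - exp z / (exp z - 1) ^ 2 + 1 / z ^ 2) (at z)"
      by (rule has_field_derivative_transform_within_open[of _ _ _ "- {0}"]) (use False in \<open>auto simp: g_def bern_def\<close>)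
    then have D: "deriv g z = - exp z / (exp z - 1) ^ 2 + 1 / z ^ 2" by (rule DERIV_imp_deriv)
    define w where "w = exp z - 1"
    have w: "w \<noteq> 0" "exp z = w + 1" using e by (auto simp: w_def)
    show ?thesis
      unfolding D g_def bern_def using False w
      by (simp add: field_simps power2_eq_square)
  qed (simp add: g_def bern_def)
  have "(\<lambda>z. z * deriv g z + 2 * g z) has_fps_expansion fps_X * fps_deriv G + 2 * G"
    by (intro fps_expansion_intros)
  moreover have ev: "\<forall>\<^sub>F z in nhds 0. z * deriv g z + 2 * g z = 1 / 4 * z - z * (g z * g z)"
    using eventually_nhds_in_open[OF open_strip S0] by eventually_elim (rule ode)
  ultimately have "(\<lambda>z. 1 / 4 * z - z * (g z * g z)) has_fps_expansion fps_X * fps_deriv G + 2 * G"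
    using has_fps_expansion_cong[OF ev refl] by blast
  moreover have "(\<lambda>z. 1 / 4 * z - z * (g z * g z)) has_fps_expansion fps_const (1 / 4) * fps_X - fps_X * (G * G)"
    by (intro fps_expansion_intros)
  ultimately have "fps_X * fps_deriv G + 2 * G = fps_const (1 / 4) * fps_X - fps_X * (G * G)"
    by (rule fps_expansion_unique_complex)
  then have E: "fps_nth (fps_X * fps_deriv G + 2 * G) (Suc n) = fps_nth (fps_const (1 / 4) * fps_X - fps_X * (G * G)) (Suc n)" for n
    by simp
  have two: "(2 :: complex fps) = fps_const 2" by (simp add: fps_numeral_fps_const)
  \<comment> \<open>Coefficients of X^(n+1): the left side contributes n + 1 from
    \<open>fps_X * fps_deriv G\<close> and 2 from \<open>2 * G\<close>, hence n + 3.\<close>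
  have rec: "of_nat (n + 3) * fps_nth G (Suc n) = (if n = 0 then 1 / 4 else 0) - (\<Sum>i\<le>n. fps_nth G i * fps_nth G (n - i))" for n
  proof -
    have "fps_nth (fps_X * fps_deriv G + 2 * G) (Suc n) = of_nat (n + 3) * fps_nth G (Suc n)"
      unfolding two by (simp add: algebra_simps)
    moreover have "fps_nth (fps_const (1 / 4) * fps_X - fps_X * (G * G)) (Suc n)
        = (if n = 0 then 1 / 4 else 0) - (\<Sum>i\<le>n. fps_nth G i * fps_nth G (n - i))"
      by (simp add: fps_mult_nth[of G G] atMost_atLeast0)
    ultimately show ?thesis using E[of n] by simp
  qed
  have G0: "fps_nth G 0 = 0"
    using fps_nth_fps_expansion[OF G, of 0] by (simp add: g_def bern_def)
  \<comment> \<open>The powers of \<open>\<i>\<close> encode the alternating signs. For n = m + 1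
    the factors belonging to i and m - i multiply to \<open>\<i> ^ (n + 5)\<close>, which is
    \<open>- (\<i> ^ (n + 3))\<close>; the minus sign of the recursion disappears, and positivity of
    \<open>r\<close> at odd indices follows by induction. The shift 3 makes the factor 1 at n =
    1.\<close>
  define r where "r n = Re (fps_nth G n / \<i> ^ (n + 3))" for n
  have "fps_nth G n = of_real (r n) * \<i> ^ (n + 3) \<and> r n \<ge> 0 \<and> (odd n \<longrightarrow> r n > 0)" for n
  proof (induction n rule: less_induct)
    case (less n)
    show ?case
    proof (cases n)
      case 0
      then show ?thesis using G0 by (simp add: r_def)
    next
      case (Suc m)
      define q where "q = (\<Sum>i\<le>m. r i * r (m - i))"
      have "(\<Sum>i\<le>m. fps_nth G i * fps_nth G (m - i)) = (\<Sum>i\<le>m. - (of_real (r i * r (m - i)) * \<i> ^ (n + 3)))"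
      proof (rule sum.cong[OF refl])
        fix i assume i: "i \<in> {..m}"
        have a: "fps_nth G i = of_real (r i) * \<i> ^ (i + 3)" "fps_nth G (m - i) = of_real (r (m - i)) * \<i> ^ (m - i + 3)"
          using less.IH[of i] less.IH[of "m - i"] i Suc by auto
        have "\<i> ^ (i + 3) * \<i> ^ (m - i + 3) = \<i> ^ (n + 3 + 2)"
          using i Suc by (simp flip: power_add)
        also have "\<dots> = - (\<i> ^ (n + 3))" by (subst power_add) simp
        finally show "fps_nth G i * fps_nth G (m - i) = - (of_real (r i * r (m - i)) * \<i> ^ (n + 3))"
          unfolding a by (simp add: algebra_simps)
      qed
      also have "\<dots> = - (of_real q * \<i> ^ (n + 3))"
        by (simp add: q_def sum_negf sum_distrib_right)
      finally have "of_nat (n + 2) * fps_nth G n = (if m = 0 then 1 / 4 else 0) + of_real q * \<i> ^ (n + 3)"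
        using rec[of m] Suc by (cases "m = 0") (simp_all add: algebra_simps)
      also have "(if m = 0 then 1 / 4 else 0) = of_real (if m = 0 then 1 / 4 else 0) * \<i> ^ (n + 3)"
        using Suc by (auto simp: eval_nat_numeral)
      finally have "of_nat (n + 2) * fps_nth G n = of_real ((if m = 0 then 1 / 4 else 0) + q) * \<i> ^ (n + 3)"
        by (simp add: algebra_simps)
      moreover have "complex_of_nat (n + 2) \<noteq> 0" by (metis of_nat_eq_0_iff add_is_0 zero_neq_numeral)
      ultimately have Gn: "fps_nth G n = of_real (((if m = 0 then 1 / 4 else 0) + q) / real (n + 2)) * \<i> ^ (n + 3)"
        by (simp add: field_simps)
      then have rn: "r n = ((if m = 0 then 1 / 4 else 0) + q) / real (n + 2)"
        unfolding r_def by (subst Gn) (simp del: of_real_divide of_real_add)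
      have q0: "q \<ge> 0" unfolding q_def
        using less.IH Suc by (intro sum_nonneg mult_nonneg_nonneg) auto
      have "r n > 0" if "odd n"
      proof (cases "m = 0")
        case True
        then show ?thesis using q0 by (simp add: rn)
      next
        case False
        with that Suc have m: "even m" "m \<ge> 2" by auto
        have "0 < r 1 * r (m - 1)"
          using less.IH[of 1] less.IH[of "m - 1"] m Suc by auto
        also have "\<dots> \<le> q"
          unfolding q_def using less.IH Suc m by (intro member_le_sum mult_nonneg_nonneg) auto
        finally show ?thesis using False by (simp add: rn)
      qed
      then show ?thesis using Gn q0 by (auto simp: rn)
    qed
  qed
  then have "fps_nth G k \<noteq> 0" using assms by (metis of_real_eq_0_iff less_irrefl mult_eq_0_iff power_not_zero complex_i_not_zero)
  then have "(deriv ^^ k) g 0 \<noteq> 0"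
    using fps_nth_fps_expansion[OF G, of k] by auto
  moreover have "(deriv ^^ k) g 0 = (deriv ^^ k) bern 0"
  proof -
    have "(deriv ^^ k) g 0 = (deriv ^^ k) bern 0 + (deriv ^^ k) (\<lambda>z. 1 / 2) 0"
      unfolding g_def using S0 by (intro higher_deriv_add[OF bern_holomorphic _ open_strip]) auto
    also have "(deriv ^^ k) (\<lambda>z. 1 / 2 :: complex) 0 = 0"
      using assms by (auto simp: higher_deriv_const odd_pos)
    finally show ?thesis by simp
  qed
  ultimately show ?thesis by simp
qed

lemma zeta_of_nat_nonzero: "n \<ge> 2 \<Longrightarrow> zeta (of_nat n) \<noteq> 0"
proof -
  assume n: "n \<ge> 2"
  have s: "summable (\<lambda>m. real (Suc m) powr (- real n))"
    using n by (intro summable_Suc_powr) auto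
  have "zeta (of_nat n) = (\<Sum>m. of_nat (Suc m) powr (- of_nat n))"
    using n by (simp add: zeta_eq_dirichlet dirichlet_altdef del: of_nat_Suc)
  also have "\<dots> = (\<Sum>m. of_real (real (Suc m) powr (- real n)))"
    by (intro suminf_cong) (metis of_real_of_nat_eq of_real_minus of_nat_0_le_iff powr_of_real)
  also have "\<dots> = of_real (\<Sum>m. real (Suc m) powr (- real n))"
    by (rule suminf_of_real[OF s, symmetric])
  also have "(\<Sum>m. real (Suc m) powr (- real n)) > 0"
    by (rule suminf_pos[OF s]) simp
  ultimately show ?thesis by (metis of_real_eq_0_iff less_irrefl)
qed

text \<open>The Dirichlet series is positive at integers above 1, the value at 0 is -1/2, and at
  negative odd integers the sign pattern excludes zeros. This puts \<open>1 + l + \<rho>\<close>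
  into \<open>regular\<close> and makes Gamma finite and the sine nonzero at
  \<open>\<rho>\<close>.\<close>

lemma nontrivial_zeros_not_Ints:
  assumes "s \<in> nontrivial_zeros"
  shows "s \<notin> \<int>"
proof
  assume "s \<in> \<int>"
  then obtain m :: int where m: "s = of_int m" by (auto elim: Ints_cases)
  have z: "zeta s = 0" "s \<noteq> 1" "\<And>k::nat. k \<ge> 1 \<Longrightarrow> s \<noteq> - 2 * of_nat k"
    using assms by (auto simp: nontrivial_zeros_def)
  show False
  proof (cases "m > 0")
    case True
    then have "s = of_nat (nat m)" by (simp add: m)
    moreover from this have "nat m \<noteq> 1" using z(2) by auto
    ultimately show False using zeta_of_nat_nonzero[of "nat m"] z(1) True by auto
  next
    case False
    define k where "k = nat (- m)"
    have s: "s = - of_nat k" using False by (simp add: m k_def)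
    consider "k = 0" | "odd k" | j where "k = 2 * j" "j \<ge> 1" by (metis evenE less_one linorder_not_less mult_0_right)
    then show False
    proof cases
      case 1
      then show False using z(1) s zeta_0 by simp
    next
      case 2
      then show False using z(1) s higher_deriv_bern_0_nonzero[of k] by (simp add: zeta_neg_nat)
    next
      case (3 j)
      then show False using z(3)[of j] s by simp
    qed
  qed
qed

subsection \<open>The logarithmic derivative of zeta at 0\<close>

text \<open>
  The singular terms cancel in the combination that gives the alternating series
  \<open>\<eta>(s) = (1 - 2\<^bsup>1 - s\<^esup>) \<zeta>(s)\<close>, and \<open>\<eta>'(0)\<close> is evaluated by the Wallis product.
\<close>

lemma Li_reg_doubling:
  assumes "t > 0"
  shows "Li_reg s (of_real t) - 2 powr (1 - s) * Li_reg s (of_real (2 * t))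
       = Li s (of_real t) - 2 powr (1 - s) * Li s (of_real (2 * t))"
proof -
  have "complex_of_real (2 * t) powr (s - 1) = 2 powr (s - 1) * of_real t powr (s - 1)"
    using assms powr_times_real[of 2 "of_real t" "s - 1"] by simp
  moreover have "2 powr (1 - s) * 2 powr (s - 1) = (1 :: complex)"
    by (simp add: powr_add[symmetric])
  ultimately have "2 powr (1 - s) * complex_of_real (2 * t) powr (s - 1) = of_real t powr (s - 1)"
    by (simp add: mult.assoc[symmetric])
  then show ?thesis by (simp add: Li_reg_def algebra_simps)
qed

definition log_series :: "real \<Rightarrow> real" where
  "log_series t = (\<Sum>m. ln (real (Suc m)) * exp (- (real (Suc m) * t)))"

lemma log_series_summable: "t > 0 \<Longrightarrow> summable (\<lambda>m. ln (real (Suc m)) * exp (- (real (Suc m) * t)))"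
proof -
  assume t: "t > 0"
  have "summable (\<lambda>m. Re (- of_real (ln (Suc m)) * (of_nat (Suc m) powr (- 0) * exp (- (of_nat (Suc m) * complex_of_real t)))))"
    by (intro summable_Re Li_log_summable) (use t in simp)
  then have "summable (\<lambda>m. - (ln (real (Suc m)) * exp (- (real (Suc m) * t))))"
    by (simp add: Re_exp del: of_nat_Suc)
  then show ?thesis using summable_minus_iff by blast
qed

lemma Li_has_field_derivative_left_0:
  assumes t: "t > 0"
  shows "((\<lambda>s. Li s (of_real t)) has_field_derivative - of_real (log_series t)) (at 0)"
proof -
  have "(\<Sum>m. - of_real (ln (Suc m)) * (of_nat (Suc m) powr (- 0) * exp (- (of_nat (Suc m) * complex_of_real t))))
      = (\<Sum>m. complex_of_real (- (ln (real (Suc m)) * exp (- (real (Suc m) * t)))))"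
    by (intro suminf_cong) (simp del: of_nat_Suc add: exp_of_real[symmetric])
  also have "\<dots> = of_real (\<Sum>m. - (ln (real (Suc m)) * exp (- (real (Suc m) * t))))"
    by (intro suminf_of_real[symmetric] summable_minus log_series_summable t)
  also have "\<dots> = - of_real (log_series t)"
    unfolding log_series_def by (subst suminf_minus[OF log_series_summable[OF t]]) simp
  finally show ?thesis
    using Li_has_field_derivative_left[of "of_real t" 0] t by simp
qed

text \<open>The derivative with respect to s at 0 of Li s t - 2^(1-s) Li s (2 t), that is,
  \<eta>'(0) with convergence factors exp(- m t).\<close>

abbreviation eta_log :: "real \<Rightarrow> real" where
  "eta_log t \<equiv> 2 * log_series (2 * t) + 2 * ln 2 * (1 / (exp (2 * t) - 1)) - log_series t"

text \<open>With x = exp(-t), \<open>eta_log t\<close> is the sum of (-1)^N ln N x^N, because ln (2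
  j) = ln 2 + ln j at the even N. Multiplication by 1 + x is a summation by parts: it replaces
  logarithms by their decreasing differences, to which the Leibniz bounds apply.\<close>

lemma log_series_alternating:
  assumes t: "t > 0"
  shows "(1 + exp (- t)) * (eta_log t)
       = (\<Sum>n. (- 1) ^ n * ((ln (real (n + 2)) - ln (real (n + 1))) * exp (- (real (n + 2) * t))))"
proof -
  define x where "x = exp (- t)"
  have ex: "exp (- (real n * t)) = x ^ n" for n
    by (simp add: x_def exp_of_nat_mult[symmetric] algebra_simps)
  have ex2: "exp (- (real n * (2 * t))) = x ^ (2 * n)" for n
    using ex[of "2 * n"] by (simp add: algebra_simps)
  have x: "0 < x" "x < 1" using t by (auto simp: x_def)
  have 1: "(\<lambda>m. ln (real (Suc m)) * x ^ Suc m) sums log_series t"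
    using log_series_summable[OF t] unfolding log_series_def ex by (rule summable_sums)
  have 2: "(\<lambda>m. ln (real (Suc m)) * x ^ (2 * Suc m)) sums log_series (2 * t)"
    using log_series_summable[of "2 * t"] t unfolding log_series_def ex2 by (intro summable_sums) simp
  have "(\<lambda>m. x ^ 2 * (x ^ 2) ^ m) sums (x ^ 2 * (1 / (1 - x ^ 2)))"
    by (intro sums_mult geometric_sums) (use x in \<open>simp add: power_less_one_iff abs_square_less_1\<close>)
  moreover have "x ^ 2 * (1 / (1 - x ^ 2)) = 1 / (exp (2 * t) - 1)"
  proof -
    have *: "x ^ 2 = exp (- (2 * t))" using ex[of 2] by simp
    have "exp (2 * t) > 1" using t by simp
    then show ?thesis unfolding * by (simp add: exp_minus field_simps)
  qed
  ultimately have 3: "(\<lambda>m. x ^ (2 * Suc m)) sums (1 / (exp (2 * t) - 1))"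
    by (simp add: power_mult[symmetric] power_add[symmetric])
  have "(\<lambda>m. 2 * (ln (real (Suc m)) * x ^ (2 * Suc m)) + 2 * ln 2 * x ^ (2 * Suc m)) sums
        (2 * log_series (2 * t) + 2 * ln 2 * (1 / (exp (2 * t) - 1)))"
    by (intro sums_add sums_mult 2 3)
  \<comment> \<open>Spreads the series over the odd n, which are the even arguments
    \<open>Suc n\<close>, and fills the other places with 0.\<close>
  from sums_if'[OF this]
  have "(\<lambda>n. (if even n then 0 else 2 * (ln (real (Suc ((n - 1) div 2))) * x ^ (2 * Suc ((n - 1) div 2)))
          + 2 * ln 2 * x ^ (2 * Suc ((n - 1) div 2))) - ln (real (Suc n)) * x ^ Suc n) sums
        (eta_log t)" (is "_ sums ?T")
    by (intro sums_diff 1)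
  moreover have "(if even n then 0 else 2 * (ln (real (Suc ((n - 1) div 2))) * x ^ (2 * Suc ((n - 1) div 2)))
          + 2 * ln 2 * x ^ (2 * Suc ((n - 1) div 2))) - ln (real (Suc n)) * x ^ Suc n
        = (- 1) ^ Suc n * (ln (real (Suc n)) * x ^ Suc n)" for n
  proof (cases "even n")
    case False
    then obtain j where j: "n = 2 * j + 1" by (auto elim: oddE)
    have "ln (real (Suc n)) = ln 2 + ln (real (Suc j))"
      using ln_mult[of 2 "real (Suc j)"] by (simp add: j algebra_simps)
    then show ?thesis using False by (simp add: j algebra_simps)
  qed simp
  ultimately have T: "(\<lambda>n. (- 1) ^ Suc n * (ln (real (Suc n)) * x ^ Suc n)) sums ?T" by simp
  \<comment> \<open>The dropped first term is 0 because ln 1 = 0.\<close>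
  then have "(\<lambda>n. (- 1) ^ Suc (Suc n) * (ln (real (Suc (Suc n))) * x ^ Suc (Suc n))) sums ?T"
    by (subst sums_Suc_iff[where f = "\<lambda>n. (- 1) ^ Suc n * (ln (real (Suc n)) * x ^ Suc n)"]) simp
  from sums_add[OF this sums_mult[OF T, of x]]
  have "(\<lambda>n. (- 1) ^ Suc (Suc n) * (ln (real (Suc (Suc n))) * x ^ Suc (Suc n)) + x * ((- 1) ^ Suc n * (ln (real (Suc n)) * x ^ Suc n)))
         sums (?T + x * ?T)" .
  moreover have "(- 1) ^ Suc (Suc n) * (ln (real (Suc (Suc n))) * x ^ Suc (Suc n)) + x * ((- 1) ^ Suc n * (ln (real (Suc n)) * x ^ Suc n))
      = (- 1) ^ n * ((ln (real (n + 2)) - ln (real (n + 1))) * x ^ (n + 2))" for n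
    by (simp add: algebra_simps)
  ultimately have "(\<lambda>n. (- 1) ^ n * ((ln (real (n + 2)) - ln (real (n + 1))) * x ^ (n + 2))) sums (?T + x * ?T)"
    by simp
  moreover have "?T + x * ?T = (1 + exp (- t)) * ?T"
    by (simp only: x_def ring_distribs mult_1)
  ultimately show ?thesis
    unfolding ex by (simp add: sums_iff)
qed

text \<open>Two consecutive summands contribute 2 ln(2n+2) - ln(2n+1) - ln(2n+3), the logarithm of
  one factor of the Wallis product.\<close>

lemma Wallis_log:
  "(\<lambda>n. \<Sum>i<2 * n. (- 1) ^ i * (ln (real (i + 2)) - ln (real (i + 1)))) \<longlonglongrightarrow> ln (pi / 2)"
proof -
  have "(\<Sum>i<2 * n. (- 1) ^ i * (ln (real (i + 2)) - ln (real (i + 1)))) = ln (\<Prod>k=1..n. (4 * real k ^ 2) / (4 * real k ^ 2 - 1))" for n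
  proof (induction n)
    case (Suc n)
    have pos: "(4 * real k ^ 2) / (4 * real k ^ 2 - 1) > 0" if "k \<ge> 1" for k
    proof -
      have "real k ^ 2 \<ge> 1" using that by (intro one_le_power) auto
      then show ?thesis by (intro divide_pos_pos; linarith)
    qed
    have P: "(\<Prod>k=1..n. (4 * real k ^ 2) / (4 * real k ^ 2 - 1)) > 0"
      by (intro prod_pos) (use pos in auto)
    have eq: "4 * real (Suc n) ^ 2 = real (2 * n + 2) * real (2 * n + 2)" "4 * real (Suc n) ^ 2 - 1 = real (2 * n + 1) * real (2 * n + 3)"
      by (auto simp: power2_eq_square algebra_simps)
    have "ln (\<Prod>k=1..Suc n. (4 * real k ^ 2) / (4 * real k ^ 2 - 1))
        = ln (\<Prod>k=1..n. (4 * real k ^ 2) / (4 * real k ^ 2 - 1)) + ln (4 * real (Suc n) ^ 2 / (4 * real (Suc n) ^ 2 - 1))"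
      using ln_mult_pos[OF pos[of "Suc n"] P] by (subst prod.nat_ivl_Suc') (auto simp del: of_nat_Suc)
    also have "ln (4 * real (Suc n) ^ 2 / (4 * real (Suc n) ^ 2 - 1)) = 2 * ln (real (2 * n + 2)) - ln (real (2 * n + 1)) - ln (real (2 * n + 3))"
      by (subst eq(2), subst eq(1)) (simp add: ln_div ln_mult)
    also have "ln (\<Prod>k=1..n. (4 * real k ^ 2) / (4 * real k ^ 2 - 1)) = (\<Sum>i<2 * n. (- 1) ^ i * (ln (real (i + 2)) - ln (real (i + 1))))"
      using Suc.IH by simp
    finally show ?case by simp
  qed simp
  then show ?thesis
    using tendsto_ln[OF wallis] by simp
qed

text \<open>Convergence as t \<rightarrow> 0 is uniform for s near 0, so it passes to the
  derivatives in s. The limit function is (1 - 2^(1-s)) zeta(s), and the term - ln 2 comes from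
  zeta(0) = -1/2.\<close>

lemma zeta_deriv_limit:
  "((\<lambda>t. complex_of_real (eta_log t)) \<longlongrightarrow>
      - deriv zeta 0 - of_real (ln 2)) (at_right 0)"
proof -
  define Q where "Q t s = Li_reg s (of_real t) - 2 powr (1 - s) * Li_reg s (of_real (2 * t))" for t s
  define \<eta> where "\<eta> s = zeta s - 2 powr (1 - s) * zeta s" for s
  have reg0: "0 \<in> regular" by (rule regular_if_Re) simp
  obtain r C where r: "r > 0" "C \<ge> 0" "cball 0 r \<subseteq> regular"
    and C: "\<And>z t. z \<in> cball 0 r \<Longrightarrow> t \<in> {0<..1} \<Longrightarrow> norm (Li_reg z (of_real t) - zlim z) \<le> C * t"
    by (rule Li_reg_zlim_uniform[OF reg0]) (rule that; assumption)
  define d where "d = min r 1"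
  have d: "d > 0" "d \<le> r" "d \<le> 1" using r by (auto simp: d_def)
  \<comment> \<open>The restriction t \<le> 1/2 keeps 2 t in the range of \<open>C\<close>. The
    factor 2^(1-s) has modulus at most 4 for |s| \<le> 1, and 9 = 1 + 4 * 2.\<close>
  have bd: "norm (Q t s - \<eta> s) \<le> 9 * C * t" if s: "s \<in> ball 0 d" and t: "t \<in> {0<..1/2}" for s t
  proof -
    have sr: "s \<in> cball 0 r" using s d by auto
    then have z: "zeta s = zlim s" using r zeta_eq_zlim by auto
    have "\<bar>Re s\<bar> \<le> 1" using s d abs_Re_le_cmod[of s] by auto
    then have "2 powr (1 - Re s) \<le> 2 powr (2 :: real)" by (intro powr_mono) auto
    then have p: "norm (2 powr (1 - s) :: complex) \<le> 4" by (simp add: norm_powr_real_powr)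
    have "norm (Q t s - \<eta> s) = norm ((Li_reg s (of_real t) - zeta s) - 2 powr (1 - s) * (Li_reg s (of_real (2 * t)) - zeta s))"
      by (simp add: Q_def \<eta>_def algebra_simps)
    also have "\<dots> \<le> norm (Li_reg s (of_real t) - zeta s) + norm (2 powr (1 - s) :: complex) * norm (Li_reg s (of_real (2 * t)) - zeta s)"
      by (rule order_trans[OF norm_triangle_ineq4]) (simp add: norm_mult)
    also have "\<dots> \<le> C * t + 4 * (C * (2 * t))"
      unfolding z using t r by (intro add_mono mult_mono p C sr) auto
    finally show ?thesis by simp
  qed
  have "uniform_limit (ball 0 d) Q \<eta> (at_right 0)"
  proof (rule uniform_limitI)
    fix e :: real assume e: "e > 0"
    have "((\<lambda>t. 9 * C * t) \<longlongrightarrow> 9 * C * 0) (at_right 0)" by (intro tendsto_intros)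
    then have "\<forall>\<^sub>F t in at_right 0. 9 * C * t < e" using e by (intro order_tendstoD) auto
    moreover have "\<forall>\<^sub>F t in at_right (0::real). t \<in> {0<..<1/2}"
      by (rule eventually_at_right_real) simp
    ultimately show "\<forall>\<^sub>F t in at_right 0. \<forall>s\<in>ball 0 d. dist (Q t s) (\<eta> s) < e"
      by eventually_elim (use bd in \<open>force simp: dist_norm\<close>)
  qed
  moreover have pos: "\<forall>\<^sub>F t in at_right (0::real). t > 0" by (simp add: eventually_at_right_less)
  then have "\<forall>\<^sub>F t in at_right 0. Q t holomorphic_on ball 0 d"
  proof eventually_elim
    case (elim t)
    have "ball 0 d \<subseteq> regular" using d r by auto
    then show ?case
      unfolding Q_def using elim by (intro holomorphic_intros holomorphic_Li_reg_left) auto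
  qed
  ultimately have lim: "((\<lambda>t. deriv (Q t) 0) \<longlongrightarrow> deriv \<eta> 0) (at_right 0)"
    using d by (intro deriv_complex_uniform_limit) auto
  have dp: "((\<lambda>s. 2 powr (1 - s) :: complex) has_field_derivative - 2 * of_real (ln 2)) (at 0)"
  proof -
    have "((\<lambda>s. 2 powr (1 - s) :: complex) has_field_derivative (Ln 2 * 2 powr (1 - 0)) * - 1) (at 0)"
      by (rule DERIV_chain2[OF has_field_derivative_powr_right]) (auto intro!: derivative_eq_intros)
    moreover have "Ln 2 = complex_of_real (ln 2)" using Ln_of_real[of 2] by simp
    ultimately show ?thesis by (simp add: mult.commute)
  qed
  have "(zeta has_field_derivative deriv zeta 0) (at 0)"
    by (intro holomorphic_derivI[OF zeta_holomorphic]) auto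
  then have "(\<eta> has_field_derivative deriv zeta 0 - ((- 2 * of_real (ln 2)) * zeta 0 + deriv zeta 0 * 2 powr (1 - 0))) (at 0)"
    unfolding \<eta>_def by (intro DERIV_diff DERIV_mult dp)
  then have "deriv \<eta> 0 = - deriv zeta 0 - of_real (ln 2)"
    by (intro DERIV_imp_deriv) (simp add: zeta_0)
  moreover have "deriv (Q t) 0 = of_real (eta_log t)"
    if t: "t > 0" for t
  proof -
    have "((\<lambda>s. Li s (of_real t) - 2 powr (1 - s) * Li s (of_real (2 * t))) has_field_derivative
        - of_real (log_series t) - ((- 2 * of_real (ln 2)) * Li 0 (of_real (2 * t)) + - of_real (log_series (2 * t)) * 2 powr (1 - 0))) (at 0)"
      using t by (intro DERIV_diff DERIV_mult dp Li_has_field_derivative_left_0) auto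
    moreover have "Q t = (\<lambda>s. Li s (of_real t) - 2 powr (1 - s) * Li s (of_real (2 * t)))"
      unfolding Q_def using Li_reg_doubling[OF t] by blast
    moreover have "Li 0 (of_real (2 * t)) = of_real (1 / (exp (2 * t) - 1))"
      using t by (subst Li_0) (auto simp flip: exp_of_real)
    ultimately show ?thesis by (intro DERIV_imp_deriv) (simp add: algebra_simps)
  qed
  then have "\<forall>\<^sub>F t in at_right 0. deriv (Q t) 0 = of_real (eta_log t)"
    using pos by (auto elim: eventually_mono)
  ultimately show ?thesis
    using Lim_transform_eventually[OF lim] by simp
qed

text \<open>For each t > 0 the alternating series lies between its partial sums of even and odd
  length. Letting t \<rightarrow> 0 in these finite sums, and only then the length grow, squeezes 2
  \<open>L\<close> to ln (pi / 2); the 2 is the limit of 1 + exp(-t).\<close>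

lemma zeta_M_0: "zeta_M 0 = - of_real (ln (2 * pi))"
proof -
  define T where "T = eta_log"
  define L where "L = Re (- deriv zeta 0 - ln 2)"
  define c where "c i = ln (real (i + 2)) - ln (real (i + 1))" for i
  define A where "A t = (\<Sum>n. (- 1) ^ n * (c n * exp (- (real (n + 2) * t))))" for t
  have T: "(T \<longlongrightarrow> L) (at_right 0)"
    using tendsto_Re[OF zeta_deriv_limit] unfolding T_def L_def by simp
  then have "((\<lambda>t. (1 + exp (- t)) * T t) \<longlongrightarrow> (1 + exp (- 0)) * L) (at_right 0)"
    by (intro tendsto_intros)
  moreover have pos: "\<forall>\<^sub>F t in at_right (0::real). t > 0" by (simp add: eventually_at_right_less)
  then have "\<forall>\<^sub>F t in at_right 0. (1 + exp (- t)) * T t = A t"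
    by eventually_elim (unfold T_def A_def c_def, rule log_series_alternating)
  ultimately have "(A \<longlongrightarrow> (1 + exp (- 0)) * L) (at_right 0)"
    by (rule Lim_transform_eventually)
  then have A: "(A \<longlongrightarrow> 2 * L) (at_right 0)" by simp
  have c: "c i = ln (1 + 1 / real (i + 1))" for i
  proof -
    have "1 + 1 / real (i + 1) = real (i + 2) / real (i + 1)" by (simp add: field_simps)
    then show ?thesis by (simp add: c_def ln_div)
  qed
  have c0: "c i \<ge> 0" for i by (simp add: c)
  have cdec: "c (Suc i) \<le> c i" for i
    unfolding c by (intro ln_mono) (auto simp: field_simps add_pos_nonneg)
  have clim: "c \<longlonglongrightarrow> 0"
    unfolding c by real_asymp
  have alt: "(\<Sum>i<2 * n. (- 1) ^ i * (c i * exp (- (real (i + 2) * t)))) \<le> A t \<and>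
             A t \<le> (\<Sum>i<2 * n + 1. (- 1) ^ i * (c i * exp (- (real (i + 2) * t))))" if t: "t > 0" for n t
  proof -
    have "(\<lambda>i. c i * exp (- (real (i + 2) * t))) \<longlonglongrightarrow> 0"
    proof (rule tendsto_sandwich[OF _ _ tendsto_const clim])
      show "\<forall>\<^sub>F i in sequentially. 0 \<le> c i * exp (- (real (i + 2) * t))" using c0 by simp
      show "\<forall>\<^sub>F i in sequentially. c i * exp (- (real (i + 2) * t)) \<le> c i"
        using c0 t by (intro always_eventually allI mult_right_le_one_le) auto
    qed
    moreover have "c (Suc i) * exp (- (real (Suc i + 2) * t)) \<le> c i * exp (- (real (i + 2) * t))" for i
      using c0 cdec t by (intro mult_mono) auto
    ultimately show ?thesis
      unfolding A_def using c0 by (intro conjI summable_Leibniz'(2,4)) auto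
  qed
  have lim: "((\<lambda>t. \<Sum>i<n. (- 1) ^ i * (c i * exp (- (real (i + 2) * t)))) \<longlongrightarrow> (\<Sum>i<n. (- 1) ^ i * c i)) (at_right 0)" for n
  proof -
    have "((\<lambda>t. \<Sum>i<n. (- 1) ^ i * (c i * exp (- (real (i + 2) * t)))) \<longlongrightarrow> (\<Sum>i<n. (- 1) ^ i * (c i * exp (- (real (i + 2) * 0))))) (at_right 0)"
      by (intro tendsto_intros)
    then show ?thesis by simp
  qed
  have lower: "(\<Sum>i<2 * n. (- 1) ^ i * c i) \<le> 2 * L" for n
    by (rule tendsto_le[OF _ A lim]) (use pos alt in \<open>auto elim: eventually_mono\<close>)
  have upper: "2 * L \<le> (\<Sum>i<2 * n + 1. (- 1) ^ i * c i)" for n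
    by (rule tendsto_le[OF _ lim A]) (use pos alt in \<open>auto elim: eventually_mono simp del: sum.lessThan_Suc\<close>)
  have W: "(\<lambda>n. \<Sum>i<2 * n. (- 1) ^ i * c i) \<longlonglongrightarrow> ln (pi / 2)"
    using Wallis_log by (simp add: c_def)
  have "(\<lambda>n. c (2 * n)) \<longlonglongrightarrow> 0"
    using LIMSEQ_subseq_LIMSEQ[OF clim, of "\<lambda>n. 2 * n"] by (simp add: strict_mono_def o_def)
  from tendsto_add[OF W this]
  have W': "(\<lambda>n. \<Sum>i<2 * n + 1. (- 1) ^ i * c i) \<longlonglongrightarrow> ln (pi / 2)" by simp
  have "ln (pi / 2) \<le> 2 * L" by (rule LIMSEQ_le_const2[OF W]) (use lower in auto)
  moreover have "2 * L \<le> ln (pi / 2)" by (rule LIMSEQ_le_const[OF W']) (use upper in blast)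
  ultimately have "L = ln (pi / 2) / 2" by simp
  then have "Re (deriv zeta 0) = - ln 2 - ln (pi / 2) / 2" by (simp add: L_def)
  also have "\<dots> = - ln (2 * pi) / 2" by (simp add: ln_div ln_mult field_simps)
  finally have re: "Re (deriv zeta 0) = - ln (2 * pi) / 2" .
  \<comment> \<open>Up to the real constant ln 2 and a sign it is a limit of real numbers.\<close>
  have "deriv zeta 0 \<in> \<real>"
    using tendsto_unique[OF _ tendsto_Im[OF zeta_deriv_limit, unfolded Im_complex_of_real] tendsto_const[of 0]]
    by (simp add: complex_is_Real_iff)
  then have "deriv zeta 0 = of_real (- ln (2 * pi) / 2)"
    using re by (metis of_real_Re)
  then show ?thesis by (simp add: zeta_M_def zeta_0)
qed

subsection \<open>The expansion of the double series\<close>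

definition Li_rem :: "nat \<Rightarrow> complex \<Rightarrow> complex \<Rightarrow> complex" where
  "Li_rem n s z = Li_reg s z - (\<Sum>k<n. zeta (s - of_nat k) * (- z) ^ k / fact k)"

text \<open>Differentiation turns the Taylor term of index k + 1 at order s into that of index k at
  order s - 1 with opposite sign, and the constant term is lost; so order and length of the
  expansion drop together.\<close>

lemma Li_rem_Suc_has_field_derivative:
  assumes z: "Re z > 0" and s: "s \<in> regular"
  shows "(Li_rem (Suc n) s has_field_derivative - Li_rem n (s - 1) z) (at z)"
proof -
  have "((\<lambda>z. zeta (s - of_nat (Suc k)) * (- z) ^ Suc k / fact (Suc k)) has_field_derivative
          - (zeta (s - 1 - of_nat k) * (- z) ^ k / fact k)) (at z)" for k
  proof -
    have "((\<lambda>z. zeta (s - of_nat (Suc k)) * (- z) ^ Suc k / fact (Suc k)) has_field_derivative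
          zeta (s - of_nat (Suc k)) * (of_nat (Suc k) * (- z) ^ k * - 1) / fact (Suc k)) (at z)"
    proof (intro DERIV_cdivide DERIV_cmult)
      show "((\<lambda>z. (- z) ^ Suc k) has_field_derivative of_nat (Suc k) * (- z) ^ k * - 1) (at z)"
        by (auto intro!: derivative_eq_intros simp del: of_nat_Suc power_Suc)
    qed
    moreover have "zeta (s - of_nat (Suc k)) * (of_nat (Suc k) * (- z) ^ k * - 1) / fact (Suc k)
        = - (zeta (s - of_nat (Suc k)) * (- z) ^ k / fact k)"
      using of_nat_neq_0[of k, where 'a = complex] by (simp only: fact_Suc) (simp add: field_simps del: of_nat_Suc)
    ultimately show ?thesis by (simp add: algebra_simps)
  qed
  then have "((\<lambda>z. Li_reg s z - (zeta (s - of_nat 0) * (- z) ^ 0 / fact 0 + (\<Sum>k<n. zeta (s - of_nat (Suc k)) * (- z) ^ Suc k / fact (Suc k))))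
      has_field_derivative - Li_reg (s - 1) z - (0 + (\<Sum>k<n. - (zeta (s - 1 - of_nat k) * (- z) ^ k / fact k)))) (at z)"
    by (intro DERIV_diff DERIV_add DERIV_sum Li_reg_has_field_derivative[OF z s]) simp
  then show ?thesis
    unfolding Li_rem_def[abs_def] sum.lessThan_Suc_shift by (simp add: sum_negf)
qed

lemma continuous_on_Li_rem:
  assumes s: "s \<in> regular"
  shows "continuous_on {0<..} (\<lambda>t. Li_rem n s (of_real t))"
proof -
  have "continuous_on {z. Re z > 0} (Li_reg s)"
    using Li_reg_has_field_derivative[OF _ s] by (auto intro!: continuous_at_imp_continuous_on DERIV_isCont)
  then have "continuous_on {z. Re z > 0} (Li_rem n s)"
    unfolding Li_rem_def by (intro continuous_intros) auto
  then show ?thesis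
    by (rule continuous_on_compose2) (auto intro!: continuous_intros)
qed

lemma holomorphic_Li_rem:
  assumes z: "Re z > 0" and A: "A \<subseteq> regular"
  shows "(\<lambda>s. Li_rem n s z) holomorphic_on A"
proof -
  have "s - of_nat k \<noteq> 1" if "s \<in> A" for s k
    using that A regular_minus_nat regular_neq_1 by blast
  then show ?thesis
    unfolding Li_rem_def using z A by (intro holomorphic_intros holomorphic_Li_reg_left) auto
qed

text \<open>Induction on n: by the case at order s - 1 the t-derivative is O(t^n), and the function
  itself tends to 0 at t = 0 because its constant term \<open>zeta s\<close> is the limit of
  \<open>Li_reg s\<close>. The mean value theorem thus gains a factor t.\<close>

lemma Li_rem_bound_small:
  assumes "s \<in> regular"
  shows "\<exists>r>0. \<exists>C\<ge>0. ball s r \<subseteq> regular \<and> (\<forall>z\<in>ball s r. \<forall>t\<in>{0<..1}. norm (Li_rem n z (of_real t)) \<le> C * t ^ n)"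
  using assms
proof (induction n arbitrary: s)
  case 0
  from Li_reg_bounded[OF 0] obtain r C where rC: "r > 0" "ball s r \<subseteq> regular"
    "\<And>z t. z \<in> ball s r \<Longrightarrow> t \<in> {0<..1} \<Longrightarrow> norm (Li_reg z (of_real t)) \<le> C" by blast
  then have "C \<ge> 0" using order_trans[OF norm_ge_zero rC(3)[of s 1]] by simp
  with rC show ?case by (intro exI[of _ r] conjI exI[of _ C]) (auto simp: Li_rem_def)
next
  case (Suc n)
  obtain r C where r: "r > 0" "C \<ge> 0" and
    C: "\<And>z t. z \<in> ball (s - 1) r \<Longrightarrow> t \<in> {0<..1} \<Longrightarrow> norm (Li_rem n z (of_real t)) \<le> C * t ^ n"
    using Suc.IH[OF regular_minus_1[OF Suc.prems]] by blast
  obtain r' where r': "r' > 0" "ball s r' \<subseteq> regular"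
    using open_regular Suc.prems by (meson open_contains_ball)
  have "norm (Li_rem (Suc n) z (of_real t)) \<le> C * t ^ Suc n" if z: "z \<in> ball s (min r r')" and t: "t \<in> {0<..1}" for z t
  proof -
    have zreg: "z \<in> regular" using z r' by auto
    have z1: "z - 1 \<in> ball (s - 1) r" using z by (simp add: dist_norm)
    have "(\<lambda>m. Li_rem (Suc n) z (of_real (1 / real (Suc m)))) \<longlonglongrightarrow>
        zeta z - (\<Sum>k<Suc n. zeta (z - of_nat k) * (- of_real 0) ^ k / fact k)"
      unfolding Li_rem_def using Li_reg_LIMSEQ[OF zreg] zeta_eq_zlim[OF zreg]
      by (intro tendsto_intros LIMSEQ_inverse_Suc) auto
    also have "(\<Sum>k<Suc n. zeta (z - of_nat k) * (- of_real 0) ^ k / fact k) = zeta z"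
      by (simp add: sum.lessThan_Suc_shift del: sum.lessThan_Suc)
    finally have L: "(\<lambda>m. Li_rem (Suc n) z (of_real (1 / real (Suc m)))) \<longlonglongrightarrow> 0" by simp
    have bd: "norm (Li_rem (Suc n) z (of_real t) - Li_rem (Suc n) z (of_real u)) \<le> C * t ^ n * t" if u: "u \<in> {0<..t}" for u
    proof -
      have "norm (Li_rem (Suc n) z (of_real t) - Li_rem (Suc n) z (of_real u)) \<le> C * t ^ n * norm (complex_of_real t - complex_of_real u)"
      proof (rule field_differentiable_bound[where S = "complex_of_real ` {0<..t}" and f' = "\<lambda>w. - Li_rem n (z - 1) w"])
        show "convex (complex_of_real ` {0<..t})"
          by (intro convex_linear_image bounded_linear.linear[OF bounded_linear_of_real]) auto
        fix w assume "w \<in> complex_of_real ` {0<..t}"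
        then obtain v where v: "w = of_real v" "0 < v" "v \<le> t" by auto
        show "(Li_rem (Suc n) z has_field_derivative - Li_rem n (z - 1) w) (at w within complex_of_real ` {0<..t})"
          using v by (intro has_field_derivative_at_within[OF Li_rem_Suc_has_field_derivative] zreg) auto
        have "norm (Li_rem n (z - 1) (of_real v)) \<le> C * v ^ n" using v t by (intro C z1) auto
        also have "\<dots> \<le> C * t ^ n" using v r by (intro mult_left_mono power_mono) auto
        finally show "norm (- Li_rem n (z - 1) w) \<le> C * t ^ n" using v by simp
      qed (use u t in auto)
      also have "\<dots> \<le> C * t ^ n * t"
        using u t r by (intro mult_left_mono) (auto simp flip: of_real_diff)
      finally show ?thesis .
    qed
    have "\<forall>\<^sub>F m in sequentially. 1 / real (Suc m) < t"
      using order_tendstoD(2)[OF LIMSEQ_inverse_Suc, of t] t by auto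
    then have "\<forall>\<^sub>F m in sequentially. norm (Li_rem (Suc n) z (of_real t) - Li_rem (Suc n) z (of_real (1 / real (Suc m)))) \<le> C * t ^ n * t"
      by (rule eventually_mono) (rule bd, simp)
    moreover have "(\<lambda>m. norm (Li_rem (Suc n) z (of_real t) - Li_rem (Suc n) z (of_real (1 / real (Suc m))))) \<longlonglongrightarrow> norm (Li_rem (Suc n) z (of_real t) - 0)"
      by (intro tendsto_intros L)
    ultimately have "norm (Li_rem (Suc n) z (of_real t) - 0) \<le> C * t ^ n * t"
      by (intro tendsto_upperbound[where F = sequentially]) auto
    then show ?thesis by (simp add: mult_ac)
  qed
  moreover have "ball s (min r r') \<subseteq> regular" using r' by auto
  ultimately show ?case using r r' by (intro exI[of _ "min r r'"] conjI exI[of _ C]) auto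
qed

text \<open>Polynomial growth suffices, as exp(- m t) will be multiplied on. The exponent
  \<open>A\<close> covers the Gamma term through Re s and the Taylor terms through n at the same
  time.\<close>

lemma Li_rem_bound_large:
  assumes s: "s \<in> regular"
  shows "\<exists>r>0. \<exists>C\<ge>0. \<exists>A\<ge>n. \<forall>z\<in>ball s r. \<forall>t\<ge>1. norm (Li_rem n z (of_real t)) \<le> C * t ^ A"
proof -
  obtain r where r: "r > 0" "cball s r \<subseteq> regular"
    using open_regular s by (meson open_contains_cball)
  have cont: "continuous_on (cball s r) (\<lambda>z. Gamma (1 - z))"
    using r by (intro holomorphic_on_imp_continuous_on holomorphic_intros) (auto simp: regular_def)
  have "bounded ((\<lambda>z. Gamma (1 - z)) ` cball s r)"
    by (intro compact_imp_bounded compact_continuous_image cont) auto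
  then obtain G where G: "\<And>z. z \<in> cball s r \<Longrightarrow> norm (Gamma (1 - z)) \<le> G"
    unfolding bounded_iff by blast
  have "\<exists>B. \<forall>z\<in>cball s r. norm (zeta (z - of_nat k)) \<le> B" for k
  proof -
    have "z - of_nat k \<noteq> 1" if "z \<in> cball s r" for z
      using that r regular_minus_nat regular_neq_1 by blast
    then have "continuous_on (cball s r) (\<lambda>z. zeta (z - of_nat k))"
      by (intro holomorphic_on_imp_continuous_on holomorphic_intros) auto
    then have "bounded ((\<lambda>z. zeta (z - of_nat k)) ` cball s r)"
      by (intro compact_imp_bounded compact_continuous_image) auto
    then show ?thesis unfolding bounded_iff by blast
  qed
  then obtain B where B: "\<And>k z. z \<in> cball s r \<Longrightarrow> norm (zeta (z - of_nat k)) \<le> B k" by metis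
  have sc: "s \<in> cball s r" using r by simp
  have G0: "G \<ge> 0" and B0: "B k \<ge> 0" for k
    using order_trans[OF norm_ge_zero G[OF sc]] order_trans[OF norm_ge_zero B[OF sc]] by auto
  define a where "a = nat \<lceil>1 - Re s\<rceil>"
  define S where "S = (\<Sum>m. fact (a + 2) / 1 ^ (a + 2) * (1 / real (Suc m) ^ 2))"
  have S: "summable (\<lambda>m. fact (a + 2) / 1 ^ (a + 2) * (1 / real (Suc m) ^ 2))"
    by (intro summable_mult summable_inverse_Suc_square)
  have S0: "S \<ge> 0" unfolding S_def by (intro suminf_nonneg S) simp
  define A where "A = nat \<lceil>Re s\<rceil> + n"
  define C where "C = S + G + (\<Sum>k<n. B k)"
  have "norm (Li_rem n z (of_real t)) \<le> C * t ^ A" if z: "z \<in> ball s (min r 1)" and t: "t \<ge> 1" for z t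
  proof -
    have zc: "z \<in> cball s r" and z1: "z \<in> ball s 1" using z by auto
    have tA: "1 \<le> t ^ A" using t by (rule one_le_power)
    have rez: "Re z < Re s + 1" using z1 abs_Re_le_cmod[of "s - z"] by (simp add: dist_norm)
    have "norm (Li z (of_real t)) \<le> S"
      unfolding Li_def S_def
      using t Re_bound_in_ball[OF z1] by (intro norm_suminf_le S Li_term_bound) (auto simp: a_def)
    also have "\<dots> \<le> S * t ^ A" using tA S0 mult_left_mono[OF tA S0] by simp
    finally have 1: "norm (Li z (of_real t)) \<le> S * t ^ A" .
    have "norm (Gamma (1 - z) * of_real t powr (z - 1)) = norm (Gamma (1 - z)) * t powr (Re z - 1)"
      using t by (simp add: norm_mult norm_of_real_powr)
    also have "\<dots> \<le> G * t powr real A"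
      using t G0 rez real_nat_ceiling_ge[of "Re s"] by (intro mult_mono G zc powr_mono) (auto simp: A_def)
    finally have 2: "norm (Gamma (1 - z) * of_real t powr (z - 1)) \<le> G * t ^ A"
      using t by (simp add: powr_realpow)
    have 3: "norm (zeta (z - of_nat k) * (- of_real t) ^ k / fact k) \<le> B k * t ^ A" if "k < n" for k
    proof -
      have "norm (zeta (z - of_nat k) * (- of_real t) ^ k / fact k) = norm (zeta (z - of_nat k)) * t ^ k / fact k"
        using t by (simp add: norm_mult norm_divide norm_power)
      also have "\<dots> \<le> norm (zeta (z - of_nat k)) * t ^ k / 1"
        using t by (intro divide_left_mono) (auto simp: fact_ge_1)
      also have "\<dots> \<le> B k * t ^ A"
        unfolding div_by_1 using t that B0 by (intro mult_mono B[OF zc] power_increasing) (auto simp: A_def)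
      finally show ?thesis .
    qed
    have "norm (Li_rem n z (of_real t)) \<le> norm (Li z (of_real t)) + norm (Gamma (1 - z) * of_real t powr (z - 1))
         + norm (\<Sum>k<n. zeta (z - of_nat k) * (- of_real t) ^ k / fact k)"
      unfolding Li_rem_def Li_reg_def
      by (intro order_trans[OF norm_triangle_ineq4] add_mono order_refl) 
    also have "\<dots> \<le> S * t ^ A + G * t ^ A + (\<Sum>k<n. B k * t ^ A)"
      using 3 by (intro add_mono 1 2 order_trans[OF norm_sum] sum_mono) auto
    also have "\<dots> = C * t ^ A" by (simp add: C_def algebra_simps sum_distrib_left)
    finally show ?thesis .
  qed
  moreover have "C \<ge> 0" unfolding C_def using S0 G0 B0 by (intro add_nonneg_nonneg sum_nonneg) auto
  moreover have "A \<ge> n" by (simp add: A_def)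
  ultimately show ?thesis using r by (intro exI[of _ "min r 1"] conjI exI[of _ C] exI[of _ A]) auto
qed

text \<open>The exponents a and b stem from t^n near 0 and t^A near infinity, widened by r to serve
  a disc of values \<open>s2\<close>. With the weight \<Lambda>(m) \<le> m the integrals will be
  summed like m^(1-a), whence a > 2.\<close>

lemma kernel_bound:
  assumes s1: "s1 \<in> regular" and s2: "Re s2 + real n > 2"
  obtains r C a b where "r > 0" "C \<ge> 0" "a > 2" "b \<ge> a" "ball s1 r \<subseteq> regular"
    "\<And>z2. z2 \<in> ball s2 r \<Longrightarrow> Re z2 + real n > 2"
    "\<And>z1 z2 t. z1 \<in> ball s1 r \<Longrightarrow> z2 \<in> ball s2 r \<Longrightarrow> t > 0 \<Longrightarrow>
       norm (of_real t powr (z2 - 1) * Li_rem n z1 (of_real t)) \<le> C * (t powr (a - 1) + t powr (b - 1))"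
proof -
  obtain r1 C1 where r1: "r1 > 0" "C1 \<ge> 0" "ball s1 r1 \<subseteq> regular"
    and C1: "\<And>z t. z \<in> ball s1 r1 \<Longrightarrow> t \<in> {0<..1} \<Longrightarrow> norm (Li_rem n z (of_real t)) \<le> C1 * t ^ n"
    using Li_rem_bound_small[OF s1] by blast
  obtain r2 C2 A where r2: "r2 > 0" "C2 \<ge> 0" "A \<ge> n"
    and C2: "\<And>z t. z \<in> ball s1 r2 \<Longrightarrow> t \<ge> 1 \<Longrightarrow> norm (Li_rem n z (of_real t)) \<le> C2 * t ^ A"
    using Li_rem_bound_large[OF s1] by blast
  \<comment> \<open>Half the excess of Re s2 + n over 2, so that a = Re s2 - r + n still exceeds
    2.\<close>
  define r where "r = min (min r1 r2) ((Re s2 + real n - 2) / 2)"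
  have "r \<le> (Re s2 + real n - 2) / 2" unfolding r_def by (rule min.cobounded2)
  then have r: "r > 0" "r \<le> r1" "r \<le> r2" "2 * r \<le> Re s2 + real n - 2"
    using r1 r2 s2 by (auto simp: r_def)
  define a where "a = Re s2 - r + real n"
  define b where "b = Re s2 + r + real A"
  have re: "\<bar>Re z - Re s2\<bar> < r" if "z \<in> ball s2 r" for z
    using that abs_Re_le_cmod[of "s2 - z"] by (simp add: dist_norm)
  have "norm (of_real t powr (z2 - 1) * Li_rem n z1 (of_real t)) \<le> (C1 + C2) * (t powr (a - 1) + t powr (b - 1))"
    if z: "z1 \<in> ball s1 r" "z2 \<in> ball s2 r" and t: "t > 0" for z1 z2 t
  proof (cases "t \<le> 1")
    case True
    have "norm (of_real t powr (z2 - 1) * Li_rem n z1 (of_real t)) \<le> t powr (Re z2 - 1) * (C1 * t ^ n)"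
      unfolding norm_mult using z t r True by (intro mult_mono C1) (auto simp: norm_of_real_powr)
    also have "\<dots> = C1 * t powr (Re z2 - 1 + real n)"
      using t by (simp add: powr_add powr_realpow)
    also have "\<dots> \<le> C1 * t powr (a - 1)"
      using re[OF z(2)] t True r1 by (intro mult_left_mono powr_mono') (auto simp: a_def)
    also have "\<dots> \<le> (C1 + C2) * (t powr (a - 1) + t powr (b - 1))"
      using r1 r2 by (intro mult_mono) auto
    finally show ?thesis .
  next
    case False
    have "norm (of_real t powr (z2 - 1) * Li_rem n z1 (of_real t)) \<le> t powr (Re z2 - 1) * (C2 * t ^ A)"
      unfolding norm_mult using z t r False by (intro mult_mono C2) (auto simp: norm_of_real_powr)
    also have "\<dots> = C2 * t powr (Re z2 - 1 + real A)"
      using t by (simp add: powr_add powr_realpow)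
    also have "\<dots> \<le> C2 * t powr (b - 1)"
      using re[OF z(2)] t False r2 by (intro mult_left_mono powr_mono) (auto simp: b_def)
    also have "\<dots> \<le> (C1 + C2) * (t powr (a - 1) + t powr (b - 1))"
      using r1 r2 by (intro mult_mono) auto
    finally show ?thesis .
  qed
  moreover have "ball s1 r \<subseteq> regular" using r r1 by auto
  moreover have "Re z2 + real n > 2" if "z2 \<in> ball s2 r" for z2 using re[OF that] r by linarith
  moreover have "a > 2" "b \<ge> a" using r r2 by (auto simp: a_def b_def)
  moreover have "C1 + C2 \<ge> 0" using r1 r2 by simp
  ultimately show ?thesis using r(1) that[of r "C1 + C2" a b] by blast
qed

abbreviation rem_kernel :: "nat \<Rightarrow> nat \<Rightarrow> complex \<Rightarrow> complex \<Rightarrow> real \<Rightarrow> complex" where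
  "rem_kernel n m s1 s2 t \<equiv> of_real (exp (- (real (Suc m) * t))) * (of_real t powr (s2 - 1) * Li_rem n s1 (of_real t))"

definition rem_integral :: "nat \<Rightarrow> nat \<Rightarrow> complex \<Rightarrow> complex \<Rightarrow> complex" where
  "rem_integral n m s1 s2 = (\<integral>t. rem_kernel n m s1 s2 t \<partial>half_line)"

text \<open>For n = 4 this is the function E of the overview.\<close>

definition rem_series :: "nat \<Rightarrow> complex \<Rightarrow> complex \<Rightarrow> complex" where
  "rem_series n s1 s2 = (\<Sum>m. mangoldt (Suc m) * rem_integral n m s1 s2)"

lemma rem_integral_integrand_measurable:
  "s1 \<in> regular \<Longrightarrow> (\<lambda>t. rem_kernel n m s1 s2 t) \<in> borel_measurable half_line"
  by (intro measurable_half_line_continuous continuous_intros continuous_on_Li_rem)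

lemma mangoldt_le_self: "mangoldt (Suc m) \<le> real (Suc m)"
  using mangoldt_le[of "Suc m"] ln_bound[of "real (Suc m)"] by simp

text \<open>One package of majorants for both variables: \<open>g\<close> dominates the integrands
  and yields holomorphy of each integral, \<open>h\<close> dominates the weighted integrals and
  yields holomorphy of their sum.\<close>

lemma rem_integral_bound:
  assumes s1: "s1 \<in> regular" and s2: "Re s2 + real n > 2"
  obtains r g h where "r > 0" "ball s1 r \<subseteq> regular" "\<And>z2. z2 \<in> ball s2 r \<Longrightarrow> Re z2 > 2 - real n"
    and "\<And>m. integrable half_line (g m)" and "summable h"
    and "\<And>m z1 z2 t. z1 \<in> ball s1 r \<Longrightarrow> z2 \<in> ball s2 r \<Longrightarrow> t > 0 \<Longrightarrow>
       norm (rem_kernel n m z1 z2 t) \<le> g m t"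
    and "\<And>m z1 z2. z1 \<in> ball s1 r \<Longrightarrow> z2 \<in> ball s2 r \<Longrightarrow> norm (mangoldt (Suc m) * rem_integral n m z1 z2) \<le> h m"
proof -
  obtain r C a b where r: "r > 0" "C \<ge> 0" "a > 2" "b \<ge> a" "ball s1 r \<subseteq> regular" "\<And>z2. z2 \<in> ball s2 r \<Longrightarrow> Re z2 + real n > 2"
    and bd: "\<And>z1 z2 t. z1 \<in> ball s1 r \<Longrightarrow> z2 \<in> ball s2 r \<Longrightarrow> t > 0 \<Longrightarrow>
       norm (of_real t powr (z2 - 1) * Li_rem n z1 (of_real t)) \<le> C * (t powr (a - 1) + t powr (b - 1))"
    by (rule kernel_bound[OF s1 s2]) (rule that; assumption)
  define g where "g m t = C * (t powr (a - 1) * exp (- (real (Suc m) * t)) + t powr (b - 1) * exp (- (real (Suc m) * t)))" for m t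
  have g: "has_hl_integral (g m) (C * (Gamma a * real (Suc m) powr (- a) + Gamma b * real (Suc m) powr (- b)))" for m
    unfolding g_def using r by (intro has_bochner_integral_mult_right has_bochner_integral_add Gamma_integral_half_line_real) auto
  have gb: "norm (rem_kernel n m z1 z2 t) \<le> g m t"
    if z: "z1 \<in> ball s1 r" "z2 \<in> ball s2 r" "t > 0" for z1 z2 t m
  proof -
    have "norm (rem_kernel n m z1 z2 t)
        \<le> exp (- (real (Suc m) * t)) * (C * (t powr (a - 1) + t powr (b - 1)))"
      unfolding norm_mult[of "of_real (exp _)"] using bd[OF z] by (intro mult_mono) auto
    then show ?thesis by (simp add: g_def algebra_simps)
  qed
  have eb: "norm (mangoldt (Suc m) * rem_integral n m z1 z2) \<le> C * (Gamma a + Gamma b) * real (Suc m) powr (- (a - 1))"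
    if z: "z1 \<in> ball s1 r" "z2 \<in> ball s2 r" for m z1 z2
  proof -
    have z1: "z1 \<in> regular" using z r by blast
    have "integrable half_line (\<lambda>t. rem_kernel n m z1 z2 t)"
    proof (rule Bochner_Integration.integrable_bound[OF _ rem_integral_integrand_measurable[OF z1]])
      show "integrable half_line (g m)" using g by (auto simp: has_bochner_integral_iff)
      show "AE t in half_line. norm (rem_kernel n m z1 z2 t) \<le> norm (g m t)"
        using gb[OF z] by (intro AE_I2) (auto intro: order_trans[OF _ abs_ge_self])
    qed
    then have "norm (rem_integral n m z1 z2) \<le> (\<integral>t. g m t \<partial>half_line)"
      unfolding rem_integral_def using g gb[OF z]
      by (intro Bochner_Integration.integral_norm_bound_integral) (auto simp: has_bochner_integral_iff)
    also have "\<dots> = C * (Gamma a * real (Suc m) powr (- a) + Gamma b * real (Suc m) powr (- b))"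
      using g by (simp add: has_bochner_integral_iff)
    also have "\<dots> \<le> C * (Gamma a * real (Suc m) powr (- a) + Gamma b * real (Suc m) powr (- a))"
      using r by (intro mult_left_mono add_left_mono powr_mono) (auto intro!: less_imp_le[OF Gamma_real_pos])
    finally have e: "norm (rem_integral n m z1 z2) \<le> C * (Gamma a + Gamma b) * real (Suc m) powr (- a)"
      by (simp add: algebra_simps)
    have "norm (mangoldt (Suc m) * rem_integral n m z1 z2) \<le> real (Suc m) * (C * (Gamma a + Gamma b) * real (Suc m) powr (- a))"
      unfolding norm_mult norm_mangoldt by (intro mult_mono mangoldt_le_self e) auto
    also have "\<dots> = C * (Gamma a + Gamma b) * (real (Suc m) powr 1 * real (Suc m) powr (- a))" by (simp del: of_nat_Suc)
    also have "real (Suc m) powr 1 * real (Suc m) powr (- a) = real (Suc m) powr (- (a - 1))"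
      unfolding powr_add[symmetric] by simp
    finally show ?thesis .
  qed
  have "summable (\<lambda>m. C * (Gamma a + Gamma b) * real (Suc m) powr (- (a - 1)))"
    using r by (intro summable_mult summable_Suc_powr) auto
  moreover have "integrable half_line (g m)" for m using g[of m] by (simp add: has_bochner_integral_iff)
  moreover have "Re z2 > 2 - real n" if "z2 \<in> ball s2 r" for z2 using r(6) that by fastforce
  ultimately show ?thesis
    using that[of r g "\<lambda>m. C * (Gamma a + Gamma b) * real (Suc m) powr (- (a - 1))"] r gb eb by blast
qed

text \<open>Holomorphy is proved in each variable separately, which is the form in which the
  identity theorem in two variables is stated below.\<close>

lemma rem_series_holomorphic_left:
  assumes s2: "Re s2 + real n > 2"
  shows "(\<lambda>s1. rem_series n s1 s2) holomorphic_on regular"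
  unfolding rem_series_def
proof (rule holomorphic_on_suminf[OF open_regular])
  fix s1 assume s1: "s1 \<in> regular"
  obtain r g h where r: "r > 0" "summable h"
    and h: "\<And>m z1 z2. z1 \<in> ball s1 r \<Longrightarrow> z2 \<in> ball s2 r \<Longrightarrow> norm (mangoldt (Suc m) * rem_integral n m z1 z2) \<le> h m"
    by (rule rem_integral_bound[OF s1 s2]) (rule that; assumption)
  then show "\<exists>d>0. \<exists>h. summable h \<and> (\<forall>m. \<forall>y\<in>ball s1 d \<inter> regular. norm (mangoldt (Suc m) * rem_integral n m y s2) \<le> h m)"
    by (intro exI[of _ r] conjI exI[of _ h]) auto
next
  fix m
  have "(\<lambda>s1. rem_integral n m s1 s2) holomorphic_on regular"
    unfolding rem_integral_def
  proof (rule holomorphic_on_lebesgue_integral[OF open_regular])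
    fix s1 assume s1: "s1 \<in> regular"
    obtain r g h where r: "r > 0" "ball s1 r \<subseteq> regular" and g: "\<And>m. integrable half_line (g m)"
      "\<And>m z1 z2 t. z1 \<in> ball s1 r \<Longrightarrow> z2 \<in> ball s2 r \<Longrightarrow> t > 0 \<Longrightarrow>
         norm (rem_kernel n m z1 z2 t) \<le> g m t"
      by (rule rem_integral_bound[OF s1 s2]) (rule that; assumption)
    then show "\<exists>r>0. \<exists>g. integrable half_line g \<and> ball s1 r \<subseteq> regular \<and> (\<forall>y\<in>ball s1 r. \<forall>t\<in>space half_line.
         norm (rem_kernel n m y s2 t) \<le> g t)"
      by (intro exI[of _ r] conjI exI[of _ "g m"] ballI) (auto simp del: of_nat_Suc)
  qed (auto intro!: rem_integral_integrand_measurable holomorphic_intros holomorphic_Li_rem simp del: of_nat_Suc)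
  then show "(\<lambda>s1. mangoldt (Suc m) * rem_integral n m s1 s2) holomorphic_on regular"
    by (intro holomorphic_intros)
qed

lemma rem_series_holomorphic_right:
  assumes s1: "s1 \<in> regular"
  shows "rem_series n s1 holomorphic_on {s2. Re s2 > 2 - real n}"
  unfolding rem_series_def
proof (rule holomorphic_on_suminf[OF open_halfspace_Re_gt])
  fix s2 assume "s2 \<in> {s2. Re s2 > 2 - real n}"
  then have s2: "Re s2 + real n > 2" by simp
  obtain r g h where r: "r > 0" "summable h"
    and h: "\<And>m z1 z2. z1 \<in> ball s1 r \<Longrightarrow> z2 \<in> ball s2 r \<Longrightarrow> norm (mangoldt (Suc m) * rem_integral n m z1 z2) \<le> h m"
    by (rule rem_integral_bound[OF s1 s2]) (rule that; assumption)
  then show "\<exists>d>0. \<exists>h. summable h \<and> (\<forall>m. \<forall>y\<in>ball s2 d \<inter> {s2. Re s2 > 2 - real n}. norm (mangoldt (Suc m) * rem_integral n m s1 y) \<le> h m)"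
    by (intro exI[of _ r] conjI exI[of _ h]) auto
next
  fix m
  have "(\<lambda>s2. rem_integral n m s1 s2) holomorphic_on {s2. Re s2 > 2 - real n}"
    unfolding rem_integral_def
  proof (rule holomorphic_on_lebesgue_integral[OF open_halfspace_Re_gt])
    fix s2 assume "s2 \<in> {s2. Re s2 > 2 - real n}"
    then have s2: "Re s2 + real n > 2" by simp
    obtain r g h where r: "r > 0" "\<And>z2. z2 \<in> ball s2 r \<Longrightarrow> Re z2 > 2 - real n" and g: "\<And>m. integrable half_line (g m)"
      "\<And>m z1 z2 t. z1 \<in> ball s1 r \<Longrightarrow> z2 \<in> ball s2 r \<Longrightarrow> t > 0 \<Longrightarrow>
         norm (rem_kernel n m z1 z2 t) \<le> g m t"
      by (rule rem_integral_bound[OF s1 s2]) (rule that; assumption)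
    have "ball s2 r \<subseteq> {s2. Re s2 > 2 - real n}" using r by blast
    then show "\<exists>r>0. \<exists>g. integrable half_line g \<and> ball s2 r \<subseteq> {s2. Re s2 > 2 - real n} \<and> (\<forall>y\<in>ball s2 r. \<forall>t\<in>space half_line.
         norm (rem_kernel n m s1 y t) \<le> g t)"
      using r g by (intro exI[of _ r] conjI exI[of _ "g m"] ballI) (auto simp del: of_nat_Suc)
  qed (auto intro!: rem_integral_integrand_measurable holomorphic_intros simp: s1 simp del: of_nat_Suc)
  then show "(\<lambda>s2. mangoldt (Suc m) * rem_integral n m s1 s2) holomorphic_on {s2. Re s2 > 2 - real n}"
    by (intro holomorphic_intros)
qed

section \<open>Unordered sums and the Dirichlet series of \<Lambda>\<close>

lemma range_Suc: "range Suc = {1..}"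
  by (auto simp: image_iff Suc_le_eq gr0_conv_Suc)

lemma has_sum_Suc:
  fixes f :: "nat \<Rightarrow> 'a :: banach"
  assumes "summable (\<lambda>n. norm (f (Suc n)))"
  shows "(f has_sum (\<Sum>n. f (Suc n))) {1..}"
  unfolding range_Suc[symmetric]
  by (subst has_sum_reindex)
     (use assms in \<open>auto simp: o_def intro!: norm_summable_imp_has_sum summable_sums summable_norm_cancel\<close>)

lemma has_sum_imp_sums_Suc:
  fixes f :: "nat \<Rightarrow> 'a :: {comm_monoid_add, topological_space}"
  assumes "(f has_sum S) {1..}"
  shows "(\<lambda>n. f (Suc n)) sums S"
  using assms unfolding range_Suc[symmetric]
  by (subst (asm) has_sum_reindex) (auto simp: o_def dest: has_sum_imp_sums)

lemma summable_on_product_bound: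
  fixes f :: "nat \<times> nat \<Rightarrow> complex"
  assumes u: "summable (\<lambda>m. u (Suc m))" "\<And>m. u m \<ge> 0" and v: "summable (\<lambda>m. v (Suc m))" "\<And>m. v m \<ge> (0 :: real)"
    and f: "\<And>m n. m \<ge> 1 \<Longrightarrow> n \<ge> 1 \<Longrightarrow> norm (f (m, n)) \<le> u m * v n"
  shows "f summable_on ({1..} \<times> {1..})"
proof -
  have U: "(u has_sum (\<Sum>n. u (Suc n))) {1..}" and V: "(v has_sum (\<Sum>n. v (Suc n))) {1..}"
    by (rule has_sum_Suc, use u v in simp)+
  have "(\<lambda>(m, n). u m * v n) summable_on ({1..} \<times> {1..})"
  proof (rule summable_on_SigmaI)
    show "((\<lambda>y. case (x, y) of (m, n) \<Rightarrow> u m * v n) has_sum u x * (\<Sum>n. v (Suc n))) {1..}" for x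
      using has_sum_cmult_right[OF V] by simp
    show "(\<lambda>x. u x * (\<Sum>n. v (Suc n))) summable_on {1..}"
      using has_sum_cmult_left[OF U] by (auto simp: summable_on_def)
  qed (use u v in auto)
  then have "(\<lambda>x. norm (case x of (m, n) \<Rightarrow> u m * v n)) summable_on ({1..} \<times> {1..})"
    by (rule summable_on_cong[THEN iffD1, rotated]) (use u v in auto)
  then have "(\<lambda>x. norm (f x)) summable_on ({1..} \<times> {1..})"
    by (rule Infinite_Sum.abs_summable_on_comparison_test) (use f u v in \<open>force intro: order_trans[OF _ abs_ge_self]\<close>)
  then show ?thesis by (rule abs_summable_summable)
qed

definition mangoldt_series :: "complex \<Rightarrow> complex" where
  "mangoldt_series s = (\<Sum>m. mangoldt (Suc m) * of_nat (Suc m) powr (- s))"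

lemma norm_mangoldt_powr:
  assumes "m \<ge> 1"
  shows "norm (mangoldt m * of_nat m powr (- s) :: complex) \<le> real m powr (1 - Re s)"
proof -
  obtain k where k: "m = Suc k" using assms by (cases m) auto
  have "norm (mangoldt m * of_nat m powr (- s) :: complex) \<le> real (Suc k) * real (Suc k) powr (- Re s)"
    unfolding norm_mult k norm_Suc_powr norm_mangoldt using mangoldt_le_self[of k] by (intro mult_mono) auto
  also have "\<dots> = real m powr (1 - Re s)"
    using assms by (simp add: k powr_diff powr_minus divide_inverse del: of_nat_Suc)
  finally show ?thesis .
qed

text \<open>The half-plane Re s > 2 results from \<Lambda>(m) \<le> m; the identity theorem starts
  from any nonempty open set, so this region serves the purpose.\<close>

lemma mangoldt_series_summable: "Re s > 2 \<Longrightarrow> summable (\<lambda>m. norm (mangoldt (Suc m) * of_nat (Suc m) powr (- s) :: complex))"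
  by (rule summable_comparison_test'[OF summable_Suc_powr[of "Re s - 1"]])
     (use norm_mangoldt_powr[of "Suc _" s] in \<open>auto simp del: of_nat_Suc\<close>)

lemma mangoldt_series_sums: "Re s > 2 \<Longrightarrow> (\<lambda>m. mangoldt (Suc m) * of_nat (Suc m) powr (- s)) sums mangoldt_series s"
  unfolding mangoldt_series_def by (intro summable_sums summable_norm_cancel[OF mangoldt_series_summable])

text \<open>The double sum of \<Lambda>(d) (d m)^(-s) is computed as a product and also by
  collecting n = d m, where the sum of \<Lambda>(d) over d | n is ln n. The product form spares a
  proof that zeta has no zeros in the half-plane.\<close>

lemma zeta_times_mangoldt_series:
  assumes s: "Re s > 2"
  shows "zeta s * mangoldt_series s = - deriv zeta s"
proof -
  define A :: "nat set" where "A = {1..}"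
  define f where "f = (\<lambda>(d :: nat, m). mangoldt d * of_nat d powr (- s) * of_nat m powr (- s) :: complex)"
  have "f summable_on (A \<times> A)"
    unfolding A_def
  proof (rule summable_on_product_bound)
    show "summable (\<lambda>m. real (Suc m) powr (1 - Re s))" "summable (\<lambda>m. real (Suc m) powr (- Re s))"
      using summable_Suc_powr[of "Re s - 1"] summable_Suc_powr[of "Re s"] s by auto
    fix m n :: nat assume mn: "m \<ge> 1" "n \<ge> 1"
    have "norm (of_nat n powr (- s) :: complex) = real n powr (- Re s)"
      using norm_of_real_powr[of "real n" "- s"] mn by simp
    then show "norm (f (m, n)) \<le> real m powr (1 - Re s) * real n powr (- Re s)"
      unfolding f_def using norm_mangoldt_powr[OF mn(1), of s] by (simp add: norm_mult[of "mangoldt m * _"] mult_right_mono)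
  qed auto
  then obtain S where S: "(f has_sum S) (A \<times> A)" by (auto simp: summable_on_def)
  have D: "((\<lambda>m. of_nat m powr (- s)) has_sum dirichlet s) A"
    unfolding dirichlet_altdef A_def using dirichlet_summable[of s] s by (intro has_sum_Suc) auto
  have "((\<lambda>d. mangoldt d * of_nat d powr (- s) * dirichlet s) has_sum S) A"
    by (rule has_sum_SigmaD[OF S]) (use has_sum_cmult_right[OF D] in \<open>auto simp: f_def\<close>)
  moreover have "((\<lambda>d. mangoldt d * of_nat d powr (- s) * dirichlet s) has_sum (mangoldt_series s * dirichlet s)) A"
    unfolding mangoldt_series_def A_def by (intro has_sum_cmult_left has_sum_Suc mangoldt_series_summable s)
  ultimately have S1: "S = mangoldt_series s * dirichlet s" by (rule has_sum_unique)
  define h where "h = (\<lambda>(n :: nat, d). mangoldt d * of_nat n powr (- s) :: complex)"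
  have "(f has_sum S) (A \<times> A) = (h has_sum S) (Sigma A (\<lambda>n. {d. d dvd n}))"
  proof (rule has_sum_reindex_bij_witness[where j = "\<lambda>(d, m). (d * m, d)" and i = "\<lambda>(n, d). (d, n div d)"])
    fix a assume "a \<in> A \<times> A"
    then obtain d m where a: "a = (d, m)" "d \<ge> 1" "m \<ge> 1" by (auto simp: A_def)
    then show "h (case a of (d, m) \<Rightarrow> (d * m, d)) = f a"
      using powr_times_real[of "of_nat d" "of_nat m" "- s"] by (simp add: f_def h_def)
  qed (auto simp: A_def dvd_div_eq_0_iff Suc_le_eq dvd_imp_le)
  with S have "(h has_sum S) (Sigma A (\<lambda>n. {d. d dvd n}))" by simp
  then have "((\<lambda>n. \<Sum>d | d dvd n. h (n, d)) has_sum S) A"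
    by (rule has_sum_SigmaD) (auto simp: A_def intro!: has_sum_finite)
  then have "((\<lambda>n. of_real (ln (real n)) * of_nat n powr (- s)) has_sum S) A"
    by (rule has_sum_cong[THEN iffD1, rotated])
       (auto simp: A_def h_def sum_distrib_right[symmetric] mangoldt_sum)
  then have "(\<lambda>n. of_real (ln (real (Suc n))) * of_nat (Suc n) powr (- s)) sums S"
    unfolding A_def by (rule has_sum_imp_sums_Suc)
  then have "(\<lambda>n. - (of_real (ln (real (Suc n))) * of_nat (Suc n) powr (- s))) sums (- S)"
    by (rule sums_minus)
  then have "(\<Sum>n. - of_real (ln (real (Suc n))) * of_nat (Suc n) powr (- s)) = - S"
    by (simp add: sums_iff)
  then have "(dirichlet has_field_derivative - S) (at s)"
    using dirichlet_has_field_derivative[of s] s by simp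
  then have "(zeta has_field_derivative - S) (at s)"
    by (rule has_field_derivative_transform_within_open[of _ _ _ "{s. Re s > 1}"])
       (use s in \<open>auto simp: open_halfspace_Re_gt zeta_eq_dirichlet\<close>)
  then have "deriv zeta s = - S" by (rule DERIV_imp_deriv)
  then show ?thesis using S1 s by (simp add: zeta_eq_dirichlet)
qed

section \<open>Expansion of the double series in a region of convergence\<close>

definition shifted_sum :: "complex \<Rightarrow> complex \<Rightarrow> nat \<Rightarrow> complex" where
  "shifted_sum s1 s2 M = (\<Sum>k. of_nat (Suc k) powr (- s1) * of_nat (Suc k + M) powr (- s2))"

lemma norm_shifted_sum_term_le:
  assumes "Re s2 \<ge> 0" "M \<ge> 1"
  shows "norm (of_nat (Suc k) powr (- s1) * of_nat (Suc k + M) powr (- s2) :: complex)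
           \<le> real (Suc k) powr (- Re s1) * real M powr (- Re s2)"
proof -
  have "norm (of_nat (Suc k + M) powr (- s2) :: complex) = real (Suc k + M) powr (- Re s2)"
    using norm_of_real_powr[of "real (Suc k + M)" "- s2"] by simp
  also have "\<dots> \<le> real M powr (- Re s2)" using assms by (intro powr_mono2') auto
  finally show ?thesis unfolding norm_mult norm_Suc_powr by (simp add: mult_left_mono del: of_nat_Suc of_nat_add)
qed

text \<open>In this region the terms are bounded by the product of m1^(- Re s1) and m2^(1 - Re s2),
  so the sum over m1 may be carried out first.\<close>

lemma Phi2_series_sums:
  assumes s: "Re s1 > 1" "Re s2 > 2"
  shows "(\<lambda>m. mangoldt (Suc m) * shifted_sum s1 s2 (Suc m)) sums Phi2_series s1 s2"
proof -
  define f where "f = (\<lambda>(m1, m2). mangoldt m2 / (of_nat m1 powr s1 * of_nat (m1 + m2) powr s2) :: complex)"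
  have f: "f (Suc m1, m2) = mangoldt m2 * (of_nat (Suc m1) powr (- s1) * of_nat (Suc m1 + m2) powr (- s2))" for m1 m2
    by (simp only: f_def prod.case powr_minus divide_inverse inverse_mult_distrib)
  have b: "norm (of_nat (Suc k) powr (- s1) * of_nat (Suc k + M) powr (- s2) :: complex) \<le> real (Suc k) powr (- Re s1) * real M powr (- Re s2)"
    if "M \<ge> 1" for k M
    using norm_shifted_sum_term_le that s by simp
  have "f summable_on ({1..} \<times> {1..})"
  proof (rule summable_on_product_bound)
    show "summable (\<lambda>m. real (Suc m) powr (- Re s1))" "summable (\<lambda>m. real (Suc m) powr (1 - Re s2))"
      using summable_Suc_powr[of "Re s2 - 1"] summable_Suc_powr[of "Re s1"] s by auto
    fix m n :: nat assume mn: "m \<ge> 1" "n \<ge> 1"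
    obtain k where k: "m = Suc k" using mn by (cases m) auto
    obtain j where j: "n = Suc j" using mn by (cases n) auto
    have "norm (f (m, n)) \<le> real n * (real m powr (- Re s1) * real n powr (- Re s2))"
      unfolding k f norm_mult[of "mangoldt _"] norm_mangoldt using mangoldt_le_self[of j] b[OF mn(2), of k]
      by (intro mult_mono) (auto simp: j simp del: of_nat_Suc)
    also have "\<dots> = real m powr (- Re s1) * real n powr (1 - Re s2)"
      using mn by (simp add: powr_diff powr_minus divide_inverse)
    finally show "norm (f (m, n)) \<le> real m powr (- Re s1) * real n powr (1 - Re s2)" .
  qed auto
  then have "(f has_sum Phi2_series s1 s2) ({1..} \<times> {1..})"
    unfolding Phi2_series_def f_def by (rule has_sum_infsum)
  then have "((\<lambda>(m2, m1). f (m1, m2)) has_sum Phi2_series s1 s2) ({1..} \<times> {1..})"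
    by (subst (asm) has_sum_swap)
  then have "((\<lambda>m2. mangoldt m2 * shifted_sum s1 s2 m2) has_sum Phi2_series s1 s2) {1..}"
  proof (rule has_sum_SigmaD)
    fix m2 :: nat assume "m2 \<in> {1..}"
    then have m2: "m2 \<ge> 1" by simp
    have "summable (\<lambda>k. real (Suc k) powr (- Re s1) * real m2 powr (- Re s2))"
      using s by (intro summable_mult2 summable_Suc_powr) auto
    then have sm: "summable (\<lambda>k. norm (of_nat (Suc k) powr (- s1) * of_nat (Suc k + m2) powr (- s2) :: complex))"
      by (rule summable_comparison_test'[where N = 0]) (use b[OF m2] in \<open>auto simp del: of_nat_Suc\<close>)
    have "summable (\<lambda>k. norm (f (Suc k, m2)))"
      unfolding f norm_mult[of "mangoldt _"] by (rule summable_mult[OF sm])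
    then have "((\<lambda>m1. f (m1, m2)) has_sum (\<Sum>k. f (Suc k, m2))) {1..}" by (rule has_sum_Suc)
    also have "(\<Sum>k. f (Suc k, m2)) = mangoldt m2 * shifted_sum s1 s2 m2"
      unfolding f shifted_sum_def by (rule suminf_mult[OF summable_norm_cancel[OF sm]])
    finally show "((\<lambda>y. case (m2, y) of (m2, m1) \<Rightarrow> f (m1, m2)) has_sum mangoldt m2 * shifted_sum s1 s2 m2) {1..}" by simp
  qed
  then show ?thesis by (rule has_sum_imp_sums_Suc)
qed

abbreviation zeta_coeff :: "complex \<Rightarrow> nat \<Rightarrow> complex" where
  "zeta_coeff s k \<equiv> zeta (s - of_nat k) * (- 1) ^ k / fact k"

text \<open>The Mellin transform of exp(- M x) Li s1 x has the frequencies k + M and is the shifted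
  sum. For Re s1 > 1 and Re s2 > 1 the subtracted powers have convergent Mellin transforms as well,
  so the integral of the remainder splits into Gamma integrals.\<close>

lemma shifted_sum_expansion:
  assumes s1: "s1 \<in> regular" "Re s1 > 1" and s2: "Re s2 > 1"
  shows "Gamma s2 * shifted_sum s1 s2 (Suc m) = rem_integral n m s1 s2
     + Gamma (1 - s1) * (Gamma (s1 + s2 - 1) * of_nat (Suc m) powr (- (s1 + s2 - 1)))
     + (\<Sum>k<n. zeta_coeff s1 k * (Gamma (s2 + of_nat k) * of_nat (Suc m) powr (- (s2 + of_nat k))))"
proof -
  define M where "M = real (Suc m)"
  have M: "M > 0" by (simp add: M_def)
  have H: "has_hl_integral (\<lambda>x. of_real x powr (s2 - 1) * (\<Sum>k. of_nat (Suc k) powr (- s1) * of_real (exp (- ((real (Suc k) + M) * x)))))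
      (Gamma s2 * (\<Sum>k. of_nat (Suc k) powr (- s1) * of_real (real (Suc k) + M) powr (- s2)))"
  proof (rule Mellin_series)
    have S: "summable (\<lambda>k. norm (of_nat (Suc k) powr (- s1) :: complex))"
      using dirichlet_summable s1 by simp
    have "real (Suc k) + M \<ge> 1" for k using M by simp
    then have p: "(real (Suc k) + M) powr (- Re s2) \<le> 1" for k
      using s2 powr_mono2'[of "- Re s2" 1 "real (Suc k) + M"] by simp
    show "summable (\<lambda>k. norm (of_nat (Suc k) powr (- s1) :: complex) * (real (Suc k) + M) powr (- Re s2))"
      by (rule summable_comparison_test'[OF S, where N = 0]) (use p in \<open>auto intro!: mult_right_le_one_le simp del: of_nat_Suc\<close>)
    show "summable (\<lambda>k. norm (of_nat (Suc k) powr (- s1) :: complex) * exp (- ((real (Suc k) + M) * x)))" if "x > 0" for x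
      by (rule summable_comparison_test'[OF S, where N = 0]) (use that M in \<open>auto intro!: mult_right_le_one_le simp del: of_nat_Suc\<close>)
  qed (use s2 M in auto)
  have eq1: "(\<Sum>k. of_nat (Suc k) powr (- s1) * of_real (real (Suc k) + M) powr (- s2)) = shifted_sum s1 s2 (Suc m)"
    unfolding shifted_sum_def M_def by simp
  have eq2: "(\<Sum>k. of_nat (Suc k) powr (- s1) * complex_of_real (exp (- ((real (Suc k) + M) * x)))) = of_real (exp (- (M * x))) * Li s1 (of_real x)"
    if "x > 0" for x
  proof -
    have "of_nat (Suc k) powr (- s1) * complex_of_real (exp (- ((real (Suc k) + M) * x))) =
        of_real (exp (- (M * x))) * (of_nat (Suc k) powr (- s1) * exp (- (of_nat (Suc k) * of_real x)))" for k
    proof -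
      have "complex_of_real (exp (- ((real (Suc k) + M) * x))) = of_real (exp (- (M * x))) * exp (- (of_nat (Suc k) * of_real x))"
        unfolding exp_of_real[symmetric] exp_add[symmetric] by (simp add: algebra_simps)
      then show ?thesis by (simp only:) (simp only: mult_ac)
    qed
    then show ?thesis
      unfolding Li_def by (simp only: suminf_mult[OF summable_norm_cancel[OF Li_summable[of "of_real x" s1]]] that Re_complex_of_real)
  qed
  define e where "e x = complex_of_real (exp (- (M * x)))" for x
  define T1 where "T1 x = Gamma (1 - s1) * (of_real x powr (s1 + s2 - 1 - 1) * e x)" for x
  define T2 where "T2 x = (\<Sum>k<n. zeta_coeff s1 k * (of_real x powr (s2 + of_nat k - 1) * e x))" for x
  define I1 where "I1 = Gamma (1 - s1) * (Gamma (s1 + s2 - 1) * of_real M powr (- (s1 + s2 - 1)))"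
  define I2 where "I2 = (\<Sum>k<n. zeta_coeff s1 k * (Gamma (s2 + of_nat k) * of_real M powr (- (s2 + of_nat k))))"
  have "has_hl_integral (\<lambda>x. of_real x powr (s2 - 1) * (e x * Li s1 (of_real x))) (Gamma s2 * shifted_sum s1 s2 (Suc m))"
    unfolding e_def
    by (rule has_bochner_integral_cong[THEN iffD1, OF refl _ _ H]) (simp_all only: space_half_line greaterThan_iff eq1 eq2)
  moreover have "has_hl_integral T1 I1"
    unfolding T1_def I1_def e_def using s1 s2 M by (intro has_bochner_integral_mult_right Gamma_integral_half_line) auto
  moreover have "has_hl_integral T2 I2"
    unfolding T2_def I2_def e_def using s2 M by (intro has_bochner_integral_sum has_bochner_integral_mult_right Gamma_integral_half_line) auto
  ultimately have "has_hl_integral (\<lambda>x. of_real x powr (s2 - 1) * (e x * Li s1 (of_real x)) - T1 x - T2 x) (Gamma s2 * shifted_sum s1 s2 (Suc m) - I1 - I2)"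
    by (intro has_bochner_integral_diff)
  moreover have "of_real x powr (s2 - 1) * (e x * Li s1 (of_real x)) - T1 x - T2 x = e x * (of_real x powr (s2 - 1) * Li_rem n s1 (of_real x))"
    if x: "x \<in> space half_line" for x
  proof -
    have 1: "of_real x powr (s1 + s2 - 1 - 1) = of_real x powr (s2 - 1) * of_real x powr (s1 - 1)"
      unfolding powr_add[symmetric] by (simp add: algebra_simps)
    have 2: "zeta_coeff s1 k * (of_real x powr (s2 + of_nat k - 1) * e x)
        = e x * of_real x powr (s2 - 1) * (zeta (s1 - of_nat k) * (- of_real x) ^ k / fact k)" for k
    proof -
      have "complex_of_real x powr (s2 + of_nat k - 1) = of_real x powr (s2 - 1) * of_real x powr of_nat k"
        unfolding powr_add[symmetric] by (simp add: algebra_simps)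
      also have "complex_of_real x powr of_nat k = of_real x ^ k" using x by simp
      finally show ?thesis unfolding power_minus[of "of_real x"] by (simp add: field_simps)
    qed
    show ?thesis
      unfolding T1_def T2_def 1 2 sum_distrib_left[symmetric] Li_rem_def Li_reg_def by (simp only: ring_distribs mult_ac)
  qed
  ultimately have "has_hl_integral (\<lambda>x. e x * (of_real x powr (s2 - 1) * Li_rem n s1 (of_real x))) (Gamma s2 * shifted_sum s1 s2 (Suc m) - I1 - I2)"
    by (subst (asm) has_bochner_integral_cong) auto
  then have "rem_integral n m s1 s2 = Gamma s2 * shifted_sum s1 s2 (Suc m) - I1 - I2"
    unfolding rem_integral_def e_def M_def by (rule has_bochner_integral_integral_eq)
  then show ?thesis unfolding I1_def I2_def M_def by (simp only: of_real_of_nat_eq) (simp add: algebra_simps)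
qed

text \<open>Writing \<open>rGamma s2\<close> in place of a division by Gamma keeps the formula
  meaningful at s2 = -l, where its zero is used in the end; the quotients Gamma(s2 + k) / Gamma(s2)
  become Pochhammer symbols.\<close>

lemma Phi2_series_formula:
  assumes s1: "s1 \<in> regular" "Re s1 > 1" and s2: "Re s2 > 2"
  shows "Phi2_series s1 s2 = rGamma s2 * Gamma (1 - s1) * Gamma (s1 + s2 - 1) * mangoldt_series (s1 + s2 - 1)
     + (\<Sum>k<n. zeta_coeff s1 k * pochhammer s2 k * mangoldt_series (s2 + of_nat k))
     + rGamma s2 * rem_series n s1 s2"
proof -
  have s2': "Re s2 > 1" using s2 by simp
  have nn: "s2 \<notin> \<int>\<^sub>\<le>\<^sub>0" using s2 by (auto elim!: nonpos_Ints_cases)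
  then have rG: "rGamma s2 * (Gamma s2 * z) = z" for z
    by (simp add: rGamma_inverse_Gamma Gamma_eq_zero_iff)
  have E: "(\<lambda>m. mangoldt (Suc m) * rem_integral n m s1 s2) sums rem_series n s1 s2"
  proof -
    obtain r g h where r: "r > 0" and h: "summable h" "\<And>m z1 z2. z1 \<in> ball s1 r \<Longrightarrow> z2 \<in> ball s2 r \<Longrightarrow> norm (mangoldt (Suc m) * rem_integral n m z1 z2) \<le> h m"
      by (rule rem_integral_bound[OF s1(1), of s2 n]) (use s2 in auto)
    have "summable (\<lambda>m. mangoldt (Suc m) * rem_integral n m s1 s2)"
      by (rule summable_comparison_test'[OF h(1), where N = 0]) (use h(2)[of s1 s2] r in auto)
    then show ?thesis unfolding rem_series_def by (rule summable_sums)
  qed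
  have "(\<lambda>m. rGamma s2 * Gamma (1 - s1) * Gamma (s1 + s2 - 1) * (mangoldt (Suc m) * of_nat (Suc m) powr (- (s1 + s2 - 1)))
      + (\<Sum>k<n. zeta_coeff s1 k * pochhammer s2 k * (mangoldt (Suc m) * of_nat (Suc m) powr (- (s2 + of_nat k))))
      + rGamma s2 * (mangoldt (Suc m) * rem_integral n m s1 s2)) sums
     (rGamma s2 * Gamma (1 - s1) * Gamma (s1 + s2 - 1) * mangoldt_series (s1 + s2 - 1)
     + (\<Sum>k<n. zeta_coeff s1 k * pochhammer s2 k * mangoldt_series (s2 + of_nat k))
     + rGamma s2 * rem_series n s1 s2)"
    using s1 s2 by (intro sums_add sums_mult sums_sum E mangoldt_series_sums) auto
  moreover have "rGamma s2 * Gamma (1 - s1) * Gamma (s1 + s2 - 1) * (mangoldt (Suc m) * of_nat (Suc m) powr (- (s1 + s2 - 1)))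
      + (\<Sum>k<n. zeta_coeff s1 k * pochhammer s2 k * (mangoldt (Suc m) * of_nat (Suc m) powr (- (s2 + of_nat k))))
      + rGamma s2 * (mangoldt (Suc m) * rem_integral n m s1 s2) = mangoldt (Suc m) * shifted_sum s1 s2 (Suc m)" for m
  proof -
    have p: "pochhammer s2 k = rGamma s2 * Gamma (s2 + of_nat k)" for k
      using pochhammer_Gamma[OF nn, of k] by (simp add: rGamma_inverse_Gamma field_simps)
    have "mangoldt (Suc m) * shifted_sum s1 s2 (Suc m) = mangoldt (Suc m) * (rGamma s2 * (Gamma s2 * shifted_sum s1 s2 (Suc m)))"
      by (simp only: rG)
    also have "\<dots> = rGamma s2 * Gamma (1 - s1) * Gamma (s1 + s2 - 1) * (mangoldt (Suc m) * of_nat (Suc m) powr (- (s1 + s2 - 1)))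
      + (\<Sum>k<n. mangoldt (Suc m) * rGamma s2 * (zeta_coeff s1 k * (Gamma (s2 + of_nat k) * of_nat (Suc m) powr (- (s2 + of_nat k)))))
      + rGamma s2 * (mangoldt (Suc m) * rem_integral n m s1 s2)"
      unfolding shifted_sum_expansion[OF s1 s2', of m n] sum_distrib_left[symmetric]
      by (simp only: ring_distribs mult_ac add_ac)
    finally show ?thesis unfolding p by (simp only: mult_ac times_divide_eq_left times_divide_eq_right)
  qed
  ultimately show ?thesis
    using Phi2_series_sums[OF s1(2) s2] sums_unique2 by fastforce
qed

subsection \<open>Meromorphic functions of two variables\<close>

lemma holomorphic2_on_has_derivative:
  assumes "open U" "holomorphic2_on g U" "p \<in> U"
  obtains a b where "(g has_derivative (\<lambda>(x, y). a * x + b * y)) (at p)"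
  using assms unfolding holomorphic2_on_def by (metis at_within_open)

lemma holomorphic2_on_continuous: "open U \<Longrightarrow> holomorphic2_on g U \<Longrightarrow> continuous_on U g"
  unfolding continuous_on_eq_continuous_within holomorphic2_on_def
  using has_derivative_continuous by blast

lemma holomorphic2_on_slices:
  assumes U: "open U" "holomorphic2_on g U"
  shows "{x. (x, y) \<in> U} \<supseteq> S \<Longrightarrow> (\<lambda>x. g (x, y)) holomorphic_on S"
    and "{y. (x, y) \<in> U} \<supseteq> S \<Longrightarrow> (\<lambda>y. g (x, y)) holomorphic_on S"
proof -
  have "(\<lambda>x. g (x, y)) field_differentiable at x within S" if xy: "(x, y) \<in> U" for x
  proof -
    obtain a b where "(g has_derivative (\<lambda>(x, y). a * x + b * y)) (at (x, y))"
      using holomorphic2_on_has_derivative[OF U xy] .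
    then have "((\<lambda>x. g (x, y)) has_derivative (\<lambda>h. case (h, 0) of (x, y) \<Rightarrow> a * x + b * y)) (at x within S)"
      by (intro has_derivative_compose[of "\<lambda>x. (x, y)" _ _ _ g]) (auto intro!: derivative_eq_intros)
    then show ?thesis by (auto simp: field_differentiable_def has_field_derivative_def)
  qed
  then show "{x. (x, y) \<in> U} \<supseteq> S \<Longrightarrow> (\<lambda>x. g (x, y)) holomorphic_on S"
    by (auto simp: holomorphic_on_def)
  have "(\<lambda>y. g (x, y)) field_differentiable at y within S" if xy: "(x, y) \<in> U" for y
  proof -
    obtain a b where "(g has_derivative (\<lambda>(x, y). a * x + b * y)) (at (x, y))"
      using holomorphic2_on_has_derivative[OF U xy] .
    then have "((\<lambda>y. g (x, y)) has_derivative (\<lambda>h. case (0, h) of (x, y) \<Rightarrow> a * x + b * y)) (at y within S)"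
      by (intro has_derivative_compose[of "\<lambda>y. (x, y)" _ _ _ g]) (auto intro!: derivative_eq_intros)
    then show ?thesis by (auto simp: field_differentiable_def has_field_derivative_def)
  qed
  then show "{y. (x, y) \<in> U} \<supseteq> S \<Longrightarrow> (\<lambda>y. g (x, y)) holomorphic_on S"
    by (auto simp: holomorphic_on_def)
qed

text \<open>Two applications of the identity theorem in one variable: inside a box contained in V
  the zeros spread along the second variable to all of D2, and then along the first to all of
  D1.\<close>

lemma separately_holomorphic_eq_0:
  fixes f :: "complex \<times> complex \<Rightarrow> complex"
  assumes D: "open D1" "connected D1" "open D2" "connected D2"
    and f1: "\<And>y. y \<in> D2 \<Longrightarrow> (\<lambda>x. f (x, y)) holomorphic_on D1"
    and f2: "\<And>x. x \<in> D1 \<Longrightarrow> (\<lambda>y. f (x, y)) holomorphic_on D2"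
    and V: "open V" "V \<noteq> {}" "V \<subseteq> D1 \<times> D2" "\<And>q. q \<in> V \<Longrightarrow> f q = 0"
    and q: "q \<in> D1 \<times> D2"
  shows "f q = 0"
proof -
  obtain p where p: "p \<in> V" using V by blast
  obtain V1 V2 where box: "open V1" "open V2" "p \<in> V1 \<times> V2" "V1 \<times> V2 \<subseteq> V"
    using open_prod_elim[OF V(1) p] .
  obtain x y where xy: "q = (x, y)" "x \<in> D1" "y \<in> D2" using q by auto
  have V12: "V1 \<subseteq> D1" "V2 \<subseteq> D2" using box V(3) by auto
  have "f (x', y) = 0" if "x' \<in> V1" for x'
  proof (rule analytic_continuation_open[OF box(2) D(3) _ D(4) V12(2), of "\<lambda>y. f (x', y)" "\<lambda>_. 0"])
    show "f (x', z) = 0" if "z \<in> V2" for z using V(4) box that \<open>x' \<in> V1\<close> by blast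
    show "(\<lambda>y. f (x', y)) holomorphic_on D2" using that V12 by (intro f2) auto
  qed (use box xy in auto)
  note V1 = this
  have "f (x, y) = 0"
  proof (rule analytic_continuation_open[OF box(1) D(1) _ D(2) V12(1), of "\<lambda>x. f (x, y)" "\<lambda>_. 0"])
    show "(\<lambda>x. f (x, y)) holomorphic_on D1" using xy by (intro f1) auto
  qed (use box xy V1 in auto)
  then show ?thesis using xy by simp
qed

text \<open>A local quotient as in \<open>meromorphic2\<close>, but over a product of connected open
  sets, so that the slicewise identity theorem is available on it.\<close>

definition mero_rep :: "(complex \<times> complex \<Rightarrow> complex) \<Rightarrow> complex set \<Rightarrow> complex set \<Rightarrow>
    (complex \<times> complex \<Rightarrow> complex) \<Rightarrow> (complex \<times> complex \<Rightarrow> complex) \<Rightarrow> bool" where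
  "mero_rep F U1 U2 g h \<longleftrightarrow> open U1 \<and> open U2 \<and> connected U1 \<and> connected U2 \<and>
     holomorphic2_on g (U1 \<times> U2) \<and> holomorphic2_on h (U1 \<times> U2) \<and>
     (\<forall>V. open V \<and> V \<noteq> {} \<and> V \<subseteq> U1 \<times> U2 \<longrightarrow> (\<exists>q\<in>V. h q \<noteq> 0)) \<and>
     (\<forall>q\<in>U1 \<times> U2. h q \<noteq> 0 \<longrightarrow> F q = g q / h q)"

lemma meromorphic2_local_rep:
  assumes F: "meromorphic2 F" and D: "open D" "p \<in> D"
  obtains U1 U2 g h where "mero_rep F U1 U2 g h" "p \<in> U1 \<times> U2" "U1 \<times> U2 \<subseteq> D"
proof -
  obtain U g h where U: "open U" "p \<in> U" "holomorphic2_on g U" "holomorphic2_on h U"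
    "\<forall>V. open V \<and> V \<noteq> {} \<and> V \<subseteq> U \<longrightarrow> (\<exists>q\<in>V. h q \<noteq> 0)" "\<forall>q\<in>U. h q \<noteq> 0 \<longrightarrow> F q = g q / h q"
    using F[unfolded meromorphic2_def, THEN spec, of p] by (elim exE conjE) (rule that; assumption)
  obtain V1 V2 where V: "open V1" "open V2" "p \<in> V1 \<times> V2" "V1 \<times> V2 \<subseteq> U \<inter> D"
    using open_prod_elim[of "U \<inter> D" p] U D by blast
  obtain x y where p: "p = (x, y)" by (cases p)
  obtain e1 where e1: "e1 > 0" "ball x e1 \<subseteq> V1" using V p open_contains_ball by blast
  obtain e2 where e2: "e2 > 0" "ball y e2 \<subseteq> V2" using V p open_contains_ball by blast
  have sub: "ball x e1 \<times> ball y e2 \<subseteq> U" "ball x e1 \<times> ball y e2 \<subseteq> D" using e1 e2 V(4) by blast+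
  have "holomorphic2_on f (ball x e1 \<times> ball y e2)" if "holomorphic2_on f U" for f
    using that sub unfolding holomorphic2_on_def by (meson has_derivative_subset subsetD)
  then have "mero_rep F (ball x e1) (ball y e2) g h"
    unfolding mero_rep_def
  proof (intro conjI allI impI ballI)
    fix V assume "open V \<and> V \<noteq> {} \<and> V \<subseteq> ball x e1 \<times> ball y e2"
    then have "open V \<and> V \<noteq> {} \<and> V \<subseteq> U" using sub(1) by (meson subset_trans)
    then show "\<exists>q\<in>V. h q \<noteq> 0" using U(5) by blast
  next
    fix q assume "q \<in> ball x e1 \<times> ball y e2" "h q \<noteq> 0"
    then show "F q = g q / h q" using U(6) sub(1) by blast
  qed (use U(3,4) in auto)
  then show ?thesis using that[of "ball x e1" "ball y e2" g h] sub e1 e2 p by auto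
qed

lemma mero_rep_eq:
  "mero_rep F U1 U2 g h \<Longrightarrow> x \<in> U1 \<Longrightarrow> y \<in> U2 \<Longrightarrow> h (x, y) \<noteq> 0 \<Longrightarrow> g (x, y) = F (x, y) * h (x, y)"
  unfolding mero_rep_def by simp

lemma mero_rep_nonzero_set:
  assumes "mero_rep F U1 U2 g h" "open V" "V \<subseteq> U1 \<times> U2" "V \<noteq> {}"
  shows "open {q \<in> V. h q \<noteq> 0}" "{q \<in> V. h q \<noteq> 0} \<noteq> {}"
proof -
  have "continuous_on V h"
    using assms(1,3) holomorphic2_on_continuous[of "U1 \<times> U2" h] unfolding mero_rep_def
    by (auto intro: continuous_on_subset open_Times)
  then have "open (V \<inter> h -` (- {0}))"
    using assms(2) by (rule continuous_open_preimage) auto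
  moreover have "V \<inter> h -` (- {0}) = {q \<in> V. h q \<noteq> 0}" by auto
  ultimately show "open {q \<in> V. h q \<noteq> 0}" by simp
  show "{q \<in> V. h q \<noteq> 0} \<noteq> {}" using assms unfolding mero_rep_def by blast
qed

text \<open>F = g / h and F = A / B are compared as g B = h A, an identity between functions
  holomorphic in each variable, untouched by zeros of denominators.\<close>

lemma mero_rep_cross_eq:
  assumes rep: "mero_rep F U1 U2 g h"
    and A: "\<And>y. y \<in> U2 \<Longrightarrow> (\<lambda>x. A x y) holomorphic_on U1" "\<And>x. x \<in> U1 \<Longrightarrow> A x holomorphic_on U2"
    and B: "\<And>y. y \<in> U2 \<Longrightarrow> (\<lambda>x. B x y) holomorphic_on U1" "\<And>x. x \<in> U1 \<Longrightarrow> B x holomorphic_on U2"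
    and V: "open V" "V \<noteq> {}" "V \<subseteq> U1 \<times> U2"
    and eq: "\<And>x y. (x, y) \<in> V \<Longrightarrow> g (x, y) * B x y = h (x, y) * A x y"
    and xy: "x \<in> U1" "y \<in> U2"
  shows "g (x, y) * B x y = h (x, y) * A x y"
proof -
  define f where "f = (\<lambda>(x, y). g (x, y) * B x y - h (x, y) * A x y)"
  have U: "open (U1 \<times> U2)" "holomorphic2_on g (U1 \<times> U2)" "holomorphic2_on h (U1 \<times> U2)" "open U1" "open U2" "connected U1" "connected U2"
    using rep unfolding mero_rep_def by (auto intro: open_Times)
  have "f (x, y) = 0"
  proof (rule separately_holomorphic_eq_0[of U1 U2 f V])
    show "(\<lambda>x. f (x, y)) holomorphic_on U1" if "y \<in> U2" for y
      unfolding f_def prod.case using that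
      by (intro holomorphic_intros A B holomorphic2_on_slices(1)[OF U(1,2)] holomorphic2_on_slices(1)[OF U(1,3)]) auto
    show "(\<lambda>y. f (x, y)) holomorphic_on U2" if "x \<in> U1" for x
      unfolding f_def prod.case using that
      by (intro holomorphic_intros A B holomorphic2_on_slices(2)[OF U(1,2)] holomorphic2_on_slices(2)[OF U(1,3)]) auto
  qed (use U V eq xy in \<open>auto simp: f_def\<close>)
  then show ?thesis by (simp add: f_def)
qed

text \<open>The set \<open>T\<close> of points with a local quotient satisfying g B = h A is open,
  meets V, and is closed in the connected set D1 \<times> D2: a box that meets \<open>T\<close>
  overlaps a good box in an open set, on which the identity is transported through the common values
  of F. The conclusion concerns g and h, since F is arbitrary where h vanishes.\<close>

lemma meromorphic2_identity:
  assumes F: "meromorphic2 F" and D: "open D1" "connected D1" "open D2" "connected D2"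
    and A: "\<And>y. y \<in> D2 \<Longrightarrow> (\<lambda>x. A x y) holomorphic_on D1" "\<And>x. x \<in> D1 \<Longrightarrow> A x holomorphic_on D2"
    and B: "\<And>y. y \<in> D2 \<Longrightarrow> (\<lambda>x. B x y) holomorphic_on D1" "\<And>x. x \<in> D1 \<Longrightarrow> B x holomorphic_on D2"
    and V: "open V" "V \<noteq> {}" "V \<subseteq> D1 \<times> D2" "\<And>x y. (x, y) \<in> V \<Longrightarrow> F (x, y) * B x y = A x y"
    and p: "p \<in> D1 \<times> D2"
  shows "\<exists>U1 U2 g h. mero_rep F U1 U2 g h \<and> p \<in> U1 \<times> U2 \<and> U1 \<times> U2 \<subseteq> D1 \<times> D2 \<and>
           (\<forall>x\<in>U1. \<forall>y\<in>U2. g (x, y) * B x y = h (x, y) * A x y)"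
proof -
  define cross where "cross g h U1 U2 \<longleftrightarrow> (\<forall>x\<in>U1. \<forall>y\<in>U2. g (x, y) * B x y = h (x, y) * A x y)" for g h U1 U2
  define T where "T = {p. \<exists>U1 U2 g h. mero_rep F U1 U2 g h \<and> p \<in> U1 \<times> U2 \<and> U1 \<times> U2 \<subseteq> D1 \<times> D2 \<and>
           cross g h U1 U2}"
  have openD: "open (D1 \<times> D2)" using D by (intro open_Times)
  \<comment> \<open>An identity on the part of an open subset where \<open>h\<close> is nonzero
    spreads over the whole box, because that part is open and nonempty.\<close>
  have step: "U1 \<times> U2 \<subseteq> T"
    if rep: "mero_rep F U1 U2 g h" and sub: "U1 \<times> U2 \<subseteq> D1 \<times> D2"
      and W: "open W" "W \<noteq> {}" "W \<subseteq> U1 \<times> U2" "\<And>x y. (x, y) \<in> W \<Longrightarrow> h (x, y) \<noteq> 0 \<Longrightarrow> g (x, y) * B x y = h (x, y) * A x y"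
    for U1 U2 g h W
  proof -
    have U: "U1 \<subseteq> D1" "U2 \<subseteq> D2" using sub W by auto
    have "g (x, y) * B x y = h (x, y) * A x y" if "x \<in> U1" "y \<in> U2" for x y
    proof (rule mero_rep_cross_eq[OF rep, of A B "{q \<in> W. h q \<noteq> 0}"])
      show "open {q \<in> W. h q \<noteq> 0}" "{q \<in> W. h q \<noteq> 0} \<noteq> {}"
        using mero_rep_nonzero_set[OF rep W(1,3,2)] .
    qed (use U W that in \<open>auto intro: holomorphic_on_subset[OF A(1)] holomorphic_on_subset[OF A(2)]
           holomorphic_on_subset[OF B(1)] holomorphic_on_subset[OF B(2)]\<close>)
    then have rest: "cross g h U1 U2" by (simp add: cross_def)
    show ?thesis
    proof
      fix q assume "q \<in> U1 \<times> U2"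
      then show "q \<in> T" unfolding T_def mem_Collect_eq
        by (intro exI[of _ U1] exI[of _ U2] exI[of _ g] exI[of _ h] conjI rep sub rest)
    qed
  qed
  have loc: "\<exists>U1 U2 g h. mero_rep F U1 U2 g h \<and> q \<in> U1 \<times> U2 \<and> U1 \<times> U2 \<subseteq> D1 \<times> D2" if "q \<in> D1 \<times> D2" for q
    using meromorphic2_local_rep[OF F openD that] by metis
  have openU: "open (U1 \<times> U2)" if "mero_rep F U1 U2 g h" for U1 U2 g h
    using that unfolding mero_rep_def by (auto intro: open_Times)
  have "open T"
  proof (rule topological_space_class.openI)
    fix q assume "q \<in> T"
    then obtain U1 U2 g h where *: "mero_rep F U1 U2 g h" "q \<in> U1 \<times> U2" "U1 \<times> U2 \<subseteq> D1 \<times> D2"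
           "cross g h U1 U2" unfolding T_def by blast
    have "U1 \<times> U2 \<subseteq> T"
    proof
      fix q' assume "q' \<in> U1 \<times> U2"
      then show "q' \<in> T" unfolding T_def mem_Collect_eq
        by (intro exI[of _ U1] exI[of _ U2] exI[of _ g] exI[of _ h] conjI *)
    qed
    then show "\<exists>S. open S \<and> q \<in> S \<and> S \<subseteq> T"
      using *(2) openU[OF *(1)] by (intro exI[of _ "U1 \<times> U2"]) simp
  qed
  moreover have "open (D1 \<times> D2 - T)"
  proof (rule topological_space_class.openI)
    fix q assume q: "q \<in> D1 \<times> D2 - T"
    then obtain U1 U2 g h where rep: "mero_rep F U1 U2 g h" "q \<in> U1 \<times> U2" "U1 \<times> U2 \<subseteq> D1 \<times> D2"
      using loc by blast
    have "(U1 \<times> U2) \<inter> T = {}"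
    proof (rule ccontr)
      assume "\<not> (U1 \<times> U2) \<inter> T = {}"
      then obtain q' U1' U2' g' h' where q': "q' \<in> U1 \<times> U2" "mero_rep F U1' U2' g' h'" "q' \<in> U1' \<times> U2'"
           "cross g' h' U1' U2'" unfolding T_def by blast
      \<comment> \<open>On the overlap, \<open>h'\<close> must be nonzero for F B = A to be
        recovered from the cross-multiplied identity of the other box.\<close>
      define W where "W = {q \<in> U1 \<times> U2 \<inter> U1' \<times> U2'. h' q \<noteq> 0}"
      have "open (U1 \<times> U2 \<inter> U1' \<times> U2')" using openU[OF rep(1)] openU[OF q'(2)] by (rule open_Int)
      then have W: "open W" "W \<noteq> {}"
        unfolding W_def using mero_rep_nonzero_set[OF q'(2), of "U1 \<times> U2 \<inter> U1' \<times> U2'"] q' by blast+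
      have "g (x, y) * B x y = h (x, y) * A x y" if xy: "(x, y) \<in> W" "h (x, y) \<noteq> 0" for x y
      proof -
        have h': "x \<in> U1" "y \<in> U2" "x \<in> U1'" "y \<in> U2'" "h' (x, y) \<noteq> 0" using xy by (auto simp: W_def)
        have "h' (x, y) * (F (x, y) * B x y) = h' (x, y) * A x y"
        proof -
          have "g' (x, y) * B x y = h' (x, y) * A x y" using q'(4) h' by (simp add: cross_def)
          then show ?thesis unfolding mero_rep_eq[OF q'(2) h'(3-5)] by (simp only: mult_ac)
        qed
        then have "F (x, y) * B x y = A x y" using h' by simp
        moreover have "g (x, y) = F (x, y) * h (x, y)" by (rule mero_rep_eq[OF rep(1) h'(1,2) xy(2)])
        ultimately show ?thesis by (simp add: mult_ac)
      qed
      then have "U1 \<times> U2 \<subseteq> T" using step[OF rep(1,3) W] by (auto simp: W_def)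
      then show False using rep(2) q by blast
    qed
    then have "U1 \<times> U2 \<subseteq> D1 \<times> D2 - T" using rep(3) by blast
    then show "\<exists>S. open S \<and> q \<in> S \<and> S \<subseteq> D1 \<times> D2 - T"
      using rep(2) openU[OF rep(1)] by (intro exI[of _ "U1 \<times> U2"]) simp
  qed
  moreover have "T \<inter> (D1 \<times> D2) \<noteq> {}"
  proof -
    obtain q where q: "q \<in> V" using V by blast
    then obtain U1 U2 g h where rep: "mero_rep F U1 U2 g h" "q \<in> U1 \<times> U2" "U1 \<times> U2 \<subseteq> D1 \<times> D2"
      using loc V by blast
    have "U1 \<times> U2 \<subseteq> T"
    proof (rule step[OF rep(1,3), of "U1 \<times> U2 \<inter> V"])
      show "open (U1 \<times> U2 \<inter> V)" using openU[OF rep(1)] V(1) by (rule open_Int)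
      fix x y assume xy: "(x, y) \<in> U1 \<times> U2 \<inter> V" "h (x, y) \<noteq> 0"
      then have "g (x, y) = F (x, y) * h (x, y)" by (intro mero_rep_eq[OF rep(1)]) auto
      then show "g (x, y) * B x y = h (x, y) * A x y"
        using V(4)[of x y] xy by (simp add: mult_ac)
    qed (use q rep in auto)
    then show ?thesis using rep(2,3) by blast
  qed
  moreover have "connected (D1 \<times> D2)" using D by (intro connected_Times)
  ultimately have "(D1 \<times> D2 - T) \<inter> (D1 \<times> D2) = {}"
    using connectedD[of "D1 \<times> D2" T "D1 \<times> D2 - T"] by blast
  then have "p \<in> T" using p by blast
  then show ?thesis unfolding T_def cross_def by blast
qed

text \<open>Fix (a, b) in the box with h(a, b) \<noteq> 0. The zeros of h(a, y) in y are isolated,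
  and for every other y near u2 the slice h(x, y) is not identically 0 in x, so its zeros are
  isolated too. Close to u1, but not at u1, F therefore equals A / B.\<close>

lemma meromorphic2_inner_limit:
  assumes F: "meromorphic2 F" and D: "open D1" "connected D1" "open D2" "connected D2"
    and A: "\<And>y. y \<in> D2 \<Longrightarrow> (\<lambda>x. A x y) holomorphic_on D1" "\<And>x. x \<in> D1 \<Longrightarrow> A x holomorphic_on D2"
    and B: "\<And>y. y \<in> D2 \<Longrightarrow> (\<lambda>x. B x y) holomorphic_on D1" "\<And>x. x \<in> D1 \<Longrightarrow> B x holomorphic_on D2"
    and V: "open V" "V \<noteq> {}" "V \<subseteq> D1 \<times> D2" "\<And>x y. (x, y) \<in> V \<Longrightarrow> F (x, y) * B x y = A x y"
    and u: "u1 \<in> D1" "u2 \<in> D2" and B0: "\<forall>\<^sub>F y in at u2. B u1 y \<noteq> 0"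
  shows "\<forall>\<^sub>F y in at u2. ((\<lambda>x. F (x, y)) \<longlongrightarrow> A u1 y / B u1 y) (at u1)"
proof -
  obtain U1 U2 g h where rep: "mero_rep F U1 U2 g h" "u1 \<in> U1" "u2 \<in> U2" "U1 \<times> U2 \<subseteq> D1 \<times> D2"
    and eq: "\<And>x y. x \<in> U1 \<Longrightarrow> y \<in> U2 \<Longrightarrow> g (x, y) * B x y = h (x, y) * A x y"
    using meromorphic2_identity[OF F D A B V, of "(u1, u2)"] u by auto
  have U: "open U1" "open U2" "connected U1" "connected U2" "open (U1 \<times> U2)" "holomorphic2_on h (U1 \<times> U2)"
    using rep(1) unfolding mero_rep_def by (auto intro: open_Times)
  have sub: "U1 \<subseteq> D1" "U2 \<subseteq> D2" using rep by auto
  obtain a b where ab: "a \<in> U1" "b \<in> U2" "h (a, b) \<noteq> 0"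
    using mero_rep_nonzero_set(2)[OF rep(1), of "U1 \<times> U2"] U rep by blast
  have "(\<lambda>y. h (a, y)) holomorphic_on U2"
    using ab by (intro holomorphic2_on_slices(2)[OF U(5,6)]) auto
  then have "\<forall>\<^sub>F y in at u2. h (a, y) \<noteq> 0 \<and> y \<in> U2"
    using ab rep U by (intro non_zero_neighbour_alt[where \<beta> = b]) auto
  with B0 show ?thesis
  proof eventually_elim
    case (elim y)
    then have y: "y \<in> U2" "h (a, y) \<noteq> 0" "B u1 y \<noteq> 0" by auto
    have "(\<lambda>x. h (x, y)) holomorphic_on U1"
      using y by (intro holomorphic2_on_slices(1)[OF U(5,6)]) auto
    then have 1: "\<forall>\<^sub>F x in at u1. h (x, y) \<noteq> 0 \<and> x \<in> U1"
      using ab rep U y by (intro non_zero_neighbour_alt[where \<beta> = a]) auto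
    have cont: "isCont (\<lambda>x. f x y) u1" if "(\<lambda>x. f x y) holomorphic_on D1" for f :: "complex \<Rightarrow> complex \<Rightarrow> complex"
      using holomorphic_on_imp_continuous_on[OF that] continuous_on_eq_continuous_at[OF D(1)] u by blast
    have limA: "((\<lambda>x. A x y) \<longlongrightarrow> A u1 y) (at u1)" and limB: "((\<lambda>x. B x y) \<longlongrightarrow> B u1 y) (at u1)"
      using cont[of A] cont[of B] A(1)[of y] B(1)[of y] y sub by (auto simp: isCont_def)
    then have lim: "((\<lambda>x. A x y / B x y) \<longlongrightarrow> A u1 y / B u1 y) (at u1)"
      using y by (intro tendsto_intros)
    have 2: "\<forall>\<^sub>F x in at u1. B x y \<noteq> 0"
      using tendsto_imp_eventually_ne[OF limB] y by simp
    from 1 2 have "\<forall>\<^sub>F x in at u1. A x y / B x y = F (x, y)"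
    proof eventually_elim
      case (elim x)
      then have "g (x, y) = F (x, y) * h (x, y)" using y by (intro mero_rep_eq[OF rep(1)]) auto
      then have "h (x, y) * (F (x, y) * B x y) = h (x, y) * A x y"
        using eq[of x y] elim y by (simp add: mult_ac)
      then have "F (x, y) * B x y = A x y" using elim by simp
      then show ?case using elim by (simp add: field_simps)
    qed
    with lim show ?case by (rule Lim_transform_eventually)
  qed
qed

subsection \<open>The reverse value\<close>

definition zeta_num :: "complex \<Rightarrow> complex" where "zeta_num s = - ((s - 1) ^ 3 * deriv zeta s)"

definition zeta_den :: "complex \<Rightarrow> complex" where "zeta_den s = (s - 1) ^ 3 * zeta s"

lemma holomorphic_on_zeta_num [holomorphic_intros]:
  "f holomorphic_on A \<Longrightarrow> (\<lambda>z. zeta_num (f z)) holomorphic_on A"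
  using holomorphic_on_compose_gen[of f A zeta_num UNIV] holomorphic_on_minus[OF entire_zeta_factors(2)]
  by (simp add: zeta_num_def[abs_def] o_def)

lemma holomorphic_on_zeta_den [holomorphic_intros]:
  "f holomorphic_on A \<Longrightarrow> (\<lambda>z. zeta_den (f z)) holomorphic_on A"
  using holomorphic_on_compose_gen[of f A zeta_den UNIV] entire_zeta_factors(1)
  by (simp add: zeta_den_def[abs_def] o_def)

lemma zeta_den_times_mangoldt_series: "Re s > 2 \<Longrightarrow> zeta_den s * mangoldt_series s = zeta_num s"
  using zeta_times_mangoldt_series[of s] by (simp add: zeta_den_def zeta_num_def mult.assoc)

lemma zeta_num_den: "s \<noteq> 1 \<Longrightarrow> zeta_num s / zeta_den s = zeta_M s"
  by (simp add: zeta_num_def zeta_den_def zeta_M_def)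

definition Phi_coeff :: "complex \<Rightarrow> complex \<Rightarrow> nat \<Rightarrow> complex" where
  "Phi_coeff s1 s2 k = zeta_coeff s1 k * pochhammer s2 k"

text \<open>One factor for Gamma(w), one for M(w), and four for M(s2 + k) with k < 4, where w = s1 +
  s2 - 1; the product is entire in each variable. \<open>Phi_num\<close> is the expansion multiplied
  by it, and what remains there is holomorphic for s1 in \<open>regular\<close> and Re s2 >
  -2.\<close>

definition Phi_den :: "complex \<Rightarrow> complex \<Rightarrow> complex" where
  "Phi_den s1 s2 = rGamma (s1 + s2 - 1) * zeta_den (s1 + s2 - 1) * (\<Prod>k<4. zeta_den (s2 + of_nat k))"

definition Phi_num :: "complex \<Rightarrow> complex \<Rightarrow> complex" where
  "Phi_num s1 s2 = rGamma s2 * Gamma (1 - s1) * zeta_num (s1 + s2 - 1) * (\<Prod>k<4. zeta_den (s2 + of_nat k))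
     + rGamma (s1 + s2 - 1) * zeta_den (s1 + s2 - 1) *
       ((\<Sum>k<4. Phi_coeff s1 s2 k * zeta_num (s2 + of_nat k) * (\<Prod>j\<in>{..<4} - {k}. zeta_den (s2 + of_nat j)))
        + rGamma s2 * rem_series 4 s1 s2 * (\<Prod>k<4. zeta_den (s2 + of_nat k)))"

lemma holomorphic_on_pochhammer [holomorphic_intros]:
  "f holomorphic_on A \<Longrightarrow> (\<lambda>z. pochhammer (f z) k) holomorphic_on A"
  unfolding pochhammer_prod by (intro holomorphic_intros)

lemma holomorphic_Phi_den:
  "(\<lambda>s1. Phi_den s1 s2) holomorphic_on A" "Phi_den s1 holomorphic_on A"
  unfolding Phi_den_def by (intro holomorphic_intros)+

lemma holomorphic_Phi_num:
  "Re s2 > - 2 \<Longrightarrow> (\<lambda>s1. Phi_num s1 s2) holomorphic_on regular"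
  "s1 \<in> regular \<Longrightarrow> Phi_num s1 holomorphic_on {s2. Re s2 > - 2}"
proof -
  have n1: "s - of_nat k \<noteq> 1" if "s \<in> regular" for s k
    using that regular_minus_nat regular_neq_1 by blast
  have n2: "1 - s \<notin> \<int>\<^sub>\<le>\<^sub>0" if "s \<in> regular" for s
    using that by (simp add: regular_def)
  show "(\<lambda>s1. Phi_num s1 s2) holomorphic_on regular" if "Re s2 > - 2"
    unfolding Phi_num_def Phi_coeff_def using that n1 n2
    by (intro holomorphic_intros rem_series_holomorphic_left) auto
  show "Phi_num s1 holomorphic_on {s2. Re s2 > - 2}" if "s1 \<in> regular"
    unfolding Phi_num_def Phi_coeff_def using rem_series_holomorphic_right[OF that, of 4]
    by (intro holomorphic_intros) auto
qed

lemma Phi2_series_eq: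
  assumes s: "s1 \<in> regular" "Re s1 > 1" "Re s2 > 2"
  shows "Phi2_series s1 s2 * Phi_den s1 s2 = Phi_num s1 s2"
proof -
  define w where "w = s1 + s2 - 1"
  have w: "Re w > 2" using s by (simp add: w_def)
  have "w \<notin> \<int>\<^sub>\<le>\<^sub>0" using w by (auto elim!: nonpos_Ints_cases)
  then have G: "Gamma w * rGamma w = 1" by (simp add: rGamma_inverse_Gamma Gamma_eq_zero_iff)
  define P where "P = (\<Prod>k<4. zeta_den (s2 + of_nat k))"
  have num: "zeta_num (s2 + of_nat k) * (\<Prod>j\<in>{..<4} - {k}. zeta_den (s2 + of_nat j)) = mangoldt_series (s2 + of_nat k) * P" if "k < 4" for k
  proof -
    have "P = zeta_den (s2 + of_nat k) * (\<Prod>j\<in>{..<4} - {k}. zeta_den (s2 + of_nat j))"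
      unfolding P_def using that by (intro prod.remove) auto
    moreover have "zeta_den (s2 + of_nat k) * mangoldt_series (s2 + of_nat k) = zeta_num (s2 + of_nat k)"
      using s by (intro zeta_den_times_mangoldt_series) auto
    ultimately show ?thesis by (simp add: mult_ac)
  qed
  have S: "(\<Sum>k<4. Phi_coeff s1 s2 k * zeta_num (s2 + of_nat k) * (\<Prod>j\<in>{..<4} - {k}. zeta_den (s2 + of_nat j)))
      = (\<Sum>k<4. Phi_coeff s1 s2 k * mangoldt_series (s2 + of_nat k)) * P"
    unfolding sum_distrib_right using num by (intro sum.cong) (auto simp: mult.assoc)
  have "Phi2_series s1 s2 = rGamma s2 * Gamma (1 - s1) * Gamma w * mangoldt_series w
     + (\<Sum>k<4. Phi_coeff s1 s2 k * mangoldt_series (s2 + of_nat k)) + rGamma s2 * rem_series 4 s1 s2"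
    using Phi2_series_formula[OF s, of 4] by (simp only: w_def Phi_coeff_def)
  then have "Phi2_series s1 s2 * Phi_den s1 s2 =
      rGamma s2 * Gamma (1 - s1) * (Gamma w * rGamma w) * (zeta_den w * mangoldt_series w) * P
      + rGamma w * zeta_den w * ((\<Sum>k<4. Phi_coeff s1 s2 k * mangoldt_series (s2 + of_nat k)) * P + rGamma s2 * rem_series 4 s1 s2 * P)"
    unfolding Phi_den_def w_def[symmetric] P_def[symmetric] by (simp add: algebra_simps)
  also have "\<dots> = Phi_num s1 s2"
    unfolding G zeta_den_times_mangoldt_series[OF w] Phi_num_def S w_def[symmetric] P_def[symmetric] by simp
  finally show ?thesis .
qed

text \<open>Undoes the clearing of denominators: the quotient is again the expansion, now with
  \<open>zeta_M\<close> in place of \<open>mangoldt_series\<close>, so that the outer limit can be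
  taken term by term.\<close>

lemma Phi_num_den:
  assumes "Phi_den s1 s2 \<noteq> 0" "s1 + s2 \<noteq> 2" "\<And>k. k < 4 \<Longrightarrow> s2 + of_nat k \<noteq> 1"
  shows "Phi_num s1 s2 / Phi_den s1 s2 = rGamma s2 * Gamma (1 - s1) * Gamma (s1 + s2 - 1) * zeta_M (s1 + s2 - 1)
     + (\<Sum>k<4. Phi_coeff s1 s2 k * zeta_M (s2 + of_nat k)) + rGamma s2 * rem_series 4 s1 s2"
proof -
  define w where "w = s1 + s2 - 1"
  define P where "P = (\<Prod>k<4. zeta_den (s2 + of_nat k))"
  have nz: "rGamma w \<noteq> 0" "zeta_den w \<noteq> 0" "P \<noteq> 0"
    using assms(1) by (auto simp: Phi_den_def w_def P_def)
  have Mw: "zeta_num w = zeta_M w * zeta_den w"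
    using zeta_num_den[of w] assms(2) nz by (simp add: w_def field_simps)
  have num: "zeta_num (s2 + of_nat k) * (\<Prod>j\<in>{..<4} - {k}. zeta_den (s2 + of_nat j)) = zeta_M (s2 + of_nat k) * P" if k: "k < 4" for k
  proof -
    have *: "P = zeta_den (s2 + of_nat k) * (\<Prod>j\<in>{..<4} - {k}. zeta_den (s2 + of_nat j))"
      unfolding P_def using that by (intro prod.remove) auto
    then have "zeta_den (s2 + of_nat k) \<noteq> 0" using nz by auto
    then have "zeta_num (s2 + of_nat k) = zeta_M (s2 + of_nat k) * zeta_den (s2 + of_nat k)"
      using zeta_num_den[OF assms(3)[OF k]] by (simp add: field_simps)
    with * show ?thesis by (simp add: mult_ac)
  qed
  have S: "(\<Sum>k<4. Phi_coeff s1 s2 k * zeta_num (s2 + of_nat k) * (\<Prod>j\<in>{..<4} - {k}. zeta_den (s2 + of_nat j)))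
      = (\<Sum>k<4. Phi_coeff s1 s2 k * zeta_M (s2 + of_nat k)) * P"
    unfolding sum_distrib_right using num by (intro sum.cong) (auto simp: mult.assoc)
  have "Phi_num s1 s2 = (rGamma s2 * Gamma (1 - s1) * Gamma w * zeta_M w + (\<Sum>k<4. Phi_coeff s1 s2 k * zeta_M (s2 + of_nat k))
      + rGamma s2 * rem_series 4 s1 s2) * Phi_den s1 s2"
  proof -
    have G: "Gamma w * rGamma w = 1" using nz by (simp add: rGamma_inverse_Gamma)
    have "rGamma s2 * Gamma (1 - s1) * Gamma w * zeta_M w * Phi_den s1 s2 = rGamma s2 * Gamma (1 - s1) * zeta_num w * P"
    proof -
      have "rGamma s2 * Gamma (1 - s1) * Gamma w * zeta_M w * Phi_den s1 s2
          = rGamma s2 * Gamma (1 - s1) * (Gamma w * rGamma w) * (zeta_M w * zeta_den w) * P"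
        unfolding Phi_den_def w_def[symmetric] P_def[symmetric] by (simp only: mult_ac)
      then show ?thesis unfolding G Mw by simp
    qed
    moreover have "Phi_num s1 s2 = rGamma s2 * Gamma (1 - s1) * zeta_num w * P + rGamma w * zeta_den w *
       ((\<Sum>k<4. Phi_coeff s1 s2 k * zeta_M (s2 + of_nat k)) * P + rGamma s2 * rem_series 4 s1 s2 * P)"
      unfolding Phi_num_def S w_def[symmetric] P_def[symmetric] by simp
    moreover have "rGamma w * zeta_den w * ((\<Sum>k<4. Phi_coeff s1 s2 k * zeta_M (s2 + of_nat k)) * P + rGamma s2 * rem_series 4 s1 s2 * P)
       = ((\<Sum>k<4. Phi_coeff s1 s2 k * zeta_M (s2 + of_nat k)) + rGamma s2 * rem_series 4 s1 s2) * Phi_den s1 s2"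
      unfolding Phi_den_def w_def[symmetric] P_def[symmetric] by (simp add: algebra_simps)
    ultimately show ?thesis by (simp only: distrib_right add.assoc)
  qed
  then show ?thesis using assms(1) by (simp add: w_def)
qed

text \<open>Each factor is entire in s2 and does not vanish where its argument is 2 (for
  \<open>zeta_den\<close>) or 1 (for \<open>rGamma\<close>), so its zeros are isolated.\<close>

lemma eventually_Phi_den_nonzero:
  "\<forall>\<^sub>F s2 in at u2. Phi_den u1 s2 \<noteq> 0"
proof -
  have z2: "zeta_den 2 \<noteq> 0" using zeta_of_nat_nonzero[of 2] by (simp add: zeta_den_def)
  have 1: "\<forall>\<^sub>F s2 in at u2. zeta_den (s2 + c) \<noteq> 0 \<and> s2 \<in> UNIV" for c
    by (rule non_zero_neighbour_alt[where \<beta> = "2 - c"]) (use z2 in \<open>auto intro!: holomorphic_intros\<close>)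
  have 2: "\<forall>\<^sub>F s2 in at u2. rGamma (s2 + c) \<noteq> 0 \<and> s2 \<in> UNIV" for c :: complex
    by (rule non_zero_neighbour_alt[where \<beta> = "1 - c"]) (auto intro!: holomorphic_intros)
  have "\<forall>\<^sub>F s2 in at u2. \<forall>k\<in>{..<4}. zeta_den (s2 + of_nat k) \<noteq> 0"
    using 1 by (intro eventually_ball_finite) (auto elim: eventually_mono)
  then show ?thesis
    using 1[of "u1 - 1"] 2[of "u1 - 1"]
    by eventually_elim (auto simp: Phi_den_def algebra_simps)
qed

text \<open>The starting region asks for Re s1 > 1 and Re s2 > 2, where the expansion was proved,
  and for Im s1 > 0, which keeps it inside \<open>regular\<close>.\<close>

lemma meromorphic2_Phi_inner_limit:
  assumes \<Phi>: "is_Phi2 \<Phi>" and u: "u1 \<in> regular" "Re u2 > - 2"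
  shows "\<forall>\<^sub>F s2 in at u2. ((\<lambda>s1. \<Phi> (s1, s2)) \<longlongrightarrow> Phi_num u1 s2 / Phi_den u1 s2) (at u1)"
proof (rule meromorphic2_inner_limit[where V = "({s. Re s > 1} \<inter> {s. Im s > 0}) \<times> {s. Re s > 2}" and ?D1.0 = regular and ?D2.0 = "{s. Re s > - 2}" and A = Phi_num and B = Phi_den])
  let ?V1 = "{s. Re s > 1} \<inter> {s. Im s > 0}" and ?V2 = "{s. Re s > 2}"
  have V1: "?V1 \<subseteq> regular"
    by (auto simp: regular_def complex_eq_iff elim!: nonpos_Ints_cases)
  have "Complex 2 1 \<in> ?V1" "3 \<in> ?V2" by simp_all
  then show "?V1 \<times> ?V2 \<noteq> {}" by blast
  show "open (?V1 \<times> ?V2)"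
    by (intro open_Times open_Int open_halfspace_Re_gt open_halfspace_Im_gt)
  show "?V1 \<times> ?V2 \<subseteq> regular \<times> {s. Re s > - 2}" using V1 by auto
  show "\<Phi> (x, y) * Phi_den x y = Phi_num x y" if "(x, y) \<in> ?V1 \<times> ?V2" for x y
    using that V1 \<Phi> Phi2_series_eq[of x y] by (auto simp: is_Phi2_def)
  show "connected {s. Re s > - 2}" by (intro convex_connected convex_halfspace_Re_gt)
qed (use u \<Phi> in \<open>auto simp: is_Phi2_def open_regular connected_regular open_halfspace_Re_gt
       holomorphic_Phi_num holomorphic_Phi_den eventually_Phi_den_nonzero\<close>)

section \<open>Limits of the individual terms\<close>

lemma isCont_zeta_M: "s \<noteq> 1 \<Longrightarrow> zeta s \<noteq> 0 \<Longrightarrow> isCont zeta_M s"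
proof -
  assume s: "s \<noteq> 1" "zeta s \<noteq> 0"
  have "isCont zeta s" "isCont (deriv zeta) s"
    using s holomorphic_on_imp_continuous_on[OF zeta_holomorphic]
      holomorphic_on_imp_continuous_on[OF holomorphic_deriv[OF zeta_holomorphic]]
      continuous_on_eq_continuous_at[of "- {1 :: complex}"] by auto
  then show ?thesis unfolding zeta_M_def[abs_def] using s by (intro continuous_intros)
qed

text \<open>With zeta(w) = g(w) (w - \<rho>)^n and g nonzero near \<rho>, the logarithmic derivative
  is n / (w - \<rho>) + g' / g; the minus sign is that of M.\<close>

lemma zeta_M_residue:
  assumes \<rho>: "\<rho> \<noteq> 1"
  shows "((\<lambda>d. d * zeta_M (\<rho> + d)) \<longlongrightarrow> - of_int (zorder zeta \<rho>)) (at 0)"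
proof -
  define n where "n = nat (zorder zeta \<rho>)"
  define g where "g = zor_poly zeta \<rho>"
  have "connected (- {1 :: complex})" by (rule connected_punctured_universe) simp
  moreover have "\<exists>w\<in>- {1}. zeta w \<noteq> 0" using zeta_of_nat_nonzero[of 2] by (intro bexI[of _ 2]) auto
  ultimately have z: "(if zeta \<rho> = 0 then zorder zeta \<rho> > 0 else zorder zeta \<rho> = 0) \<and>
     (\<exists>r. r > 0 \<and> cball \<rho> r \<subseteq> - {1} \<and> g holomorphic_on cball \<rho> r
      \<and> (\<forall>w\<in>cball \<rho> r. zeta w = g w * (w - \<rho>) ^ n \<and> g w \<noteq> 0))"
    unfolding n_def g_def using \<rho> by (intro zorder_exist_zero[OF zeta_holomorphic]) auto
  then obtain r where r: "r > 0" "cball \<rho> r \<subseteq> - {1}" "g holomorphic_on cball \<rho> r"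
    and eq: "\<And>w. w \<in> cball \<rho> r \<Longrightarrow> zeta w = g w * (w - \<rho>) ^ n" and g0: "\<And>w. w \<in> cball \<rho> r \<Longrightarrow> g w \<noteq> 0" by blast
  have "zorder zeta \<rho> \<ge> 0" using z by (auto split: if_splits)
  then have n: "of_int (zorder zeta \<rho>) = (of_nat n :: complex)" by (simp add: n_def)
  have gb: "g holomorphic_on ball \<rho> r" using r by (auto intro: holomorphic_on_subset)
  have "continuous_on (ball \<rho> r) (\<lambda>w. (w - \<rho>) * deriv g w / g w)"
    using g0 by (intro continuous_intros holomorphic_on_imp_continuous_on gb holomorphic_deriv) auto
  then have "isCont (\<lambda>w. (w - \<rho>) * deriv g w / g w) \<rho>"
    using r continuous_on_eq_continuous_at[OF open_ball] centre_in_ball by blast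
  then have "((\<lambda>w. (w - \<rho>) * deriv g w / g w) \<longlongrightarrow> 0) (at \<rho>)"
    by (simp add: isCont_def)
  then have "((\<lambda>w. - ((w - \<rho>) * deriv g w / g w + of_nat n)) \<longlongrightarrow> - (0 + of_nat n)) (at \<rho>)"
    by (intro tendsto_intros)
  moreover have "\<forall>\<^sub>F w in at \<rho>. - ((w - \<rho>) * deriv g w / g w + of_nat n) = (w - \<rho>) * zeta_M w"
  proof -
    have "\<forall>\<^sub>F w in at \<rho>. w \<in> ball \<rho> r - {\<rho>}" using r by (intro eventually_at_in_open) auto
    then show ?thesis
    proof eventually_elim
      case (elim w)
      then have w: "w \<in> cball \<rho> r" "w \<in> ball \<rho> r" "w - \<rho> \<noteq> 0" by auto
      have "(g has_field_derivative deriv g w) (at w)"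
        using w gb by (intro holomorphic_derivI[OF gb]) auto
      then have "((\<lambda>w. g w * (w - \<rho>) ^ n) has_field_derivative
          deriv g w * (w - \<rho>) ^ n + g w * (of_nat n * (w - \<rho>) ^ (n - 1))) (at w)"
        by (auto intro!: derivative_eq_intros)
      then have "(zeta has_field_derivative deriv g w * (w - \<rho>) ^ n + g w * (of_nat n * (w - \<rho>) ^ (n - 1))) (at w)"
        by (rule has_field_derivative_transform_within_open[of _ _ _ "ball \<rho> r"]) (use w eq in auto)
      then have D: "deriv zeta w = deriv g w * (w - \<rho>) ^ n + g w * (of_nat n * (w - \<rho>) ^ (n - 1))"
        by (rule DERIV_imp_deriv)
      \<comment> \<open>The case n = 0 is treated apart because of the truncated subtraction in
        \<open>n - 1\<close>.\<close>
      have D': "(w - \<rho>) * deriv zeta w = ((w - \<rho>) * deriv g w + g w * of_nat n) * (w - \<rho>) ^ n"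
        unfolding D by (cases n) (auto simp: algebra_simps)
      then show ?case
      proof -
        have "(w - \<rho>) * zeta_M w = - ((w - \<rho>) * deriv zeta w) / zeta w" by (simp add: zeta_M_def)
        also have "\<dots> = - ((w - \<rho>) * deriv g w / g w + of_nat n)"
          unfolding D' eq[OF w(1)] using w g0[OF w(1)] by (simp add: field_simps)
        finally show ?thesis by simp
      qed
    qed
  qed
  ultimately have "((\<lambda>w. (w - \<rho>) * zeta_M w) \<longlongrightarrow> - (0 + of_nat n)) (at \<rho>)"
    by (rule Lim_transform_eventually)
  then have "((\<lambda>d. (\<rho> + d - \<rho>) * zeta_M (\<rho> + d)) \<longlongrightarrow> - (0 + of_nat n)) (at 0)"
    by (rule LIM_offset_zero)
  then show ?thesis by (simp add: n)
qed

text \<open>Raising the argument of Gamma(-l - z) by l + 1 leads to Gamma(1 - z), to which Euler's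
  reflection formula applies. The factors picked up on the way are z, ..., z + l in reverse order
  with l + 1 signs.\<close>

lemma Gamma_reflection_pochhammer:
  fixes z :: complex
  assumes z: "z \<notin> \<int>"
  shows "- ((- 1) ^ l * (Gamma (- of_nat l - z) * Gamma z)) = of_real pi / (pochhammer z (l + 1) * sin (of_real pi * z))"
proof -
  have "- of_nat l - z \<notin> \<int>"
  proof
    assume "- of_nat l - z \<in> \<int>"
    then have "- of_nat l - (- of_nat l - z) \<in> \<int>" by (intro Ints_diff) auto
    then show False using z by simp
  qed
  then have nn: "- of_nat l - z \<notin> \<int>\<^sub>\<le>\<^sub>0" using nonpos_Ints_Int by blast
  have p: "pochhammer z (l + 1) \<noteq> 0"
    using z by (auto simp: pochhammer_eq_0_iff)
  have "sin (of_real pi * z) \<noteq> 0"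
    using z by (auto simp: sin_eq_0)
  have "pochhammer (- of_nat l - z) (l + 1) = Gamma (1 - z) / Gamma (- of_nat l - z)"
    using pochhammer_Gamma[OF nn, of "l + 1"] by (simp add: algebra_simps)
  moreover have "pochhammer (- of_nat l - z) (l + 1) = (- 1) ^ (l + 1) * pochhammer z (l + 1)"
  proof -
    have "- of_nat l - z = - (z + of_nat l)" "z + of_nat l - of_nat (l + 1) + 1 = z" by simp_all
    then show ?thesis using pochhammer_minus[of "z + of_nat l" "l + 1"] by (simp only:)
  qed
  ultimately have "Gamma (1 - z) = (- 1) ^ (l + 1) * pochhammer z (l + 1) * Gamma (- of_nat l - z)"
    using nn Gamma_eq_zero_iff[of "- of_nat l - z"] by (metis nonzero_divide_eq_eq)
  then have "(- 1) ^ (l + 1) * pochhammer z (l + 1) * (Gamma (- of_nat l - z) * Gamma z) = of_real pi / sin (of_real pi * z)"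
    using Gamma_reflection_complex[of z] by (simp add: mult_ac)
  then show ?thesis
    using p \<open>sin (of_real pi * z) \<noteq> 0\<close> by (simp add: field_simps)
qed

text \<open>At s = -l the function \<open>rGamma\<close> has a simple zero with derivative (-1)^l
  l!, and M has residue - ord(\<rho>) at \<rho>; splitting off s + l from the one and giving it to
  the other leaves two finite limits.\<close>

lemma Phi_main_term_limit:
  assumes \<rho>: "\<rho> \<notin> \<int>"
  shows "((\<lambda>s. rGamma s * Gamma (1 - (1 + of_nat l + \<rho>)) * Gamma (1 + of_nat l + \<rho> + s - 1) * zeta_M (1 + of_nat l + \<rho> + s - 1))
     \<longlongrightarrow> of_real pi * fact l * of_int (zorder zeta \<rho>) / (pochhammer \<rho> (l + 1) * sin (of_real pi * \<rho>))) (at (- of_nat l))"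
proof -
  define u :: complex where "u = - of_nat l"
  have "((\<lambda>s. (rGamma s - rGamma u) / (s - u)) \<longlongrightarrow> (- 1) ^ l * fact l) (at u)"
    using has_field_derivative_rGamma_nonpos_int[of l UNIV] unfolding has_field_derivative_iff u_def by simp
  moreover have "rGamma u = 0" by (simp add: u_def rGamma_eq_zero_iff)
  ultimately have 1: "((\<lambda>s. rGamma s / (s - u)) \<longlongrightarrow> (- 1) ^ l * fact l) (at u)" by simp
  have "\<rho> \<noteq> 1" using \<rho> by auto
  have "((\<lambda>s. (s - u) * zeta_M (\<rho> + (s - u))) \<longlongrightarrow> - of_int (zorder zeta \<rho>)) (at u)"
    using LIM_offset[OF zeta_M_residue[OF \<open>\<rho> \<noteq> 1\<close>], of "- u"] by simp
  moreover have "isCont Gamma \<rho>" using \<rho> nonpos_Ints_Int by (intro continuous_intros) auto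
  then have "((\<lambda>s. Gamma (\<rho> + (s - u))) \<longlongrightarrow> Gamma \<rho>) (at u)"
    by (rule isCont_tendsto_compose) (auto intro!: tendsto_eq_intros)
  ultimately have "((\<lambda>s. rGamma s / (s - u) * Gamma (- of_nat l - \<rho>) * Gamma (\<rho> + (s - u)) * ((s - u) * zeta_M (\<rho> + (s - u)))) \<longlongrightarrow>
      (- 1) ^ l * fact l * Gamma (- of_nat l - \<rho>) * Gamma \<rho> * - of_int (zorder zeta \<rho>)) (at u)"
    by (intro tendsto_mult 1 tendsto_const)
  moreover have "\<forall>\<^sub>F s in at u. rGamma s / (s - u) * Gamma (- of_nat l - \<rho>) * Gamma (\<rho> + (s - u)) * ((s - u) * zeta_M (\<rho> + (s - u)))
      = rGamma s * Gamma (1 - (1 + of_nat l + \<rho>)) * Gamma (1 + of_nat l + \<rho> + s - 1) * zeta_M (1 + of_nat l + \<rho> + s - 1)"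
  proof -
    have "1 - (1 + of_nat l + \<rho>) = - of_nat l - \<rho>" "1 + of_nat l + \<rho> + s - 1 = \<rho> + (s - u)" for s
      by (simp_all add: u_def)
    then show ?thesis
      unfolding eventually_at_filter by (simp only:) (simp add: always_eventually)
  qed
  ultimately have "((\<lambda>s. rGamma s * Gamma (1 - (1 + of_nat l + \<rho>)) * Gamma (1 + of_nat l + \<rho> + s - 1) * zeta_M (1 + of_nat l + \<rho> + s - 1))
     \<longlongrightarrow> (- 1) ^ l * fact l * Gamma (- of_nat l - \<rho>) * Gamma \<rho> * - of_int (zorder zeta \<rho>)) (at u)"
    by (rule Lim_transform_eventually)
  moreover have "(- 1) ^ l * fact l * Gamma (- of_nat l - \<rho>) * Gamma \<rho> * - of_int (zorder zeta \<rho>)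
      = fact l * of_int (zorder zeta \<rho>) * - ((- 1) ^ l * (Gamma (- of_nat l - \<rho>) * Gamma \<rho>))"
    by (simp add: mult_ac)
  ultimately show ?thesis
    unfolding Gamma_reflection_pochhammer[OF \<rho>] u_def by (simp add: mult_ac)
qed

lemma Phi_coeff_limit:
  assumes "u \<noteq> 1" "zeta u \<noteq> 0" "u = s0 + of_nat k"
  shows "((\<lambda>s. Phi_coeff u1 s k * zeta_M (s + of_nat k)) \<longlongrightarrow> Phi_coeff u1 s0 k * zeta_M u) (at s0)"
proof -
  have "((\<lambda>s. zeta_M (s + of_nat k)) \<longlongrightarrow> zeta_M u) (at s0)"
    using isCont_zeta_M[OF assms(1,2)] by (rule isCont_tendsto_compose) (auto intro!: tendsto_eq_intros simp: assms(3))
  moreover have "isCont (\<lambda>s. pochhammer s k) s0"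
    unfolding pochhammer_prod by (intro continuous_intros)
  then have "((\<lambda>s. pochhammer s k) \<longlongrightarrow> pochhammer s0 k) (at s0)" by (simp add: isCont_def)
  ultimately show ?thesis unfolding Phi_coeff_def by (intro tendsto_intros)
qed

text \<open>For k \<le> l the coefficient at s = -l is the binomial coefficient times zeta(1 + l - k
  + \<rho>), and M is taken at -(l - k), so the summand k corresponds to the index l - k of the
  stated sum; k = l gives the term with M(0). For k > l + 1 the Pochhammer symbol vanishes and M is
  finite.\<close>

lemma Phi_sum_limit:
  assumes \<rho>: "\<rho> \<notin> \<int>" "zeta \<rho> = 0" and l: "l \<in> {0, 1}"
  shows "((\<lambda>s. \<Sum>k<4. Phi_coeff (1 + of_nat l + \<rho>) s k * zeta_M (s + of_nat k)) \<longlongrightarrow>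
      - of_real (ln (2 * pi)) * zeta (1 + \<rho>)
      + (\<Sum>k | 1 \<le> k \<and> k \<le> l \<and> odd k. of_nat (l choose k) * zeta_M (- of_nat k) * zeta (1 + of_nat k + \<rho>))) (at (- of_nat l))"
proof -
  define c where "c = Phi_coeff (1 + of_nat l + \<rho>)"
  define s0 :: complex where "s0 = - of_nat l"
  define e where "e k = (if k = l + 1 then 0 else c s0 k * zeta_M (s0 + of_nat k))" for k
  have zm1: "zeta (- 1) \<noteq> 0" using zeta_neg_nat[of 1] higher_deriv_bern_0_nonzero[of 1] by simp
  have z: "zeta (s0 + of_nat k) \<noteq> 0 \<and> s0 + of_nat k \<noteq> 1" if k: "k \<noteq> l + 1" for k
  proof (cases "k \<ge> l + 2")
    case True
    then have "s0 + of_nat k = of_nat (k - l)" by (simp add: s0_def of_nat_diff)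
    moreover have "k - l \<noteq> 1" "k - l \<ge> 2" using True by auto
    ultimately show ?thesis using zeta_of_nat_nonzero[of "k - l"] of_nat_eq_1_iff[of "k - l", where 'a = complex] by simp
  next
    case False
    then consider "l = k" | "l = 1" "k = 0" using k l by force
    then show ?thesis using zeta_0 zm1 by cases (auto simp: s0_def)
  qed
  have c0: "c s (l + 1) = 0" for s
    using \<rho> by (simp add: c_def Phi_coeff_def)
  have "((\<lambda>s. c s k * zeta_M (s + of_nat k)) \<longlongrightarrow> e k) (at s0)" for k
  proof (cases "k = l + 1")
    case True
    then show ?thesis using c0 by (simp add: e_def)
  next
    case False
    then show ?thesis unfolding c_def e_def using z[OF False] Phi_coeff_limit[of "s0 + of_nat k" s0 k] by simp
  qed
  then have "((\<lambda>s. \<Sum>k<4. c s k * zeta_M (s + of_nat k)) \<longlongrightarrow> (\<Sum>k<4. e k)) (at s0)"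
    by (rule tendsto_sum)
  moreover have "(\<Sum>k<4. e k) = - of_real (ln (2 * pi)) * zeta (1 + \<rho>)
      + (\<Sum>k | 1 \<le> k \<and> k \<le> l \<and> odd k. of_nat (l choose k) * zeta_M (- of_nat k) * zeta (1 + of_nat k + \<rho>))"
  proof -
    have sum4: "(\<Sum>k<4. e k) = e 0 + e 1 + e 2 + e 3" by (simp add: eval_nat_numeral lessThan_Suc add_ac)
    have set1: "{k. 1 \<le> k \<and> k \<le> (1 :: nat) \<and> odd k} = {1}" by auto
    consider "l = 0" | "l = 1" using l by auto
    then show ?thesis
    proof cases
      case 1
      then have "e 0 = zeta (1 + \<rho>) * zeta_M 0" "e 1 = 0" "e 2 = 0" "e 3 = 0"
        by (auto simp: e_def c_def s0_def Phi_coeff_def pochhammer_0_left)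
      then show ?thesis unfolding sum4 using 1 by (simp add: zeta_M_0)
    next
      case 2
      then have "e 0 = zeta (2 + \<rho>) * zeta_M (- 1)" "e 1 = zeta (1 + \<rho>) * zeta_M 0" "e 2 = 0" "e 3 = 0"
        by (auto simp: e_def c_def s0_def Phi_coeff_def pochhammer_rec eval_nat_numeral)
      then show ?thesis unfolding sum4 using 2 by (simp only: set1) (simp add: zeta_M_0)
    qed
  qed
  ultimately show ?thesis by (simp add: c_def s0_def)
qed

theorem proposition5p4:
  fixes \<Phi> :: "complex \<times> complex \<Rightarrow> complex" and \<rho> :: "nat \<Rightarrow> complex" and l n :: nat
  assumes "is_Phi2 \<Phi>"
    and "zero_numbering \<rho>"
    and "l \<in> {0, 1}" and "n \<ge> 1"
  shows "has_reverse_value \<Phi> (1 + of_nat l + \<rho> n) (- of_nat l)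
           (- of_real (ln (2 * pi)) * zeta (1 + \<rho> n)
            + of_real pi * fact l * of_int (zorder zeta (\<rho> n))
                / (pochhammer (\<rho> n) (l + 1) * sin (of_real pi * \<rho> n))
            + (\<Sum>k | 1 \<le> k \<and> k \<le> l \<and> odd k.
                 of_nat (l choose k) * zeta_M (- of_nat k) * zeta (1 + of_nat k + \<rho> n)))"
proof -
  have "\<rho> n \<in> nontrivial_zeros"
    using assms(2,4) by (auto simp: zero_numbering_def bij_betw_def)
  then have \<rho>: "\<rho> n \<notin> \<int>" "zeta (\<rho> n) = 0"
    using nontrivial_zeros_not_Ints by (auto simp: nontrivial_zeros_def)
  define u1 where "u1 = 1 + of_nat l + \<rho> n"
  define u2 :: complex where "u2 = - of_nat l"
  \<comment> \<open>The number 1 - u1 is -l - \<rho>, and \<rho> is not an integer.\<close>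
  have "1 - u1 \<notin> \<int>"
  proof
    assume "1 - u1 \<in> \<int>"
    then have "- of_nat l - (1 - u1) \<in> \<int>" by (intro Ints_diff) auto
    then show False using \<rho> by (simp add: u1_def)
  qed
  then have u1: "u1 \<in> regular" using nonpos_Ints_Int by (auto simp: regular_def)
  have u2: "Re u2 > - 2" using assms(3) by (auto simp: u2_def)
  define G where "G s = Phi_num u1 s / Phi_den u1 s" for s
  have inner: "\<forall>\<^sub>F s2 in at u2. ((\<lambda>s1. \<Phi> (s1, s2)) \<longlongrightarrow> G s2) (at u1)"
    unfolding G_def by (rule meromorphic2_Phi_inner_limit[OF assms(1) u1 u2])
  have "isCont (rem_series 4 u1) u2"
    using holomorphic_on_imp_continuous_on[OF rem_series_holomorphic_right[OF u1, of 4]] u2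
      continuous_on_eq_continuous_at[OF open_halfspace_Re_gt] by auto
  moreover have "isCont (rGamma :: complex \<Rightarrow> complex) u2"
    by (rule DERIV_isCont[OF has_field_derivative_rGamma])
  ultimately have "((\<lambda>s. rGamma s * rem_series 4 u1 s) \<longlongrightarrow> rGamma u2 * rem_series 4 u1 u2) (at u2)"
    unfolding isCont_def by (rule tendsto_mult[rotated])
  then have rest: "((\<lambda>s. rGamma s * rem_series 4 u1 s) \<longlongrightarrow> 0) (at u2)"
    by (simp add: u2_def rGamma_eq_zero_iff)
  let ?H = "\<lambda>s. rGamma s * Gamma (1 - u1) * Gamma (u1 + s - 1) * zeta_M (u1 + s - 1)
       + (\<Sum>k<4. Phi_coeff u1 s k * zeta_M (s + of_nat k)) + rGamma s * rem_series 4 u1 s"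
  let ?L1 = "of_real pi * fact l * of_int (zorder zeta (\<rho> n)) / (pochhammer (\<rho> n) (l + 1) * sin (of_real pi * \<rho> n))"
  let ?L2 = "- of_real (ln (2 * pi)) * zeta (1 + \<rho> n)"
  let ?L3 = "\<Sum>k | 1 \<le> k \<and> k \<le> l \<and> odd k. of_nat (l choose k) * zeta_M (- of_nat k) * zeta (1 + of_nat k + \<rho> n)"
  have lim: "(?H \<longlongrightarrow> ?L1 + (?L2 + ?L3) + 0) (at u2)"
    unfolding u1_def u2_def
    by (intro tendsto_add Phi_main_term_limit Phi_sum_limit \<rho> assms(3) rest[unfolded u1_def u2_def])
  \<comment> \<open>A punctured neighbourhood of u2 avoids the finitely many s at which M would be
    taken at the pole of zeta.\<close>
  have ne: "\<forall>\<^sub>F s in at u2. s \<noteq> c" for c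
    by (rule eventually_neq_at_within)
  have "\<forall>\<^sub>F s in at u2. \<forall>k\<in>{..<4}. s \<noteq> 1 - of_nat k"
    using ne by (intro eventually_ball_finite) auto
  with eventually_Phi_den_nonzero[of u1 u2] ne[of "2 - u1"]
  have "\<forall>\<^sub>F s in at u2. ?H s = G s"
  proof eventually_elim
    case (elim s)
    have "u1 + s \<noteq> 2" using elim by (auto simp: algebra_simps)
    moreover have "s + of_nat k \<noteq> 1" if "k < 4" for k using elim that by (auto simp: algebra_simps)
    ultimately show ?case unfolding G_def using Phi_num_den[OF elim(1)] by simp
  qed
  with lim have "(G \<longlongrightarrow> ?L1 + (?L2 + ?L3) + 0) (at u2)"
    by (rule Lim_transform_eventually)
  then have "(G \<longlongrightarrow> ?L2 + ?L1 + ?L3) (at u2)"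
    by (rule back_subst[where P = "\<lambda>L. (G \<longlongrightarrow> L) (at u2)"]) (simp only: add_ac add_0_left add_0_right)
  with inner show ?thesis
    unfolding has_reverse_value_def u1_def u2_def by blast
qed

end
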